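(* For all integers $k\ge1$ and all $\varepsilon'>0$, $0<d_0\le1$, provided $\varepsilon,\eta>0$ are small enough that $$\min\{\varepsilon',2^{-k}\}\ \ge\ 2^{2^{k+6}}k^3\big(\varepsilon^{1/16}+\eta^{1/32}\big)d_0^{-2^{k+1}},$$ the following holds for all $\mathcal P$ and all $d,d'\ge d_0$. Let $\{V_j\}_{0\le j\le k}$ be vertex sets, and let $\mathcal P$ be a density graph on $\{0,\dots,k\}$. Let $\mathcal G\le\Gamma$ be $(k+1)$-partite $(k+1)$-graphs on $V_0,\dots,V_k$ such that (1) for all complexes $R$ of the form $+2O^k(\mathbf a)$ or $O^{k+1}(\mathbf b)$, where $\mathbf a\in\{0,1,2\}^k$ and $\mathbf b\in\{0,1,2\}^{k+1}$, we have $\Gamma(R)=(1\pm\eta)\frac{\gamma(\emptyset)}{p(\emptyset)}\mathcal P(R)$; (2) $\mathcal G$ gives the same weight as $\Gamma$ to every edge except those of size $k+1$ and those in $V_{[k]}$; (3) the graph with the weights of $\mathcal G$ on edges of size $k+1$ and the weights of $\Gamma$ on edges of size at most $k$ is $(\varepsilon,d')$-regular with respect to $\Gamma$; (4) $\mathcal G[V_1,\dots,V_k]$ is $(\varepsilon,d)$-regular with respect to $\Gamma[V_1,\dots,V_k]$. Then there exists a set $V_0'\subseteq V_0$ with $\|V_0'\|_\Gamma\ge(1-\varepsilon')\|V_0\|_\Gamma$ such that for every $v\in V_0'$ the graph $\mathcal G_v$ is $(\varepsilon',dd')$-regular with respect to $\Gamma_v$.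
   Context: Write $x=a\pm b$ for $a-b\le x\le a+b$; $[k]=\{1,\dots,k\}$. A complex is a finite vertex set together with a down-closed family of subsets (edges, including $\emptyset$). A weighted hypergraph $\mathcal G$ on $V$ is a function $g$ from the power set of $V$ to the nonnegative reals (lower-case letters denote weight functions: $g,\gamma,p$ for $\mathcal G,\Gamma,\mathcal P$); it is an $m$-graph if $g(e)=1$ whenever $|e|\ge m+1$. $\mathcal G\le\Gamma$ means $g\le\gamma$ pointwise. Graphs and complexes are partite: the vertex set is partitioned into parts indexed by an index set $J$, a set is crossing if it meets each part in at most one vertex, and edges of partite complexes are crossing. For $f\subseteq J$, $V_f$ is the collection of crossing $|f|$-sets with one vertex in each $V_j$, $j\in f$. $\mathcal G[V_1,\dots,V_k]$ is the induced $k$-partite graph on these parts. For a $J$-partite complex $R$ and $J$-partite weighted hypergraph $\mathcal G$, $\mathcal G(R)=\mathbb E_\phi\big[\prod_{e\in R}g(\phi(e))\big]$, where $\phi$ is a uniformly random map sending each part of $R$ into the corresponding part of $\mathcal G$ (the product includes $e=\emptyset$ and singletons). A density graph $\mathcal P$ on $J$ is a weighted hypergraph with vertex set $J$ (one vertex per part) with $p(\emptyset)>0$; so $\mathcal P(R)=\prod_{e\in R}p(\pi(e))$ with $\pi(e)\subseteq J$ the set of indices of parts met by $e$. Octahedra: for a vector $\mathbf a$ of $m$ nonnegative integers, $O^m(\mathbf a)$ is the $m$-partite complex whose $j$th part has $\mathbf a_j$ vertices and whose edges are all crossing sets; $\mathbf1^m,\mathbf2^m$ are the constant vectors. $+2O^k(\mathbf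 a)$ is the $(k+1)$-partite complex (parts $0,1,\dots,k$) consisting of two copies of $O^{k+1}(1,\mathbf a)$ which share the single vertex in part $0$ and are otherwise vertex-disjoint. Regularity: let $\mathcal G,\Gamma$ be $m$-partite hypergraphs with the same parts, $g(e)=\gamma(e)$ for $|e|<m$ and $g(e)\le\gamma(e)$ for $|e|=m$. $\mathcal G$ is $(\varepsilon,d)$-regular with respect to $\Gamma$ if $\mathcal G(O^m(\mathbf1^m))=(d\pm\varepsilon)\Gamma(O^m(\mathbf1^m))$ and $\mathcal G(O^m(\mathbf2^m))\le(d^{2^m}+\varepsilon)\Gamma(O^m(\mathbf2^m))$. Link: for $v\in V_0$, $\mathcal G_v$ is the $k$-partite weighted hypergraph on $V_1,\dots,V_k$ with weights $g_v(e)=g(e)g(e\cup\{v\})$ ($e=\emptyset$ included). For $U\subseteq V_0$, $\|U\|_\Gamma=\mathbb E_{v\in V_0}[\mathbf1_{v\in U}\gamma(v)]$ with $v$ uniform in $V_0$. *)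

theory Defs
  imports Complex_Main "HOL-Library.FuncSet" "HOL-Library.Indicator_Function"
begin

text \<open>
  Vertex parts are families \<open>V :: nat \<Rightarrow> 'a set\<close> used on an index set \<open>J\<close>; weighted hypergraphs are
  weight functions \<open>g :: 'a set \<Rightarrow> real\<close> whose values matter only on subsets of the vertex set.
  Restricting the index set from \<open>J\<close> to \<open>J' \<subseteq> J\<close> while keeping \<open>g\<close> therefore gives the
  induced hypergraph on the parts \<open>V j\<close>, \<open>j \<in> J'\<close>.
\<close>

definition weighted_hypergraph :: "'a set \<Rightarrow> ('a set \<Rightarrow> real) \<Rightarrow> bool" where
  "weighted_hypergraph X g \<longleftrightarrow> (\<forall>e\<subseteq>X. 0 \<le> g e)"

definition m_graph :: "nat \<Rightarrow> 'a set \<Rightarrow> ('a set \<Rightarrow> real) \<Rightarrow> bool" where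
  "m_graph m X g \<longleftrightarrow> weighted_hypergraph X g \<and> (\<forall>e\<subseteq>X. m + 1 \<le> card e \<longrightarrow> g e = 1)"

definition density_graph :: "nat set \<Rightarrow> (nat set \<Rightarrow> real) \<Rightarrow> bool" where
  "density_graph J p \<longleftrightarrow> weighted_hypergraph J p \<and> 0 < p {}"

definition crossing :: "nat set \<Rightarrow> (nat \<Rightarrow> 'a set) \<Rightarrow> 'a set \<Rightarrow> bool" where
  "crossing J V e \<longleftrightarrow>
     e \<subseteq> (\<Union>j\<in>J. V j) \<and> (\<forall>j\<in>J. \<forall>x\<in>e \<inter> V j. \<forall>y\<in>e \<inter> V j. x = y)"

text \<open>\<open>V\<^sub>f\<close>: the crossing sets with exactly one vertex in each \<open>V j\<close>, \<open>j \<in> f\<close>, and no others.\<close>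

definition transversals :: "(nat \<Rightarrow> 'a set) \<Rightarrow> nat set \<Rightarrow> 'a set set" where
  "transversals V f = {e. e \<subseteq> (\<Union>j\<in>f. V j) \<and> (\<forall>j\<in>f. card (e \<inter> V j) = 1)}"

text \<open>A partite complex is a pair of its family of parts and its set of edges.\<close>

type_synonym 'v partite_complex = "(nat \<Rightarrow> 'v set) \<times> 'v set set"

definition partite_maps ::
    "nat set \<Rightarrow> (nat \<Rightarrow> 'v set) \<Rightarrow> (nat \<Rightarrow> 'a set) \<Rightarrow> ('v \<Rightarrow> 'a) set" where
  "partite_maps J W V =
     {\<phi> \<in> (\<Union>j\<in>J. W j) \<rightarrow>\<^sub>E (\<Union>j\<in>J. V j). \<forall>j\<in>J. \<phi> ` W j \<subseteq> V j}"

text \<open>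
  \<open>hom_density J V g R\<close> is \<open>\<G>(R)\<close>, the expectation over a uniformly random partite map. For a
  density graph \<open>p\<close> on \<open>J\<close> the parts are the singletons \<open>{j}\<close>, so that there is only one such map.
\<close>

definition hom_density ::
    "nat set \<Rightarrow> (nat \<Rightarrow> 'a set) \<Rightarrow> ('a set \<Rightarrow> real) \<Rightarrow> 'v partite_complex \<Rightarrow> real" where
  "hom_density J V g R =
     (\<Sum>\<phi>\<in>partite_maps J (fst R) V. \<Prod>e\<in>snd R. g (\<phi> ` e)) /
     real (card (partite_maps J (fst R) V))"

abbreviation density_graph_density ::
    "nat set \<Rightarrow> (nat set \<Rightarrow> real) \<Rightarrow> 'v partite_complex \<Rightarrow> real" where
  "density_graph_density J p R \<equiv> hom_density J (\<lambda>j. {j}) p R"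

text \<open>
  Octahedra are indexed by a set \<open>J\<close> rather than by \<open>1, \<dots>, m\<close>; vertex \<open>i\<close> of part \<open>j\<close> is
  the pair \<open>(j, i)\<close>.
\<close>

definition octahedron :: "nat set \<Rightarrow> (nat \<Rightarrow> nat) \<Rightarrow> (nat \<times> nat) partite_complex" where
  "octahedron J a = (let W = (\<lambda>j. {j} \<times> {..<a j}) in (W, {e. crossing J W e}))"

text \<open>
  \<open>+2O\<^sup>k(a)\<close>: for \<open>j \<ge> 1\<close> the part \<open>j\<close> consists of the pairs \<open>(j, i)\<close> with \<open>i < 2 * a j\<close>; those with
  \<open>i < a j\<close> belong to copy \<open>0\<close>, the remaining ones to copy \<open>1\<close>. Both copies contain \<open>(0, 0)\<close>.
\<close>

definition plus2_copy :: "nat \<Rightarrow> (nat \<Rightarrow> nat) \<Rightarrow> nat \<Rightarrow> (nat \<times> nat) set" where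
  "plus2_copy k a c = insert (0, 0) (SIGMA j:{1..k}. {c * a j..<(c + 1) * a j})"

definition plus2_octahedron :: "nat \<Rightarrow> (nat \<Rightarrow> nat) \<Rightarrow> (nat \<times> nat) partite_complex" where
  "plus2_octahedron k a =
     (let W = (\<lambda>j. if j = 0 then {(0, 0)} else {j} \<times> {..<2 * a j})
      in (W, {e. crossing {0..k} W e \<and> (e \<subseteq> plus2_copy k a 0 \<or> e \<subseteq> plus2_copy k a 1)}))"

text \<open>
  \<open>(\<epsilon>, d)\<close>-regularity of the \<open>m\<close>-partite hypergraph \<open>g\<close> with respect to \<open>\<gamma>\<close>, where \<open>m = card J\<close>.
  The first two conjuncts are the standing requirements on the pair \<open>g\<close>, \<open>\<gamma>\<close>.
\<close>

definition regular_wrt ::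
    "nat set \<Rightarrow> (nat \<Rightarrow> 'a set) \<Rightarrow> real \<Rightarrow> real \<Rightarrow> ('a set \<Rightarrow> real) \<Rightarrow> ('a set \<Rightarrow> real) \<Rightarrow> bool" where
  "regular_wrt J V \<epsilon> d g \<gamma> \<longleftrightarrow>
     (\<forall>e. crossing J V e \<and> card e < card J \<longrightarrow> g e = \<gamma> e) \<and>
     (\<forall>e. crossing J V e \<and> card e = card J \<longrightarrow> g e \<le> \<gamma> e) \<and>
     hom_density J V g (octahedron J (\<lambda>_. 1))
       \<in> {(d - \<epsilon>) * hom_density J V \<gamma> (octahedron J (\<lambda>_. 1))
          .. (d + \<epsilon>) * hom_density J V \<gamma> (octahedron J (\<lambda>_. 1))} \<and>
     hom_density J V g (octahedron J (\<lambda>_. 2))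
       \<le> (d ^ (2 ^ card J) + \<epsilon>) * hom_density J V \<gamma> (octahedron J (\<lambda>_. 2))"

definition link :: "('a set \<Rightarrow> real) \<Rightarrow> 'a \<Rightarrow> 'a set \<Rightarrow> real" where
  "link g v e = g e * g (insert v e)"

definition vertex_weight :: "'a set \<Rightarrow> ('a set \<Rightarrow> real) \<Rightarrow> 'a set \<Rightarrow> real" where
  "vertex_weight V\<^sub>0 \<gamma> U = (\<Sum>v\<in>V\<^sub>0. indicator U v * \<gamma> {v}) / real (card V\<^sub>0)"

end

theory Submission
  imports Defs "HOL-Analysis.Convex"
begin

text \<open>
  Put \<open>K = 2 ^ k\<close>. Whether the link of a vertex \<open>v\<close> of \<open>V 0\<close> is regular is decided by two numbers, the
  densities of the simple octahedron (one vertex per part) and of the doubled octahedron (two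
  vertices per part) in it. Averaged over \<open>v\<close> they become counts in the hypergraph itself. Relative
  to \<open>\<gamma>\<close>, the average of the first is at least \<open>d * d'\<close> and the average of the second is at most
  \<open>(d * d') ^ K\<close>, up to small errors (\<open>g_first_moment\<close>, \<open>g_high_moment\<close>). Inside a single link, however,
  the Cauchy-Schwarz inequality, applied to one part after the other, bounds the second relative
  density from below by the \<open>K\<close>-th power of the first (\<open>X_power_le_Y\<close>). By convexity the three bounds
  are compatible only if all of them are nearly equalities for almost every \<open>v\<close>
  (\<open>moment_concentration\<close>), and this is the claim.

  For the averages, fix the vertices in \<open>V 1, \<dots>, V k\<close> and consider the weighted number of vertices in
  \<open>V 0\<close> that complete them to an octahedron. Its first two moments, over the \<open>\<gamma>\<close>-weighted octahedra on
  \<open>V 1, \<dots>, V k\<close>, are counts in the hypergraph whose only edges of weight \<open>g\<close> are those of size \<open>k + 1\<close>.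
  The regularity of that hypergraph controls the counts of the fully doubled and of the fully
  simple octahedron, and the Cauchy-Schwarz chain \<open>top_chain\<close> carries these bounds to the mixed
  octahedra that are needed. So the number of completions is almost constant in mean square. Passing
  to the weights of \<open>g\<close> on the edges in \<open>V 1, \<dots>, V k\<close> can only decrease the weight of an octahedron,
  so the almost constant factor can be taken out (\<open>avg_perturb\<close>), and what remains is a count
  controlled by the regularity of \<open>g\<close> on these parts.

  The Cauchy-Schwarz chain inside a link also needs the octahedron densities in the link of \<open>\<gamma>\<close> to
  have their expected values. Their second moments over \<open>v\<close> are the counts of two octahedra
  sharing a vertex (\<open>plus2_second_moment\<close>), so by Chebyshev's inequality they are concentrated
  (\<open>link_variance\<close>, \<open>atypical_mass\<close>).

  All of this presupposes that the densities do not vanish. If \<open>\<gamma> {}\<close> or some value of \<open>p\<close> is zero,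
  then all octahedron densities in question are zero in every link and there is nothing to prove.
\<close>

section \<open>Averages over random partite maps\<close>

definition avg :: "'b set \<Rightarrow> ('b \<Rightarrow> real) \<Rightarrow> real" where
  "avg S f = sum f S / real (card S)"

lemma avg_mono: "(\<And>x. x \<in> S \<Longrightarrow> f x \<le> h x) \<Longrightarrow> avg S f \<le> avg S h"
  unfolding avg_def by (intro divide_right_mono sum_mono) auto

lemma avg_cong: "(\<And>x. x \<in> S \<Longrightarrow> f x = h x) \<Longrightarrow> avg S f = avg S h"
  unfolding avg_def by simp

lemma avg_nonneg: "(\<And>x. x \<in> S \<Longrightarrow> 0 \<le> f x) \<Longrightarrow> 0 \<le> avg S f"
  unfolding avg_def by (intro divide_nonneg_nonneg sum_nonneg) auto

lemma avg_add: "avg S (\<lambda>x. f x + h x) = avg S f + avg S h"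
  by (simp add: avg_def sum.distrib add_divide_distrib)

lemma avg_diff: "avg S (\<lambda>x. f x - h x) = avg S f - avg S h"
  by (simp add: avg_def sum_subtractf diff_divide_distrib)

lemma avg_cmult: "avg S (\<lambda>x. c * f x) = c * avg S f"
  by (simp add: avg_def sum_distrib_left)

lemma avg_cmult_right: "avg S (\<lambda>x. f x * c) = avg S f * c"
  by (simp add: avg_def sum_distrib_right)

lemma avg_swap: "avg S (\<lambda>x. avg T (\<lambda>y. f x y)) = avg T (\<lambda>y. avg S (\<lambda>x. f x y))"
  unfolding avg_def sum_divide_distrib[symmetric] by (subst sum.swap) (simp add: mult.commute)

lemma avg_singleton: "avg {x} f = f x"
  by (simp add: avg_def)

lemma avg_abs: "\<bar>avg S f\<bar> \<le> avg S (\<lambda>x. \<bar>f x\<bar>)"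
  by (simp add: avg_def divide_right_mono)

lemma avg_eq_0_D:
  assumes "avg S f = 0" "finite S" "\<And>x. x \<in> S \<Longrightarrow> 0 \<le> f x" "x \<in> S"
  shows "f x = 0"
proof -
  have "card S \<noteq> 0" using assms by auto
  then have "sum f S = 0" using assms(1) by (auto simp: avg_def)
  then show ?thesis using assms sum_nonneg_eq_0_iff by blast
qed

lemma avg_Cauchy_Schwarz:
  assumes "\<And>x. x \<in> S \<Longrightarrow> 0 \<le> A x"
  shows "(avg S (\<lambda>x. A x * D x))\<^sup>2 \<le> avg S A * avg S (\<lambda>x. A x * (D x)\<^sup>2)"
proof -
  have "(\<Sum>x\<in>S. A x * D x) = (\<Sum>x\<in>S. sqrt (A x) * (sqrt (A x) * D x))"
    using assms by (intro sum.cong) (auto simp flip: mult.assoc)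
  moreover have "(\<Sum>x\<in>S. (sqrt (A x))\<^sup>2) = sum A S"
    using assms by (intro sum.cong) auto
  moreover have "(\<Sum>x\<in>S. (sqrt (A x) * D x)\<^sup>2) = (\<Sum>x\<in>S. A x * (D x)\<^sup>2)"
    using assms by (intro sum.cong) (auto simp: power_mult_distrib)
  ultimately have "(\<Sum>x\<in>S. A x * D x)\<^sup>2 \<le> sum A S * (\<Sum>x\<in>S. A x * (D x)\<^sup>2)"
    using Cauchy_Schwarz_ineq_sum[of "\<lambda>x. sqrt (A x)" "\<lambda>x. sqrt (A x) * D x" S] by simp
  then show ?thesis
    by (simp add: avg_def power_divide power2_eq_square divide_right_mono)
qed

text \<open>
  The vertices of all complexes are pairs whose first component names the part. An octahedron is
  therefore determined by its vertex set \<open>X\<close>: its edges are the sets in \<open>cross X\<close>, and \<open>count V g X\<close> is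
  its density. The weight \<open>wt_at g X v\<close> collects the edges through one additional vertex, which lies
  in a part that \<open>X\<close> does not meet and is mapped to \<open>v\<close>.
\<close>

definition maps :: "(nat \<Rightarrow> 'a set) \<Rightarrow> (nat \<times> nat) set \<Rightarrow> (nat \<times> nat \<Rightarrow> 'a) set" where
  "maps V X = (\<Pi>\<^sub>E z\<in>X. V (fst z))"

definition cross :: "(nat \<times> nat) set \<Rightarrow> (nat \<times> nat) set set" where
  "cross X = {e. e \<subseteq> X \<and> inj_on fst e}"

definition wt :: "('a set \<Rightarrow> real) \<Rightarrow> (nat \<times> nat) set \<Rightarrow> (nat \<times> nat \<Rightarrow> 'a) \<Rightarrow> real" where
  "wt g X \<phi> = (\<Prod>e\<in>cross X. g (\<phi> ` e))"

definition wt_at :: "('a set \<Rightarrow> real) \<Rightarrow> (nat \<times> nat) set \<Rightarrow> 'a \<Rightarrow> (nat \<times> nat \<Rightarrow> 'a) \<Rightarrow> real" where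
  "wt_at g X v \<phi> = (\<Prod>e\<in>cross X. g (insert v (\<phi> ` e)))"

definition count :: "(nat \<Rightarrow> 'a set) \<Rightarrow> ('a set \<Rightarrow> real) \<Rightarrow> (nat \<times> nat) set \<Rightarrow> real" where
  "count V g X = avg (maps V X) (wt g X)"

lemma finite_cross: "finite X \<Longrightarrow> finite (cross X)"
  by (rule finite_subset[of _ "Pow X"]) (auto simp: cross_def)

lemma wt_link: "wt (link g v) X \<phi> = wt g X \<phi> * wt_at g X v \<phi>"
  by (simp add: wt_def wt_at_def link_def prod.distrib)

text \<open>
  A crossing set contains at most one vertex of the additional part \<open>j\<close>.
\<close>

lemma cross_cylinder:
  assumes "j \<notin> fst ` X"
  shows "cross (X \<union> {j} \<times> T) = cross X \<union> (\<Union>t\<in>T. insert (j, t) ` cross X)"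
proof (intro equalityI subsetI)
  fix e assume e: "e \<in> cross (X \<union> {j} \<times> T)"
  show "e \<in> cross X \<union> (\<Union>t\<in>T. insert (j, t) ` cross X)"
  proof (cases "e \<subseteq> X")
    case True
    then show ?thesis using e by (auto simp: cross_def)
  next
    case False
    then obtain t where t: "t \<in> T" "(j, t) \<in> e" using e by (auto simp: cross_def)
    have "e - {(j, t)} \<subseteq> X"
    proof
      fix z assume z: "z \<in> e - {(j, t)}"
      have "fst z \<noteq> j"
        using e t z unfolding cross_def inj_on_def by (metis (mono_tags, lifting) DiffE fst_conv insertI1 mem_Collect_eq)
      then show "z \<in> X" using e z by (auto simp: cross_def)
    qed
    then have "e - {(j, t)} \<in> cross X" using e by (auto simp: cross_def inj_on_def)
    moreover have "e = insert (j, t) (e - {(j, t)})" using t by auto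
    ultimately show ?thesis using t by blast
  qed
next
  fix e assume "e \<in> cross X \<union> (\<Union>t\<in>T. insert (j, t) ` cross X)"
  then show "e \<in> cross (X \<union> {j} \<times> T)"
    using assms by (auto simp: cross_def inj_on_def image_iff; force)
qed

lemma prod_cross_cylinder:
  fixes F :: "(nat \<times> nat) set \<Rightarrow> real"
  assumes X: "finite X" "j \<notin> fst ` X" and T: "finite T"
  shows "(\<Prod>e\<in>cross (X \<union> {j} \<times> T). F e) =
    (\<Prod>e\<in>cross X. F e) * (\<Prod>t\<in>T. \<Prod>e\<in>cross X. F (insert (j, t) e))"
proof -
  have nin: "(j, t) \<notin> e" if "e \<in> cross X" for e t
    using that X(2) by (force simp: cross_def)
  have inj: "inj_on (insert (j, t)) (cross X)" for t
    by (rule inj_onI) (metis insert_ident nin)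
  have "(\<Prod>e\<in>cross (X \<union> {j} \<times> T). F e) =
      (\<Prod>e\<in>cross X. F e) * (\<Prod>e\<in>(\<Union>t\<in>T. insert (j, t) ` cross X). F e)"
    unfolding cross_cylinder[OF X(2)] using X T finite_cross nin
    by (intro prod.union_disjoint) auto
  also have "(\<Prod>e\<in>(\<Union>t\<in>T. insert (j, t) ` cross X). F e) =
      (\<Prod>t\<in>T. \<Prod>e\<in>insert (j, t) ` cross X. F e)"
    using X T finite_cross nin by (intro prod.UNION_disjoint) fastforce+
  also have "\<dots> = (\<Prod>t\<in>T. \<Prod>e\<in>cross X. F (insert (j, t) e))"
    by (simp add: prod.reindex[OF inj])
  finally show ?thesis .
qed

text \<open>
  Random maps on disjoint vertex sets are independent.
\<close>

lemma avg_maps_Un: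
  assumes X: "finite X" "finite Y" "X \<inter> Y = {}"
  shows "avg (maps V (X \<union> Y)) F =
    avg (maps V X) (\<lambda>\<alpha>. avg (maps V Y) (\<lambda>\<beta>. F (\<lambda>z. if z \<in> X then \<alpha> z else \<beta> z)))"
proof -
  have card: "card (maps V (X \<union> Y)) = card (maps V X) * card (maps V Y)"
    unfolding maps_def using X by (simp add: card_PiE prod.union_disjoint)
  have "sum F (maps V (X \<union> Y)) =
      (\<Sum>(\<alpha>, \<beta>)\<in>maps V X \<times> maps V Y. F (\<lambda>z. if z \<in> X then \<alpha> z else \<beta> z))"
  proof (rule sum.reindex_bij_witness
      [of _ "\<lambda>(\<alpha>, \<beta>) z. if z \<in> X then \<alpha> z else \<beta> z" "\<lambda>\<phi>. (restrict \<phi> X, restrict \<phi> Y)"])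
    fix \<phi> assume \<phi>: "\<phi> \<in> maps V (X \<union> Y)"
    then show "(restrict \<phi> X, restrict \<phi> Y) \<in> maps V X \<times> maps V Y"
      by (simp add: maps_def PiE_iff)
    have "(\<lambda>z. if z \<in> X then restrict \<phi> X z else restrict \<phi> Y z) = \<phi>"
      using PiE_arb[OF \<phi>[unfolded maps_def]] by (intro ext) simp
    then show "(case (restrict \<phi> X, restrict \<phi> Y) of (\<alpha>, \<beta>) \<Rightarrow> \<lambda>z. if z \<in> X then \<alpha> z else \<beta> z) = \<phi>"
      and "(case (restrict \<phi> X, restrict \<phi> Y) of
          (\<alpha>, \<beta>) \<Rightarrow> F (\<lambda>z. if z \<in> X then \<alpha> z else \<beta> z)) = F \<phi>"
      by simp_all
  next
    fix b assume b: "b \<in> maps V X \<times> maps V Y"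
    obtain \<alpha> \<beta> where ab: "b = (\<alpha>, \<beta>)" "\<alpha> \<in> maps V X" "\<beta> \<in> maps V Y"
      using b by auto
    show "(case b of (\<alpha>, \<beta>) \<Rightarrow> \<lambda>z. if z \<in> X then \<alpha> z else \<beta> z) \<in> maps V (X \<union> Y)"
      using ab by (simp add: maps_def PiE_iff extensional_def; blast)
    have arb: "z \<notin> X \<Longrightarrow> \<alpha> z = undefined" "z \<notin> Y \<Longrightarrow> \<beta> z = undefined" for z
      using PiE_arb[OF ab(2)[unfolded maps_def]] PiE_arb[OF ab(3)[unfolded maps_def]] by auto
    have "restrict (\<lambda>z. if z \<in> X then \<alpha> z else \<beta> z) X = \<alpha>"
      using arb by (intro ext) simp
    moreover have "restrict (\<lambda>z. if z \<in> X then \<alpha> z else \<beta> z) Y = \<beta>"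
      using arb X by (intro ext) auto
    ultimately show "(restrict (case b of (\<alpha>, \<beta>) \<Rightarrow> \<lambda>z. if z \<in> X then \<alpha> z else \<beta> z) X,
        restrict (case b of (\<alpha>, \<beta>) \<Rightarrow> \<lambda>z. if z \<in> X then \<alpha> z else \<beta> z) Y) = b"
      using ab by simp
  qed
  also have "\<dots> = (\<Sum>\<alpha>\<in>maps V X. \<Sum>\<beta>\<in>maps V Y. F (\<lambda>z. if z \<in> X then \<alpha> z else \<beta> z))"
    by (simp add: sum.cartesian_product)
  finally show ?thesis
    by (simp add: avg_def card flip: sum_divide_distrib)
qed

lemma avg_maps_part:
  assumes "finite (V j)" "finite T"
  shows "avg (maps V ({j} \<times> T)) (\<lambda>\<beta>. \<Prod>t\<in>T. f (\<beta> (j, t))) = avg (V j) f ^ card T"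
proof -
  have re: "(\<Prod>z\<in>{j} \<times> T. h z) = (\<Prod>t\<in>T. h (j, t))" for h :: "nat \<times> nat \<Rightarrow> real"
    by (rule prod.reindex_bij_witness[of _ "\<lambda>t. (j, t)" snd]) auto
  have "(\<Prod>z\<in>{j} \<times> T. card (V (fst z))) = (\<Prod>z\<in>{j} \<times> T. card (V j))"
    by (rule prod.cong) auto
  then have card: "(\<Prod>z\<in>{j} \<times> T. card (V (fst z))) = card (V j) ^ card T"
    by (simp add: card_cartesian_product)
  have "(\<Sum>\<beta>\<in>maps V ({j} \<times> T). \<Prod>t\<in>T. f (\<beta> (j, t))) =
      (\<Sum>\<beta>\<in>maps V ({j} \<times> T). \<Prod>z\<in>{j} \<times> T. f (\<beta> z))"
    by (simp add: re)
  also have "\<dots> = (\<Prod>z\<in>{j} \<times> T. \<Sum>x\<in>V (fst z). f x)"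
    unfolding maps_def using assms by (intro prod_sum_PiE[symmetric]) auto
  also have "\<dots> = sum f (V j) ^ card T"
    by (simp add: re)
  finally have "(\<Sum>\<beta>\<in>maps V ({j} \<times> T). \<Prod>t\<in>T. f (\<beta> (j, t))) = sum f (V j) ^ card T" .
  moreover have "card (maps V ({j} \<times> T)) = card (V j) ^ card T"
    unfolding maps_def using assms by (subst card_PiE) (simp_all add: card)
  ultimately show ?thesis
    by (simp add: avg_def power_divide)
qed

text \<open>
  No edge contains two vertices of part \<open>j\<close>. Once the images of the other vertices are chosen, the
  vertices of part \<open>j\<close> therefore contribute independent factors with the same expectation, and the
  count is a moment of this conditional expectation whose order is the size of part \<open>j\<close>.
\<close>

lemma count_slice:
  assumes X: "finite X" "j \<notin> fst ` X" and T: "finite T" and V: "finite (V j)"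
  shows "count V g (X \<union> {j} \<times> T) =
    avg (maps V X) (\<lambda>\<alpha>. wt g X \<alpha> * avg (V j) (\<lambda>x. wt_at g X x \<alpha>) ^ card T)"
proof -
  have disj: "X \<inter> {j} \<times> T = {}" using X by force
  have "wt g (X \<union> {j} \<times> T) (\<lambda>z. if z \<in> X then \<alpha> z else \<beta> z) =
      wt g X \<alpha> * (\<Prod>t\<in>T. wt_at g X (\<beta> (j, t)) \<alpha>)" for \<alpha> \<beta>
  proof -
    let ?m = "\<lambda>z. if z \<in> X then \<alpha> z else \<beta> z"
    have im: "(\<lambda>z. if z \<in> X then \<alpha> z else \<beta> z) ` e = \<alpha> ` e" if "e \<in> cross X" for e
      using that by (intro image_cong) (auto simp: cross_def)
    have nX: "(j, t) \<notin> X" for t using X by force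
    show ?thesis
      unfolding wt_def wt_at_def prod_cross_cylinder[OF X T]
      by (intro arg_cong2[where f="(*)"] prod.cong refl) (simp_all add: im nX del: image_Un if_image_distrib)
  qed
  moreover have "avg (maps V ({j} \<times> T)) (\<lambda>\<beta>. \<Prod>t\<in>T. wt_at g X (\<beta> (j, t)) \<alpha>) =
      avg (V j) (\<lambda>x. wt_at g X x \<alpha>) ^ card T" for \<alpha>
    using V T by (rule avg_maps_part)
  ultimately show ?thesis
    unfolding count_def
    by (subst avg_maps_Un) (use X T disj V in \<open>simp_all add: avg_cmult\<close>)
qed

section \<open>Octahedra, links and doubled octahedra\<close>

definition octv :: "nat set \<Rightarrow> (nat \<Rightarrow> nat) \<Rightarrow> (nat \<times> nat) set" where
  "octv J a = (SIGMA j:J. {..<a j})"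

lemma finite_octv: "finite J \<Longrightarrow> finite (octv J a)"
  by (simp add: octv_def)

lemma fst_octv: "fst ` octv J a \<subseteq> J"
  by (auto simp: octv_def)

text \<open>
  Both kinds of complexes that occur, octahedra and two octahedra sharing a vertex, have parts that
  consist of pairs with the index of the part as first component. This is all that is needed to
  translate partite maps and crossing sets into the language of vertex sets.
\<close>

lemma partite_maps_eq:
  assumes "\<And>j. j \<in> J \<Longrightarrow> W j \<subseteq> {j} \<times> UNIV"
  shows "partite_maps J W V = maps V (\<Union>j\<in>J. W j)"
proof (intro equalityI subsetI)
  fix \<phi> assume \<phi>: "\<phi> \<in> partite_maps J W V"
  show "\<phi> \<in> maps V (\<Union>j\<in>J. W j)"
    unfolding maps_def
  proof (rule PiE_I)
    fix z assume "z \<in> (\<Union>j\<in>J. W j)"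
    then obtain j where j: "j \<in> J" "z \<in> W j" by auto
    then have "fst z = j" using assms[OF j(1)] by auto
    then show "\<phi> z \<in> V (fst z)" using \<phi> j unfolding partite_maps_def by blast
  next
    fix z assume z: "z \<notin> (\<Union>j\<in>J. W j)"
    have "\<phi> \<in> (\<Union>j\<in>J. W j) \<rightarrow>\<^sub>E (\<Union>j\<in>J. V j)"
      using \<phi> unfolding partite_maps_def by blast
    then show "\<phi> z = undefined" using z by (rule PiE_arb)
  qed
next
  fix \<phi> assume \<phi>: "\<phi> \<in> maps V (\<Union>j\<in>J. W j)"
  have in_part: "\<phi> z \<in> V j" if "j \<in> J" "z \<in> W j" for j z
  proof -
    have "fst z = j" using assms[OF that(1)] that(2) by auto
    moreover have "\<phi> z \<in> V (fst z)"
      using PiE_mem[OF \<phi>[unfolded maps_def], of z] that by blast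
    ultimately show ?thesis by simp
  qed
  have "\<phi> \<in> (\<Union>j\<in>J. W j) \<rightarrow>\<^sub>E (\<Union>j\<in>J. V j)"
  proof (rule PiE_I)
    fix z assume "z \<in> (\<Union>j\<in>J. W j)"
    then show "\<phi> z \<in> (\<Union>j\<in>J. V j)" using in_part by blast
  next
    fix z assume "z \<notin> (\<Union>j\<in>J. W j)"
    then show "\<phi> z = undefined" by (rule PiE_arb[OF \<phi>[unfolded maps_def]])
  qed
  then show "\<phi> \<in> partite_maps J W V"
    using in_part unfolding partite_maps_def by blast
qed

lemma crossing_iff_cross:
  assumes "\<And>j. j \<in> J \<Longrightarrow> W j \<subseteq> {j} \<times> UNIV"
  shows "crossing J W e \<longleftrightarrow> e \<in> cross (\<Union>j\<in>J. W j)"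
proof
  assume e: "crossing J W e"
  have "x = y" if xy: "x \<in> e" "y \<in> e" "fst x = fst y" for x y
  proof -
    have "e \<subseteq> (\<Union>j\<in>J. W j)" using e unfolding crossing_def by simp
    then obtain i j where ij: "i \<in> J" "x \<in> W i" "j \<in> J" "y \<in> W j" using xy by blast
    have "i = fst x" "j = fst y" using assms[OF ij(1)] assms[OF ij(3)] ij by auto
    then have "y \<in> W i" using ij xy by simp
    then show "x = y" using e xy ij unfolding crossing_def by blast
  qed
  then show "e \<in> cross (\<Union>j\<in>J. W j)"
    using e by (auto simp: crossing_def cross_def inj_on_def)
next
  assume e: "e \<in> cross (\<Union>j\<in>J. W j)"
  have "x = y" if "j \<in> J" "x \<in> e \<inter> W j" "y \<in> e \<inter> W j" for j x y
  proof -
    have "fst x = fst y"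
      using subsetD[OF assms[OF that(1)], of x] subsetD[OF assms[OF that(1)], of y] that by auto
    then show ?thesis using e that by (auto simp: cross_def inj_on_def)
  qed
  then show "crossing J W e"
    using e unfolding crossing_def cross_def by blast
qed

lemma hom_density_octahedron:
  "hom_density J V g (octahedron J a) = count V g (octv J a)"
proof -
  let ?W = "\<lambda>j. {j} \<times> {..<a j}"
  have W: "\<And>j. j \<in> J \<Longrightarrow> ?W j \<subseteq> {j} \<times> UNIV" by auto
  have U: "(\<Union>j\<in>J. ?W j) = octv J a" by (auto simp: octv_def)
  have "{e. crossing J ?W e} = cross (octv J a)"
    using crossing_iff_cross[OF W] U by auto
  then show ?thesis
    using partite_maps_eq[OF W, of J V] U
    by (simp add: hom_density_def octahedron_def Let_def count_def avg_def wt_def)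
qed

lemma octv_update:
  assumes "j \<in> J"
  shows "octv J (a(j := c)) = octv (J - {j}) a \<union> {j} \<times> {..<c}"
  using assms by (auto simp: octv_def split: if_splits)

lemma octv_slice:
  assumes "finite J" "j \<in> J" "finite (V j)"
  shows "count V g (octv J (a(j := c))) =
    avg (maps V (octv (J - {j}) a))
      (\<lambda>\<alpha>. wt g (octv (J - {j}) a) \<alpha> *
         avg (V j) (\<lambda>x. wt_at g (octv (J - {j}) a) x \<alpha>) ^ c)"
proof -
  have "j \<notin> fst ` octv (J - {j}) a" using fst_octv by blast
  then show ?thesis
    unfolding octv_update[OF assms(2)]
    using count_slice[of "octv (J - {j}) a" j "{..<c}" V g] assms finite_octv by simp
qed

lemma image_in_parts:
  assumes "\<phi> \<in> maps V X" "e \<in> cross X" "fst ` X \<subseteq> J"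
  shows "\<phi> ` e \<subseteq> (\<Union>j\<in>J. V j)"
proof
  fix x assume "x \<in> \<phi> ` e"
  then obtain z where z: "z \<in> e" "x = \<phi> z" by auto
  then have "z \<in> X" using assms(2) by (auto simp: cross_def)
  then have "\<phi> z \<in> V (fst z)" "fst z \<in> J"
    using assms by (auto simp: maps_def PiE_iff)
  then show "x \<in> (\<Union>j\<in>J. V j)" using z by auto
qed

lemma wt_nonneg:
  assumes "\<And>e. e \<subseteq> (\<Union>j\<in>J. V j) \<Longrightarrow> 0 \<le> g e" "\<phi> \<in> maps V X" "fst ` X \<subseteq> J"
  shows "0 \<le> wt g X \<phi>"
  unfolding wt_def by (rule prod_nonneg) (rule assms(1)[OF image_in_parts[OF assms(2) _ assms(3)]])

lemma wt_mono:
  assumes "\<And>e. e \<subseteq> (\<Union>j\<in>J. V j) \<Longrightarrow> 0 \<le> g e \<and> g e \<le> h e" "\<phi> \<in> maps V X" "fst ` X \<subseteq> J"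
  shows "wt g X \<phi> \<le> wt h X \<phi>"
  unfolding wt_def by (rule prod_mono) (rule assms(1)[OF image_in_parts[OF assms(2) _ assms(3)]])

lemma count_nonneg:
  assumes "\<And>e. e \<subseteq> (\<Union>j\<in>J. V j) \<Longrightarrow> 0 \<le> g e" "fst ` X \<subseteq> J"
  shows "0 \<le> count V g X"
  unfolding count_def by (rule avg_nonneg, rule wt_nonneg[where J=J and V=V]) (use assms in auto)

lemma count_mono:
  assumes "\<And>e. e \<subseteq> (\<Union>j\<in>J. V j) \<Longrightarrow> 0 \<le> g e \<and> g e \<le> h e" "fst ` X \<subseteq> J"
  shows "count V g X \<le> count V h X"
  unfolding count_def by (rule avg_mono, rule wt_mono[where J=J and V=V]) (use assms in auto)

text \<open>
  By \<open>octv_slice\<close> the three counts are the moments of order 1, 0 and 2 of the same function, with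
  respect to the same weights.
\<close>

lemma octahedron_Cauchy_Schwarz:
  assumes "finite J" "j \<in> J" "finite (V j)"
    and g: "\<And>e. e \<subseteq> (\<Union>j\<in>J. V j) \<Longrightarrow> 0 \<le> g e"
  shows "(count V g (octv J (a(j := 1))))\<^sup>2 \<le>
    count V g (octv J (a(j := 0))) * count V g (octv J (a(j := 2)))"
proof -
  have sub: "fst ` octv (J - {j}) a \<subseteq> J" using fst_octv by blast
  show ?thesis
    using avg_Cauchy_Schwarz[of "maps V (octv (J - {j}) a)" "wt g (octv (J - {j}) a)"
        "\<lambda>\<alpha>. avg (V j) (\<lambda>x. wt_at g (octv (J - {j}) a) x \<alpha>)", OF wt_nonneg[of V J g, OF g _ sub]]
    unfolding octv_slice[where J=J and V=V and j=j, OF assms(1-3)] by simp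
qed

lemma bij_betw_cross:
  assumes "bij_betw \<pi> X X'" "\<And>z. z \<in> X \<Longrightarrow> fst (\<pi> z) = fst z"
  shows "bij_betw (image \<pi>) (cross X) (cross X')"
proof -
  have inj: "inj_on \<pi> X" and im: "\<pi> ` X = X'" using assms(1) by (auto simp: bij_betw_def)
  have "image \<pi> ` cross X \<subseteq> cross X'"
  proof (intro subsetI, elim imageE)
    fix e' e assume e: "e' = \<pi> ` e" "e \<in> cross X"
    have sub: "e \<subseteq> X" using e by (simp add: cross_def)
    have "inj_on fst (\<pi> ` e)"
    proof (rule inj_onI, elim imageE)
      fix x y a b assume xy: "fst x = fst y" "x = \<pi> a" "y = \<pi> b" "a \<in> e" "b \<in> e"
      then have "fst a = fst b" using assms(2)[of a] assms(2)[of b] subsetD[OF sub] by metis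
      then have "a = b" using xy e unfolding cross_def inj_on_def by blast
      then show "x = y" using xy by simp
    qed
    then show "e' \<in> cross X'" using e sub im unfolding cross_def by blast
  qed
  moreover have "cross X' \<subseteq> image \<pi> ` cross X"
  proof
    fix e' assume e': "e' \<in> cross X'"
    let ?e = "{z \<in> X. \<pi> z \<in> e'}"
    have "inj_on fst ?e"
    proof (rule inj_onI)
      fix x y assume xy: "x \<in> ?e" "y \<in> ?e" "fst x = fst y"
      then have "fst (\<pi> x) = fst (\<pi> y)" using assms(2) by simp
      then have "\<pi> x = \<pi> y" using xy e' unfolding cross_def inj_on_def by blast
      then show "x = y" using xy inj unfolding inj_on_def by blast
    qed
    then have "?e \<in> cross X" unfolding cross_def by blast
    moreover have "e' = \<pi> ` ?e" using e' im unfolding cross_def by blast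
    ultimately show "e' \<in> image \<pi> ` cross X" by blast
  qed
  moreover have "inj_on (image \<pi>) (cross X)"
    by (rule inj_on_subset[OF inj_on_image_Pow[OF inj]]) (auto simp: cross_def)
  ultimately show ?thesis unfolding bij_betw_def by blast
qed

text \<open>
  The count depends only on the number of vertices in each part, not on their names.
\<close>

lemma count_reindex:
  assumes \<pi>: "bij_betw \<pi> X X'" and f: "\<And>z. z \<in> X \<Longrightarrow> fst (\<pi> z) = fst z"
  shows "count V g X' = count V g X"
proof -
  define T where "T = (\<lambda>\<phi> :: nat \<times> nat \<Rightarrow> 'a. restrict (\<lambda>z. \<phi> (\<pi> z)) X)"
  define \<rho> where "\<rho> = the_inv_into X \<pi>"
  have inj: "inj_on \<pi> X" and im: "\<pi> ` X = X'" using \<pi> by (auto simp: bij_betw_def)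
  have \<rho>: "\<rho> (\<pi> z) = z" if "z \<in> X" for z
    using that inj by (simp add: \<rho>_def the_inv_into_f_f)
  have \<rho>': "\<pi> (\<rho> z) = z" "\<rho> z \<in> X" if "z \<in> X'" for z
    using f_the_inv_into_f[OF inj, of z] the_inv_into_into[OF inj, of z X] that im
    by (simp_all add: \<rho>_def)
  have T: "bij_betw T (maps V X') (maps V X)"
  proof (rule bij_betw_byWitness[where f' = "\<lambda>\<phi>. restrict (\<lambda>z. \<phi> (\<rho> z)) X'"])
    show "\<forall>\<phi>\<in>maps V X'. restrict (\<lambda>z. T \<phi> (\<rho> z)) X' = \<phi>"
    proof (intro ballI ext)
      fix \<phi> z assume "\<phi> \<in> maps V X'"
      then show "restrict (\<lambda>z. T \<phi> (\<rho> z)) X' z = \<phi> z"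
        using PiE_arb[of \<phi> X' _ z] unfolding maps_def T_def
        by (cases "z \<in> X'") (simp_all add: \<rho>')
    qed
    show "\<forall>\<phi>\<in>maps V X. T (restrict (\<lambda>z. \<phi> (\<rho> z)) X') = \<phi>"
    proof (intro ballI ext)
      fix \<phi> z assume "\<phi> \<in> maps V X"
      then show "T (restrict (\<lambda>z. \<phi> (\<rho> z)) X') z = \<phi> z"
        using PiE_arb[of \<phi> X _ z] bij_betwE[OF \<pi>] unfolding maps_def T_def
        by (cases "z \<in> X") (simp_all add: \<rho>)
    qed
    have "T \<phi> \<in> maps V X" if p: "\<phi> \<in> maps V X'" for \<phi>
      unfolding maps_def
    proof (rule PiE_I)
      fix z assume z: "z \<in> X"
      then have "\<pi> z \<in> X'" using im by blast
      then have "\<phi> (\<pi> z) \<in> V (fst (\<pi> z))" using p unfolding maps_def by blast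
      then show "T \<phi> z \<in> V (fst z)" using z f by (simp add: T_def)
    qed (simp add: T_def)
    then show "T ` maps V X' \<subseteq> maps V X" by blast
    have "restrict (\<lambda>z. \<phi> (\<rho> z)) X' \<in> maps V X'" if p: "\<phi> \<in> maps V X" for \<phi>
      unfolding maps_def
    proof (rule PiE_I)
      fix z assume z: "z \<in> X'"
      then have "\<phi> (\<rho> z) \<in> V (fst (\<rho> z))" using p \<rho>' unfolding maps_def by blast
      then show "restrict (\<lambda>z. \<phi> (\<rho> z)) X' z \<in> V (fst z)" using z f[of "\<rho> z"] \<rho>' by simp
    qed simp
    then show "(\<lambda>\<phi>. restrict (\<lambda>z. \<phi> (\<rho> z)) X') ` maps V X \<subseteq> maps V X'" by blast
  qed
  have "wt g X (T \<phi>) = wt g X' \<phi>" for \<phi>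
  proof -
    have "wt g X' \<phi> = (\<Prod>e\<in>cross X. g (\<phi> ` \<pi> ` e))"
      unfolding wt_def
      using prod.reindex_bij_betw[OF bij_betw_cross[OF \<pi> f], of "\<lambda>e. g (\<phi> ` e)"] by simp
    also have "\<dots> = wt g X (T \<phi>)"
      unfolding wt_def
    proof (rule prod.cong[OF refl])
      fix e assume "e \<in> cross X"
      then have "\<phi> ` \<pi> ` e = T \<phi> ` e"
        unfolding T_def image_image by (intro image_cong) (auto simp: cross_def)
      then show "g (\<phi> ` \<pi> ` e) = g (T \<phi> ` e)" by simp
    qed
    finally show ?thesis by simp
  qed
  then have "sum (wt g X) (maps V X) = sum (wt g X') (maps V X')"
    using sum.reindex_bij_betw[OF T, of "wt g X"] by simp
  then show ?thesis
    unfolding count_def avg_def using bij_betw_same_card[OF T] by simp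
qed

lemma avg_maps_single: "avg (maps V {(j, i)}) F = avg (V j) (\<lambda>x. F (\<lambda>z. if z = (j, i) then x else undefined))"
proof -
  have bij: "bij_betw (\<lambda>x z. if z = (j, i) then x else undefined) (V j) (maps V {(j, i)})"
  proof (rule bij_betw_byWitness[where f' = "\<lambda>\<phi>. \<phi> (j, i)"])
    show "\<forall>\<phi>\<in>maps V {(j, i)}. (\<lambda>z. if z = (j, i) then \<phi> (j, i) else undefined) = \<phi>"
      by (simp add: maps_def PiE_iff extensional_def fun_eq_iff)
  qed (auto simp: maps_def PiE_iff extensional_def split: if_splits)
  show ?thesis
    unfolding avg_def bij_betw_same_card[OF bij, symmetric]
    using sum.reindex_bij_betw[OF bij, of F] by simp
qed

text \<open>
  Conditioned on the image \<open>v\<close> of the common vertex, the two copies are mapped independently, so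
  that the conditional expectation \<open>S v\<close> is, up to a factor, the square of the octahedron density in
  the link of \<open>v\<close>. The factor \<open>g {} * g {v}\<close> appears because \<open>{}\<close> and the common vertex are edges of both
  copies: they occur once in the doubled octahedron but twice in the square.
\<close>

lemma plus2_second_moment:
  fixes V :: "nat \<Rightarrow> 'a set"
  assumes V: "\<And>j. j \<in> {0..k} \<Longrightarrow> finite (V j)"
    and g: "\<And>e. e \<subseteq> (\<Union>j\<in>{0..k}. V j) \<Longrightarrow> 0 \<le> g e"
  obtains S where "\<And>v. v \<in> V 0 \<Longrightarrow> 0 \<le> S v"
    "hom_density {0..k} V g (plus2_octahedron k a) = avg (V 0) S"
    "\<And>v. v \<in> V 0 \<Longrightarrow> g {} * g {v} * S v = (count V (link g v) (octv {1..k} a))\<^sup>2"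
proof -
  define X0 where "X0 = octv {1..k} a"
  define X1 where "X1 = (SIGMA j:{1..k}. {a j..<2 * a j})"
  define E where "E = cross (X0 \<union> {0} \<times> {0}) \<union> cross (X1 \<union> {0} \<times> {0})"
  define M :: "'a \<Rightarrow> (nat \<times> nat \<Rightarrow> 'a) \<Rightarrow> (nat \<times> nat \<Rightarrow> 'a) \<Rightarrow> nat \<times> nat \<Rightarrow> 'a" where "M = (\<lambda>v \<alpha> \<beta> z. if z = (0, 0) then v else if z \<in> X0 then \<alpha> z else \<beta> z)"
  define S where "S = (\<lambda>v. avg (maps V X0) (\<lambda>\<alpha>. avg (maps V X1) (\<lambda>\<beta>. \<Prod>e\<in>E. g (M v \<alpha> \<beta> ` e))))"
  have fin: "finite X0" "finite X1" by (auto simp: X0_def X1_def octv_def)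
  have disj: "X0 \<inter> X1 = {}" "{(0, 0)} \<inter> (X0 \<union> X1) = {}" "0 \<notin> fst ` X0" "0 \<notin> fst ` X1"
    by (auto simp: X0_def X1_def octv_def)
  let ?W = "\<lambda>j :: nat. if j = 0 then {(0 :: nat, 0 :: nat)} else {j} \<times> {..<2 * a j}"
  have W: "\<And>j. j \<in> {0..k} \<Longrightarrow> ?W j \<subseteq> {j} \<times> UNIV" by auto
  have U: "(\<Union>j\<in>{0..k}. ?W j) = {(0, 0)} \<union> (X0 \<union> X1)"
    by (auto simp: X0_def X1_def octv_def split: if_splits) 
  have copies: "plus2_copy k a 0 = X0 \<union> {0} \<times> {0}" "plus2_copy k a 1 = X1 \<union> {0} \<times> {0}"
    by (auto simp: plus2_copy_def X0_def X1_def octv_def)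
  have "{e. crossing {0..k} ?W e \<and> (e \<subseteq> plus2_copy k a 0 \<or> e \<subseteq> plus2_copy k a 1)} = E"
    using crossing_iff_cross[where J = "{0..k}" and W = ?W, OF W] unfolding U copies E_def
    by (auto simp: cross_def)
  then have hd: "hom_density {0..k} V g (plus2_octahedron k a) =
      avg (maps V ({(0, 0)} \<union> (X0 \<union> X1))) (\<lambda>\<phi>. \<Prod>e\<in>E. g (\<phi> ` e))"
    using partite_maps_eq[where J = "{0..k}" and W = ?W and V = V, OF W] unfolding U
    by (simp add: hom_density_def plus2_octahedron_def Let_def avg_def)
  also have "\<dots> = avg (V 0) S"
  proof -
    have M_eq: "(\<lambda>z. if z \<in> {(0, 0)} then if z = (0, 0) then v else undefined
        else if z \<in> X0 then \<alpha> z else \<beta> z) = M v \<alpha> \<beta>" for v \<alpha> \<beta>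
      by (simp add: M_def fun_eq_iff)
    show ?thesis
      unfolding S_def avg_maps_Un[OF finite.insertI[OF finite.emptyI] finite_UnI[OF fin] disj(2)]
        avg_maps_Un[OF fin disj(1)] avg_maps_single M_eq ..
  qed
  finally have hd_S: "hom_density {0..k} V g (plus2_octahedron k a) = avg (V 0) S" .
  have S_nonneg: "0 \<le> S v" if v: "v \<in> V 0" for v
  proof -
    have "M v \<alpha> \<beta> ` e \<subseteq> (\<Union>j\<in>{0..k}. V j)"
      if "\<alpha> \<in> maps V X0" "\<beta> \<in> maps V X1" "e \<in> E" for \<alpha> \<beta> e
    proof -
      have "M v \<alpha> \<beta> z \<in> (\<Union>j\<in>{0..k}. V j)" if z: "z \<in> e" for z
      proof -
        have "z = (0, 0) \<or> z \<in> X0 \<or> z \<in> X1" using z \<open>e \<in> E\<close> by (auto simp: E_def cross_def)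
        moreover have "fst z \<in> {0..k}" if "z \<in> X0 \<or> z \<in> X1"
          using that by (auto simp: X0_def X1_def octv_def)
        ultimately show ?thesis
          using PiE_mem[of \<alpha> X0 _ z] PiE_mem[of \<beta> X1 _ z] \<open>\<alpha> \<in> _\<close> \<open>\<beta> \<in> _\<close> v
          unfolding M_def maps_def by (cases "z = (0, 0)"; cases "z \<in> X0") fastforce+
      qed
      then show ?thesis by blast
    qed
    note sub = this
    show ?thesis
      unfolding S_def by (intro avg_nonneg prod_nonneg g sub)
  qed
  have "g {} * g {v} * S v = (count V (link g v) X0)\<^sup>2" for v
  proof -
    have key: "g {} * g {v} * (\<Prod>e\<in>E. g (M v \<alpha> \<beta> ` e)) = wt (link g v) X0 \<alpha> * wt (link g v) X1 \<beta>"
      for \<alpha> \<beta>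
    proof -
      have inter: "cross (X0 \<union> {0} \<times> {0}) \<inter> cross (X1 \<union> {0} \<times> {0}) = {{}, {(0, 0)}}"
      proof -
        have "e \<subseteq> {(0, 0)}" if "e \<subseteq> X0 \<union> {0} \<times> {0}" "e \<subseteq> X1 \<union> {0} \<times> {0}" for e
          using that disj by blast
        then show ?thesis by (auto simp: cross_def)
      qed
      let ?F = "\<lambda>e. g (M v \<alpha> \<beta> ` e)"
      have fin': "finite (cross (X0 \<union> {0} \<times> {0}))" "finite (cross (X1 \<union> {0} \<times> {0}))"
        using fin by (auto intro: finite_cross)
      have im0: "M v \<alpha> \<beta> ` e = \<alpha> ` e" if "e \<in> cross X0" for e
        using that disj by (intro image_cong) (auto simp: M_def cross_def)
      have im1: "M v \<alpha> \<beta> ` e = \<beta> ` e" if "e \<in> cross X1" for e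
        using that disj by (intro image_cong) (auto simp: M_def cross_def)
      have M0: "M v \<alpha> \<beta> (0, 0) = v" by (simp add: M_def)
      have "g {} * g {v} * prod ?F E = prod ?F E * prod ?F {{}, {(0, 0)}}"
        by (simp add: M0 mult.commute)
      also have "\<dots> = prod ?F (cross (X0 \<union> {0} \<times> {0})) * prod ?F (cross (X1 \<union> {0} \<times> {0}))"
        unfolding E_def inter[symmetric] using prod.union_inter[OF fin'] .
      also have "prod ?F (cross (X0 \<union> {0} \<times> {0})) = wt (link g v) X0 \<alpha>"
        using fin disj by (subst prod_cross_cylinder)
          (simp_all add: wt_def link_def prod.distrib M0 im0)
      also have "prod ?F (cross (X1 \<union> {0} \<times> {0})) = wt (link g v) X1 \<beta>"
        using fin disj by (subst prod_cross_cylinder)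
          (simp_all add: wt_def link_def prod.distrib M0 im1)
      finally show ?thesis .
    qed
    have "bij_betw (\<lambda>(j, i). (j, i + a j)) X0 X1"
      by (rule bij_betw_byWitness[where f' = "\<lambda>(j, i). (j, i - a j)"])
        (auto simp: X0_def X1_def octv_def)
    then have shift: "count V (link g v) X1 = count V (link g v) X0"
      by (rule count_reindex) auto
    have "g {} * g {v} * S v =
        avg (maps V X0) (\<lambda>\<alpha>. avg (maps V X1) (\<lambda>\<beta>. g {} * g {v} * (\<Prod>e\<in>E. g (M v \<alpha> \<beta> ` e))))"
      unfolding S_def by (simp only: avg_cmult)
    also have "\<dots> = count V (link g v) X0 * count V (link g v) X1"
      unfolding key count_def by (simp add: avg_cmult avg_cmult_right)
    finally show ?thesis by (simp add: shift power2_eq_square)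
  qed
  then show ?thesis
    using that S_nonneg hd_S unfolding X0_def by blast
qed

text \<open>
  Both sides choose \<open>v\<close> and the remaining vertices of the octahedron at random, in different orders.
\<close>

lemma avg_link:
  assumes "finite (V 0)"
  shows "avg (V 0) (\<lambda>v. count V (link g v) (octv {1..k} a)) =
    count V g (octv {0..k} (a(0 := 1)))"
proof -
  have J: "{0..k} - {0} = {1..k}" by auto
  show ?thesis
    using octv_slice[of "{0..k}" 0 V g a 1] assms
    unfolding count_def by (simp add: J wt_link avg_cmult avg_swap[of "V 0"])
qed

lemma octv_cong: "(\<And>j. j \<in> J \<Longrightarrow> a j = b j) \<Longrightarrow> octv J a = octv J b"
  by (auto simp: octv_def)

lemma octv_zero: "octv {0..k} (a(0 := 0)) = octv {1..k} a"
  by (auto simp: octv_def split: if_splits) 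

lemma count_empty: "count V h {} = h {}"
proof -
  have "cross {} = {{}}" by (auto simp: cross_def)
  moreover have "maps V {} = {\<lambda>_. undefined}" by (auto simp: maps_def)
  ultimately show ?thesis by (simp add: count_def avg_def wt_def)
qed

lemma card_cross: "e \<in> cross X \<Longrightarrow> finite J \<Longrightarrow> fst ` X \<subseteq> J \<Longrightarrow> finite e \<and> card e \<le> card J"
  by (metis (no_types, lifting) cross_def card_image card_mono finite_image_iff image_mono
      mem_Collect_eq order_trans rev_finite_subset)

lemma maps_points: "maps (\<lambda>j. {j}) X = {restrict fst X}"
proof -
  have "maps (\<lambda>j. {j}) X = (\<Pi>\<^sub>E z\<in>X. {restrict fst X z})"
    unfolding maps_def by (intro PiE_cong) simp
  also have "\<dots> = {restrict fst X}" by (rule PiE_singleton[OF restrict_extensional])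
  finally show ?thesis .
qed

text \<open>
  A density graph has one vertex in each part, hence only one partite map, and the moments in
  \<open>octv_slice\<close> form a geometric progression. Its Cauchy-Schwarz inequalities are equalities.
\<close>

lemma density_slice:
  assumes J: "finite J" "j \<in> J" and p: "\<And>f. f \<subseteq> J \<Longrightarrow> 0 < p f"
  obtains A R where "0 < A" "0 < R" "\<And>c. count (\<lambda>j. {j}) p (octv J (a(j := c))) = A * R ^ c"
proof -
  let ?X = "octv (J - {j}) a"
  let ?\<phi> = "restrict fst ?X"
  have X: "fst ` ?X \<subseteq> J" using fst_octv by blast
  have sub: "?\<phi> ` e \<subseteq> J" if "e \<in> cross ?X" for e
    using image_in_parts[of ?\<phi> "\<lambda>j. {j}" ?X e J] that X maps_points by auto
  have "0 < wt p ?X ?\<phi>"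
    unfolding wt_def by (intro prod_pos p sub)
  moreover have "0 < wt_at p ?X j ?\<phi>"
    unfolding wt_at_def using J sub by (intro prod_pos p) auto
  moreover have "count (\<lambda>j. {j}) p (octv J (a(j := c))) = wt p ?X ?\<phi> * wt_at p ?X j ?\<phi> ^ c" for c
    by (subst octv_slice[OF J]) (simp_all add: maps_points avg_singleton)
  ultimately show ?thesis using that by blast
qed

text \<open>
  Every part of the octahedron is nonempty, so some edge of it lies over the index set \<open>f\<close>.
\<close>

lemma density_zero:
  assumes J: "finite J" and f: "f \<subseteq> J" "p f = 0" and a: "\<And>j. j \<in> J \<Longrightarrow> 0 < a j"
  shows "count (\<lambda>j. {j}) p (octv J a) = 0"
proof -
  let ?X = "octv J a"
  let ?e = "(\<lambda>j. (j, 0)) ` f"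
  have sub: "?e \<subseteq> ?X" using f a by (auto simp: octv_def)
  then have e: "?e \<in> cross ?X" by (auto simp: cross_def inj_on_def)
  have "restrict fst ?X ` ?e = (\<lambda>j. j) ` f"
    using sub unfolding image_image by (intro image_cong) auto
  then have im: "restrict fst ?X ` ?e = f" by simp
  have "wt p ?X (restrict fst ?X) = 0"
    unfolding wt_def
    by (rule prod_zero[OF finite_cross[OF finite_octv[OF J]]], rule bexI[OF _ e])
      (simp only: im f(2))
  then show ?thesis by (simp add: count_def maps_points avg_singleton)
qed

lemma crossing_image:
  assumes disj: "disjoint_family_on V J" and e: "inj_on fst e" "fst ` e \<subseteq> J"
    and \<phi>: "\<And>z. z \<in> e \<Longrightarrow> \<phi> z \<in> V (fst z)"
  shows "crossing J V (\<phi> ` e)"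
proof -
  have part: "fst z = j" if "z \<in> e" "j \<in> J" "\<phi> z \<in> V j" for z j
    using that disj \<phi>[OF that(1)] e(2) unfolding disjoint_family_on_def by blast
  have "x = y" if j: "j \<in> J" and xy: "x \<in> \<phi> ` e \<inter> V j" "y \<in> \<phi> ` e \<inter> V j" for j x y
  proof -
    obtain z z' where z: "z \<in> e" "x = \<phi> z" "z' \<in> e" "y = \<phi> z'" using xy by blast
    then have "fst z = fst z'" using part[of z j] part[of z' j] j xy by auto
    then show ?thesis using z e(1) unfolding inj_on_def by blast
  qed
  moreover have "\<phi> ` e \<subseteq> (\<Union>j\<in>J. V j)" using \<phi> e(2) by blast
  ultimately show ?thesis unfolding crossing_def by blast
qed


text \<open>
  This is \<open>plus2_second_moment\<close> for the density graph, where \<open>v\<close> has only one value.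
\<close>

lemma plus2_density:
  assumes p: "\<And>f. f \<subseteq> {0..k} \<Longrightarrow> 0 \<le> p f"
  shows "p {} * p {0} * density_graph_density {0..k} p (plus2_octahedron k a) =
    (count (\<lambda>j. {j}) p (octv {0..k} (a(0 := 1))))\<^sup>2"
proof -
  have U: "(\<Union>j\<in>{0..k}. {j}) = {0..k}" by simp
  obtain S :: "nat \<Rightarrow> real" where S: "density_graph_density {0..k} p (plus2_octahedron k a) = avg {0} S"
    "\<And>v. v \<in> {0} \<Longrightarrow> p {} * p {v} * S v = (count (\<lambda>j. {j}) (link p v) (octv {1..k} a))\<^sup>2"
    by (rule plus2_second_moment[of k "\<lambda>j. {j}" p a]) (use p U in auto)
  have "count (\<lambda>j. {j}) (link p 0) (octv {1..k} a) = count (\<lambda>j. {j}) p (octv {0..k} (a(0 := 1)))"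
    using avg_link[of "\<lambda>j. {j}" p k a] unfolding avg_singleton by blast
  then show ?thesis using S(2)[of 0] unfolding S(1) avg_singleton by simp
qed

text \<open>
  If \<open>card e < k\<close>, then \<open>e\<close> is too small to be a transversal of \<open>V 1, \<dots>, V k\<close>, the set \<open>insert v e\<close>
  is not one because it meets \<open>V 0\<close>, and neither has \<open>k + 1\<close> elements. So \<open>g\<close> and \<open>\<gamma>\<close> agree on both.
\<close>

lemma link_below:
  assumes disj: "disjoint_family_on V {0..k}"
    and g: "\<And>e. e \<subseteq> (\<Union>j\<in>{0..k}. V j) \<Longrightarrow> 0 \<le> g e \<and> g e \<le> \<gamma> e"
    and same: "\<And>e. crossing {0..k} V e \<Longrightarrow> card e \<noteq> k + 1 \<Longrightarrow> e \<notin> transversals V {1..k} \<Longrightarrow> g e = \<gamma> e"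
    and v: "v \<in> V 0" and e: "crossing {1..k} V e"
  shows "card e < k \<Longrightarrow> link g v e = link \<gamma> v e" "link g v e \<le> link \<gamma> v e"
proof -
  have sub: "e \<subseteq> (\<Union>j\<in>{1..k}. V j)" using e by (simp add: crossing_def)
  have V0: "V 0 \<inter> V j = {}" if "j \<in> {1..k}" for j
    using disjoint_family_onD[OF disj, of 0 j] that by auto
  have sub0: "e \<subseteq> (\<Union>j\<in>{0..k}. V j)" "insert v e \<subseteq> (\<Union>j\<in>{0..k}. V j)"
    using sub v by fastforce+
  show "link g v e \<le> link \<gamma> v e"
    unfolding link_def using g[OF sub0(1)] g[OF sub0(2)] by (simp add: mult_mono)
  assume card: "card e < k"
  have eV0: "e \<inter> V 0 = {}" using sub V0 by blast
  have vV: "v \<notin> V j" if "j \<in> {1..k}" for j using V0[OF that] v by blast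
  have split: "j = 0 \<or> j \<in> {1..k}" if "j \<in> {0..k}" for j using that by auto
  have one: "x = y" if "j \<in> {1..k}" "x \<in> e \<inter> V j" "y \<in> e \<inter> V j" for j x y
    using e that unfolding crossing_def by blast
  have c1: "crossing {0..k} V e"
    unfolding crossing_def using sub0(1) eV0 one split by blast
  have c2: "crossing {0..k} V (insert v e)"
    unfolding crossing_def
  proof (intro conjI ballI sub0(2))
    fix j x y assume j: "j \<in> {0..k}" and xy: "x \<in> insert v e \<inter> V j" "y \<in> insert v e \<inter> V j"
    show "x = y"
      using split[OF j]
    proof
      assume "j = 0"
      then show ?thesis using xy eV0 by blast
    next
      assume "j \<in> {1..k}"
      then show ?thesis using xy one[of j x y] vV[of j] by blast
    qed
  qed
  have t1: "e \<notin> transversals V {1..k}"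
  proof
    assume "e \<in> transversals V {1..k}"
    then have one: "\<And>j. j \<in> {1..k} \<Longrightarrow> card (e \<inter> V j) = 1" by (simp add: transversals_def)
    have "e = (\<Union>j\<in>{1..k}. e \<inter> V j)" using sub by blast
    also have "card \<dots> = (\<Sum>j\<in>{1..k}. card (e \<inter> V j))"
    proof (rule card_UN_disjoint)
      show "\<forall>j\<in>{1..k}. finite (e \<inter> V j)"
        using one by (metis card.infinite zero_neq_one)
      show "\<forall>i\<in>{1..k}. \<forall>j\<in>{1..k}. i \<noteq> j \<longrightarrow> (e \<inter> V i) \<inter> (e \<inter> V j) = {}"
        using disjoint_family_onD[OF disj] by fastforce
    qed simp
    also have "\<dots> = k" using one by simp
    finally show False using card by simp
  qed
  have t2: "insert v e \<notin> transversals V {1..k}"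
    using vV by (auto simp: transversals_def)
  have "card (insert v e) \<le> Suc (card e)"
    by (cases "finite e") (auto simp: card_insert_if)
  then show "link g v e = link \<gamma> v e"
    unfolding link_def using same[OF c1 _ t1] same[OF c2 _ t2] card by simp
qed

lemma vertex_weight_eq:
  assumes "finite V0" "U \<subseteq> V0"
  shows "vertex_weight V0 \<gamma> U = (\<Sum>v\<in>U. \<gamma> {v} / real (card V0))"
proof -
  have "(\<Sum>v\<in>V0. indicator U v * \<gamma> {v}) = (\<Sum>v\<in>U. \<gamma> {v})"
    by (rule sum.mono_neutral_cong_right) (use assms in auto)
  then show ?thesis by (simp add: vertex_weight_def sum_divide_distrib)
qed

lemma regular_wrt_mono:
  assumes "regular_wrt J V e d g \<gamma>" "e \<le> e'" and nonneg: "\<And>e. e \<subseteq> (\<Union>j\<in>J. V j) \<Longrightarrow> 0 \<le> \<gamma> e"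
  shows "regular_wrt J V e' d g \<gamma>"
proof -
  have nn: "0 \<le> hom_density J V \<gamma> (octahedron J a)" for a
    unfolding hom_density_octahedron by (rule count_nonneg[OF nonneg fst_octv])
  have "(d - e') * hom_density J V \<gamma> (octahedron J a) \<le> (d - e) * hom_density J V \<gamma> (octahedron J a)"
    "(x + e) * hom_density J V \<gamma> (octahedron J a) \<le> (x + e') * hom_density J V \<gamma> (octahedron J a)" for a x
    using assms(2) nn by (auto intro!: mult_right_mono)
  then show ?thesis using assms(1) unfolding regular_wrt_def by (meson atLeastAtMost_iff order_trans)
qed

section \<open>Moment inequalities\<close>

text \<open>
  Squaring repeatedly, the constant accumulates to the power \<open>1 + 2 + \<dots> + 2 ^ (n - 1) = 2 ^ n - 1\<close>.
\<close>

lemma ladder_power: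
  fixes f :: "nat \<Rightarrow> real"
  assumes f: "\<And>i. i \<le> n \<Longrightarrow> 0 \<le> f i" and c: "1 \<le> c"
    and step: "\<And>i. i < n \<Longrightarrow> (f i)\<^sup>2 \<le> c * f (Suc i)"
  shows "f 0 ^ 2 ^ n \<le> c ^ 2 ^ n * f n"
proof -
  have "f 0 ^ 2 ^ i \<le> c ^ (2 ^ i - 1) * f i" if "i \<le> n" for i
    using that
  proof (induction i)
    case 0
    then show ?case by simp
  next
    case (Suc i)
    have arith: "Suc (2 * (m - 1)) = 2 * m - 1" if "1 \<le> m" for m :: nat
      using that by arith
    have "f 0 ^ 2 ^ Suc i = (f 0 ^ 2 ^ i)\<^sup>2"
      by (simp add: power_mult mult.commute flip: power_mult)
    also have "\<dots> \<le> (c ^ (2 ^ i - 1) * f i)\<^sup>2"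
      using Suc f by (intro power_mono) auto
    also have "\<dots> = c ^ (2 * (2 ^ i - 1)) * (f i)\<^sup>2"
      by (simp add: power_mult_distrib mult.commute flip: power_mult)
    also have "\<dots> \<le> c ^ (2 * (2 ^ i - 1)) * (c * f (Suc i))"
      using c Suc.prems by (intro mult_left_mono step) auto
    also have "\<dots> = c ^ Suc (2 * (2 ^ i - 1)) * f (Suc i)" by simp
    also have "Suc (2 * (2 ^ i - 1)) = 2 ^ Suc i - 1" using arith[of "2 ^ i"] by simp
    finally show ?case .
  qed
  from this[of n] have "f 0 ^ 2 ^ n \<le> c ^ (2 ^ n - 1) * f n" by simp
  also have "\<dots> \<le> c ^ 2 ^ n * f n"
    using c f by (intro mult_right_mono power_increasing) auto
  finally show ?thesis .
qed

text \<open>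
  An abstract form of the iterated Cauchy-Schwarz inequality. Here \<open>F i\<close> stands for the count of the
  octahedron with \<open>i\<close> doubled parts, \<open>F0 i\<close> for the count with the next part removed, and \<open>Q\<close>, \<open>Q0\<close> for
  the expected values, for which the inequality is an equality. Dividing by them turns each step into
  \<open>f\<^sup>2 \<le> (1 + \<rho>) * f'\<close> for the relative counts. Since no root is taken, the errors grow only by a factor
  that depends on \<open>n\<close>.
\<close>

lemma ladder_chain:
  fixes F F0 Q Q0 :: "nat \<Rightarrow> real"
  assumes pos: "\<And>i. i \<le> n \<Longrightarrow> 0 \<le> F i" "\<And>i. i \<le> n \<Longrightarrow> 0 < Q i" "\<And>i. i < n \<Longrightarrow> 0 < Q0 i"
    and CS: "\<And>i. i < n \<Longrightarrow> (F i)\<^sup>2 \<le> F0 i * F (Suc i)"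
    and F0: "\<And>i. i < n \<Longrightarrow> F0 i \<le> (1 + \<rho>) * Q0 i" and \<rho>: "0 \<le> \<rho>"
    and Q: "\<And>i. i < n \<Longrightarrow> (Q i)\<^sup>2 = Q0 i * Q (Suc i)"
  shows "(F 0 / Q 0) ^ 2 ^ n \<le> (1 + \<rho>) ^ 2 ^ n * (F n / Q n)"
proof (rule ladder_power)
  fix i assume i: "i < n"
  have "(F i)\<^sup>2 \<le> (1 + \<rho>) * Q0 i * F (Suc i)"
    using CS[OF i] mult_right_mono[OF F0[OF i] pos(1)[of "Suc i"]] i by simp
  then have "(F i)\<^sup>2 / (Q i)\<^sup>2 \<le> (1 + \<rho>) * Q0 i * F (Suc i) / (Q0 i * Q (Suc i))"
    unfolding Q[OF i] using pos(2)[of "Suc i"] pos(3)[OF i] i by (intro divide_right_mono) auto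
  also have "\<dots> = (1 + \<rho>) * (F (Suc i) / Q (Suc i))"
    using pos(3)[OF i] by simp
  finally show "(F i / Q i)\<^sup>2 \<le> (1 + \<rho>) * (F (Suc i) / Q (Suc i))"
    by (simp add: power_divide)
next
  show "0 \<le> F i / Q i" if "i \<le> n" for i
    using pos(1,2)[OF that] by simp
qed (use \<rho> in simp)

text \<open>
  The three bounds on the moments say that the variance of \<open>D\<close> around \<open>t\<close>, with respect to the weights
  \<open>A\<close>, is at most \<open>4 * \<tau> * m * t\<^sup>2\<close>. So \<open>D\<close> may be replaced by \<open>t\<close> in an average with any nonnegative
  weights \<open>A' \<le> A\<close>. The parameter \<open>\<mu>\<close> comes from the inequality of the arithmetic and the geometric mean, which
  serves instead of a square root.
\<close>

lemma avg_perturb: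
  assumes A: "\<And>x. x \<in> S \<Longrightarrow> 0 \<le> A' x \<and> A' x \<le> A x"
    and t: "0 < t" and m: "0 \<le> m" and \<tau>: "0 \<le> \<tau>" "\<tau> \<le> 1" and \<mu>: "0 < \<mu>"
    and m0: "avg S A \<le> (1 + \<tau>) * m"
    and m1: "(1 - \<tau>) * m * t \<le> avg S (\<lambda>x. A x * D x)"
    and m2: "avg S (\<lambda>x. A x * (D x)\<^sup>2) \<le> (1 + \<tau>) * m * t\<^sup>2"
  shows "\<bar>avg S (\<lambda>x. A' x * D x) - t * avg S A'\<bar> \<le> m * t * (\<mu> + 2 * \<tau> / \<mu>)"
proof -
  have var: "avg S (\<lambda>x. A x * (D x - t)\<^sup>2) \<le> 4 * \<tau> * m * t\<^sup>2"
  proof -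
    have "avg S (\<lambda>x. A x * (D x - t)\<^sup>2) =
        avg S (\<lambda>x. A x * (D x)\<^sup>2 - (2 * t) * (A x * D x) + t\<^sup>2 * A x)"
      by (intro avg_cong) (simp add: power2_eq_square algebra_simps)
    also have "\<dots> = avg S (\<lambda>x. A x * (D x)\<^sup>2) - 2 * t * avg S (\<lambda>x. A x * D x) + t\<^sup>2 * avg S A"
      by (simp only: avg_add avg_diff avg_cmult)
    also have "\<dots> \<le> (1 + \<tau>) * m * t\<^sup>2 - 2 * t * ((1 - \<tau>) * m * t) + t\<^sup>2 * ((1 + \<tau>) * m)"
      using t m0 m1 m2 by (intro add_mono diff_mono mult_left_mono) auto
    also have "\<dots> = 4 * \<tau> * m * t\<^sup>2" by (simp add: power2_eq_square algebra_simps)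
    finally show ?thesis .
  qed
  have amgm: "\<bar>y\<bar> \<le> t * \<mu> / 2 + y\<^sup>2 / (2 * t * \<mu>)" for y
  proof -
    have "0 \<le> (\<bar>y\<bar> - t * \<mu>)\<^sup>2" by simp
    then have "2 * (t * \<mu>) * \<bar>y\<bar> \<le> (t * \<mu>)\<^sup>2 + y\<^sup>2"
      by (simp add: power2_diff algebra_simps)
    then show ?thesis using t \<mu> by (simp add: field_simps power2_eq_square)
  qed
  have "avg S (\<lambda>x. A' x * D x) - t * avg S A' = avg S (\<lambda>x. A' x * D x - t * A' x)"
    by (simp add: avg_diff avg_cmult)
  also have "\<bar>\<dots>\<bar> \<le> avg S (\<lambda>x. \<bar>A' x * D x - t * A' x\<bar>)" by (rule avg_abs)
  also have "\<dots> \<le> avg S (\<lambda>x. (t * \<mu> / 2) * A x + (1 / (2 * t * \<mu>)) * (A x * (D x - t)\<^sup>2))"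
  proof (rule avg_mono)
    fix x assume x: "x \<in> S"
    have "A' x * D x - t * A' x = A' x * (D x - t)" by (simp add: algebra_simps)
    then have "\<bar>A' x * D x - t * A' x\<bar> = A' x * \<bar>D x - t\<bar>"
      using A[OF x] by (simp add: abs_mult)
    also have "\<dots> \<le> A x * (t * \<mu> / 2 + (D x - t)\<^sup>2 / (2 * t * \<mu>))"
      using A[OF x] amgm by (intro mult_mono) auto
    finally show "\<bar>A' x * D x - t * A' x\<bar> \<le>
        (t * \<mu> / 2) * A x + (1 / (2 * t * \<mu>)) * (A x * (D x - t)\<^sup>2)"
      by (simp add: algebra_simps)
  qed
  also have "\<dots> = (t * \<mu> / 2) * avg S A + (1 / (2 * t * \<mu>)) * avg S (\<lambda>x. A x * (D x - t)\<^sup>2)"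
    by (simp only: avg_add avg_cmult)
  also have "\<dots> \<le> (t * \<mu> / 2) * (2 * m) + (1 / (2 * t * \<mu>)) * (4 * \<tau> * m * t\<^sup>2)"
  proof (intro add_mono mult_left_mono)
    show "avg S A \<le> 2 * m" using m0 mult_right_mono[of "1 + \<tau>" 2 m] m \<tau> by linarith
  qed (use var t \<mu> in auto)
  also have "\<dots> = m * t * (\<mu> + 2 * \<tau> / \<mu>)"
    using t \<mu> by (simp add: field_simps power2_eq_square)
  finally show ?thesis .
qed

lemma weighted_variance:
  fixes w u :: "'a \<Rightarrow> real"
  assumes "sum w S \<le> (1 + \<eta>) * p0" "(1 - \<eta>) * p0 \<le> (\<Sum>v\<in>S. w v * u v)"
    and "(\<Sum>v\<in>S. w v * (u v)\<^sup>2) \<le> (1 + \<eta>) * p0"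
  shows "(\<Sum>v\<in>S. w v * (u v - 1)\<^sup>2) \<le> 4 * \<eta> * p0"
proof -
  have "(\<Sum>v\<in>S. w v * (u v - 1)\<^sup>2) = (\<Sum>v\<in>S. w v * (u v)\<^sup>2 - 2 * (w v * u v) + w v)"
    by (intro sum.cong refl) (simp add: power2_eq_square algebra_simps)
  also have "\<dots> = (\<Sum>v\<in>S. w v * (u v)\<^sup>2) - 2 * (\<Sum>v\<in>S. w v * u v) + sum w S"
    by (simp add: sum.distrib sum_subtractf sum_distrib_left)
  finally show ?thesis using assms by (simp add: algebra_simps)
qed

text \<open>
  Chebyshev's inequality with a union bound over the index \<open>i\<close>.
\<close>

lemma Chebyshev_family:
  fixes w :: "'a \<Rightarrow> real" and u :: "'i \<Rightarrow> 'a \<Rightarrow> real" and c \<rho> :: real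
  assumes fin: "finite S" "finite I" and w: "\<And>v. v \<in> S \<Longrightarrow> 0 \<le> w v" and \<rho>: "0 < \<rho>"
    and var: "\<And>i. i \<in> I \<Longrightarrow> (\<Sum>v\<in>S. w v * (u i v - 1)\<^sup>2) \<le> c"
  shows "sum w {v \<in> S. \<exists>i\<in>I. \<rho> < \<bar>u i v - 1\<bar>} \<le> card I * c / \<rho>\<^sup>2"
proof -
  let ?B = "{v \<in> S. \<exists>i\<in>I. \<rho> < \<bar>u i v - 1\<bar>}"
  have "w v \<le> (\<Sum>i\<in>I. w v * (u i v - 1)\<^sup>2 / \<rho>\<^sup>2)" if v: "v \<in> ?B" for v
  proof -
    obtain i where i: "i \<in> I" "\<rho> < \<bar>u i v - 1\<bar>" using v by auto
    have "\<rho>\<^sup>2 \<le> (u i v - 1)\<^sup>2" using i \<rho> by (simp add: abs_le_square_iff[symmetric])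
    then have "w v * 1 \<le> w v * ((u i v - 1)\<^sup>2 / \<rho>\<^sup>2)"
      using \<rho> w v by (intro mult_left_mono) auto
    also have "\<dots> \<le> (\<Sum>i\<in>I. w v * (u i v - 1)\<^sup>2 / \<rho>\<^sup>2)"
      using member_le_sum[OF i(1), of "\<lambda>i. w v * (u i v - 1)\<^sup>2 / \<rho>\<^sup>2"] fin w v by simp
    finally show ?thesis by simp
  qed
  then have "sum w ?B \<le> (\<Sum>v\<in>?B. \<Sum>i\<in>I. w v * (u i v - 1)\<^sup>2 / \<rho>\<^sup>2)" by (rule sum_mono)
  also have "\<dots> \<le> (\<Sum>v\<in>S. \<Sum>i\<in>I. w v * (u i v - 1)\<^sup>2 / \<rho>\<^sup>2)"
    using fin w by (intro sum_mono2) (auto intro!: sum_nonneg)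
  also have "\<dots> = (\<Sum>i\<in>I. (\<Sum>v\<in>S. w v * (u i v - 1)\<^sup>2) / \<rho>\<^sup>2)"
    by (subst sum.swap) (simp add: sum_divide_distrib)
  also have "\<dots> \<le> (\<Sum>i\<in>I. c / \<rho>\<^sup>2)"
    using var by (intro sum_mono divide_right_mono) auto
  finally show ?thesis by simp
qed

text \<open>
  Since \<open>X\<^sup>2 \<le> 1 + (2 / K) * (X ^ K - 1)\<close> by Bernoulli's inequality with exponent
  \<open>K div 2\<close>, the upper bound on the mean of \<open>Y\<close>
  bounds the second moment of \<open>X\<close>, and with the lower bound on its mean this makes \<open>X\<close> almost equal to
  1 outside a set of small weight. There \<open>Y\<close> is at least almost \<open>X ^ K\<close>, hence at least almost 1. As
  its mean is at most almost 1, Markov's inequality shows that \<open>Y\<close> rarely exceeds \<open>1 + \<omega>\<close>.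
\<close>

lemma moment_concentration:
  fixes w X Y :: "'a \<Rightarrow> real"
  assumes fin: "finite S" and T: "T \<subseteq> S" and w: "\<And>v. v \<in> S \<Longrightarrow> 0 \<le> w v" and p0: "0 < p0"
    and K: "even K" "0 < K" and r: "0 \<le> r" "r \<le> 1" and \<sigma>: "0 < \<sigma>" "\<sigma> \<le> 1" "real K * \<sigma> + r \<le> 1" and \<omega>: "0 < \<omega>"
    and W: "sum w T \<le> (1 + r) * p0" "(1 - r) * p0 \<le> sum w T"
    and X: "(1 - r) * p0 \<le> (\<Sum>v\<in>T. w v * X v)" and Y: "(\<Sum>v\<in>T. w v * Y v) \<le> (1 + r) * p0"
    and nonneg: "\<And>v. v \<in> T \<Longrightarrow> 0 \<le> X v" "\<And>v. v \<in> T \<Longrightarrow> 0 \<le> Y v"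
    and XY: "\<And>v. v \<in> T \<Longrightarrow> X v ^ K \<le> (1 + r) * Y v"
  shows "(1 - r - 6 * r / \<sigma>\<^sup>2 - (3 * r + real K * \<sigma> + 6 * r / \<sigma>\<^sup>2) / \<omega>) * p0
    \<le> sum w {v \<in> T. \<bar>X v - 1\<bar> \<le> \<sigma> \<and> Y v \<le> 1 + \<omega>}"
proof -
  have K2: "2 \<le> real K" using K by (auto elim!: evenE)
  have finT: "finite T" using fin T finite_subset by blast
  have wT: "0 \<le> w v" if "v \<in> T" for v using w T that by auto
  define \<beta> where "\<beta> = real K * \<sigma> + r"
  have sq: "(X v)\<^sup>2 \<le> (1 - 2 / K) + (2 / K) * ((1 + r) * Y v)" if v: "v \<in> T" for v
  proof -
    obtain L where L: "K = 2 * L" using K by (elim evenE)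
    have "1 + L * ((X v)\<^sup>2 - 1) \<le> (1 + ((X v)\<^sup>2 - 1)) ^ L"
      by (rule Bernoulli_inequality) simp
    also have "\<dots> = X v ^ K" by (simp add: L power_mult)
    also have "\<dots> \<le> (1 + r) * Y v" by (rule XY[OF v])
    finally have "(X v)\<^sup>2 \<le> (real L - 1 + (1 + r) * Y v) / L"
      using K L by (simp add: field_simps)
    also have "\<dots> = (1 - 2 / K) + (2 / K) * ((1 + r) * Y v)"
      using K L by (simp add: diff_divide_distrib add_divide_distrib)
    finally show ?thesis .
  qed
  have var: "(\<Sum>v\<in>T. w v * (X v - 1)\<^sup>2) \<le> 6 * r * p0"
  proof -
    have "(\<Sum>v\<in>T. w v * (X v - 1)\<^sup>2) \<le>
        (\<Sum>v\<in>T. (2 - 2 / K) * w v + (2 / K * (1 + r)) * (w v * Y v) - 2 * (w v * X v))"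
    proof (rule sum_mono)
      fix v assume v: "v \<in> T"
      have "w v * (X v - 1)\<^sup>2 \<le> w v * (((1 - 2 / K) + (2 / K) * ((1 + r) * Y v)) - 2 * X v + 1)"
        using sq[OF v] by (intro mult_left_mono wT[OF v]) (simp add: power2_diff)
      then show "w v * (X v - 1)\<^sup>2 \<le>
          (2 - 2 / K) * w v + (2 / K * (1 + r)) * (w v * Y v) - 2 * (w v * X v)"
        by (simp add: algebra_simps add_divide_distrib)
    qed
    also have "\<dots> = (2 - 2 / K) * sum w T + (2 / K * (1 + r)) * (\<Sum>v\<in>T. w v * Y v)
        - 2 * (\<Sum>v\<in>T. w v * X v)"
      by (simp only: sum.distrib sum_subtractf sum_distrib_left)
    also have "\<dots> \<le> (2 - 2 / K) * ((1 + r) * p0) + (2 / K * (1 + r)) * ((1 + r) * p0)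
        - 2 * ((1 - r) * p0)"
      using W X Y K r by (intro add_mono diff_mono mult_left_mono) (auto simp: field_simps)
    also have "\<dots> = p0 * (4 * r + (2 / K) * (r + r * r))"
      using K by (simp add: field_simps)
    also have "\<dots> \<le> p0 * (4 * r + 1 * (r + r))"
      using K r p0 by (intro mult_left_mono add_mono mult_mono) (auto simp: mult_left_le)
    finally show ?thesis by (simp add: ac_simps)
  qed
  let ?T1 = "{v \<in> T. \<bar>X v - 1\<bar> \<le> \<sigma>}" and ?T2 = "{v \<in> T. \<bar>X v - 1\<bar> \<le> \<sigma> \<and> Y v \<le> 1 + \<omega>}"
  \<comment> \<open>Chebyshev's inequality for \<open>X\<close> alone, as a family with one member.\<close>
  have bad1: "sum w (T - ?T1) \<le> 6 * r / \<sigma>\<^sup>2 * p0"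
  proof -
    have "sum w {v \<in> T. \<exists>i\<in>{()}. \<sigma> < \<bar>X v - 1\<bar>} \<le> card {()} * (6 * r * p0) / \<sigma>\<^sup>2"
      using Chebyshev_family[of T "{()}" w \<sigma> "\<lambda>_. X" "6 * r * p0"] finT wT \<sigma> var by simp
    moreover have "{v \<in> T. \<exists>i\<in>{()}. \<sigma> < \<bar>X v - 1\<bar>} = T - ?T1" by auto
    ultimately show ?thesis by simp
  qed
  have mass1: "(1 - r - 6 * r / \<sigma>\<^sup>2) * p0 \<le> sum w ?T1"
    using bad1 W sum_diff[OF finT, of ?T1 w] by (simp add: algebra_simps)
  have low: "1 - \<beta> \<le> Y v" if v: "v \<in> ?T1" for v
  proof -
    have "1 + K * (- \<sigma>) \<le> (1 + (- \<sigma>)) ^ K" using \<sigma> by (intro Bernoulli_inequality) auto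
    also have "\<dots> \<le> X v ^ K" using v \<sigma> by (intro power_mono) auto
    also have "\<dots> \<le> (1 + r) * Y v" using XY v by auto
    finally have *: "1 - K * \<sigma> \<le> (1 + r) * Y v" by simp
    have "(1 + r) * (1 - \<beta>) \<le> 1 - K * \<sigma>"
    proof -
      have "0 \<le> r * (K * \<sigma> + r)" using r \<sigma> by simp
      then show ?thesis by (simp add: \<beta>_def algebra_simps)
    qed
    then have "(1 + r) * (1 - \<beta>) \<le> (1 + r) * Y v" using * by linarith
    then show ?thesis using r by (simp add: mult_le_cancel_left)
  qed
  \<comment> \<open>Markov's inequality for \<open>Y - 1 + \<beta>\<close>, which is nonnegative on \<open>?T1\<close>.\<close>
  have "\<omega> * sum w (?T1 - ?T2) = (\<Sum>v\<in>?T1 - ?T2. w v * \<omega>)"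
    by (simp add: sum_distrib_left mult.commute)
  also have "\<dots> \<le> (\<Sum>v\<in>?T1 - ?T2. w v * (Y v - 1 + \<beta>))"
  proof (rule sum_mono)
    fix v assume v: "v \<in> ?T1 - ?T2"
    have "0 \<le> \<beta>" using \<sigma> r by (simp add: \<beta>_def)
    then show "w v * \<omega> \<le> w v * (Y v - 1 + \<beta>)"
      using v wT by (intro mult_left_mono) auto
  qed
  also have "\<dots> \<le> (\<Sum>v\<in>?T1. w v * (Y v - 1 + \<beta>))"
    using finT wT low by (intro sum_mono2) (force intro!: mult_nonneg_nonneg)+
  also have "\<dots> = (\<Sum>v\<in>?T1. w v * Y v) - (1 - \<beta>) * sum w ?T1"
    by (simp add: sum_distrib_left sum_subtractf[symmetric] algebra_simps)
  also have "\<dots> \<le> (1 + r) * p0 - (1 - \<beta>) * ((1 - r - 6 * r / \<sigma>\<^sup>2) * p0)"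
  proof (intro diff_mono mult_left_mono mass1)
    show "0 \<le> 1 - \<beta>" using \<sigma> by (simp add: \<beta>_def)
    have "(\<Sum>v\<in>?T1. w v * Y v) \<le> (\<Sum>v\<in>T. w v * Y v)"
      using finT wT nonneg by (intro sum_mono2) auto
    then show "(\<Sum>v\<in>?T1. w v * Y v) \<le> (1 + r) * p0" using Y by linarith
  qed
  also have "\<dots> \<le> (3 * r + real K * \<sigma> + 6 * r / \<sigma>\<^sup>2) * p0"
  proof -
    define y where "y = 6 * r / \<sigma>\<^sup>2"
    have "0 \<le> p0 * \<beta> * (r + y)" using p0 r \<sigma> by (simp add: \<beta>_def y_def)
    then show ?thesis unfolding y_def[symmetric] by (simp add: \<beta>_def algebra_simps)
  qed
  finally have "sum w (?T1 - ?T2) \<le> (3 * r + real K * \<sigma> + 6 * r / \<sigma>\<^sup>2) / \<omega> * p0"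
    using \<omega> by (simp add: field_simps)
  moreover have "sum w (?T1 - ?T2) = sum w ?T1 - sum w ?T2"
    using finT by (intro sum_diff) auto
  ultimately show ?thesis using mass1 by (simp add: algebra_simps)
qed

section \<open>Octahedron counts in the given hypergraphs\<close>

text \<open>
  The numbers of vertices per part of the octahedra between the simple and the fully doubled one.
  Part 0 is not covered by this scheme: its number of vertices is always set separately.
\<close>

definition ladder :: "nat \<Rightarrow> nat \<Rightarrow> nat" where
  "ladder i j = (if j \<le> i then 2 else 1)"

lemma ladder_step:
  "(ladder i)(Suc i := 1) = ladder i" "(ladder i)(Suc i := 2) = ladder (Suc i)"
  by (auto simp: ladder_def fun_eq_iff)

text \<open>
  The hypotheses of the theorem in the case where no density vanishes. The numbers \<open>r\<close> and \<open>z\<close> organise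
  the errors: the bounds on the moments over \<open>v\<close> hold up to a factor \<open>1 \<plusminus> r\<close>, while \<open>z\<close> is the much smaller
  accuracy of the octahedron densities in the links of \<open>\<gamma>\<close>. The bounds \<open>\<eta> \<le> z ^ 4\<close> and
  \<open>\<epsilon> \<le> z\<^sup>2 * d\<^sub>0 ^ (2 * 2 ^ k)\<close> leave room for the square lost in Chebyshev's inequality and for the
  division by powers of \<open>d\<close> and \<open>d'\<close>.
\<close>

locale inheritance =
  fixes k :: nat and \<epsilon> \<eta> d\<^sub>0 d d' r z :: real and V :: "nat \<Rightarrow> 'a set"
    and p :: "nat set \<Rightarrow> real" and g \<gamma> :: "'a set \<Rightarrow> real"
  assumes k: "1 \<le> k" and d0: "0 < d\<^sub>0" "d\<^sub>0 \<le> 1" and d: "d\<^sub>0 \<le> d" "d\<^sub>0 \<le> d'"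
    and small: "0 < r" "r \<le> 1" "0 < z" "2 ^ 10 * 2 ^ k * z \<le> r * d\<^sub>0 ^ 2 ^ k"
      "0 < \<epsilon>" "\<epsilon> \<le> z\<^sup>2 * d\<^sub>0 ^ (2 * 2 ^ k)" "0 < \<eta>" "\<eta> \<le> z ^ 4"
    and parts: "\<And>j. j \<in> {0..k} \<Longrightarrow> finite (V j)" "\<And>j. j \<in> {0..k} \<Longrightarrow> V j \<noteq> {}"
      "disjoint_family_on V {0..k}"
    and p_pos: "\<And>f. f \<subseteq> {0..k} \<Longrightarrow> 0 < p f" and \<gamma>_empty: "0 < \<gamma> {}"
    and g: "\<And>e. e \<subseteq> (\<Union>j\<in>{0..k}. V j) \<Longrightarrow> 0 \<le> g e \<and> g e \<le> \<gamma> e"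
    and counts: "\<And>a. \<forall>j\<in>{0..k}. a j \<le> 2 \<Longrightarrow>
        (1 - \<eta>) * (\<gamma> {} / p {} * count (\<lambda>j. {j}) p (octv {0..k} a)) \<le> count V \<gamma> (octv {0..k} a) \<and>
        count V \<gamma> (octv {0..k} a) \<le> (1 + \<eta>) * (\<gamma> {} / p {} * count (\<lambda>j. {j}) p (octv {0..k} a))"
    and counts_plus: "\<And>a. \<forall>j\<in>{1..k}. a j \<le> 2 \<Longrightarrow>
        hom_density {0..k} V \<gamma> (plus2_octahedron k a)
          \<le> (1 + \<eta>) * (\<gamma> {} / p {} * density_graph_density {0..k} p (plus2_octahedron k a))"
    and same: "\<And>e. crossing {0..k} V e \<Longrightarrow> card e \<noteq> k + 1 \<Longrightarrow> e \<notin> transversals V {1..k} \<Longrightarrow> g e = \<gamma> e"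
    and reg_top: "regular_wrt {0..k} V \<epsilon> d' (\<lambda>e. if card e = k + 1 then g e else \<gamma> e) \<gamma>"
    and reg_low: "regular_wrt {1..k} V \<epsilon> d g \<gamma>"
begin

definition top_graph :: "'a set \<Rightarrow> real" where
  "top_graph e = (if card e = k + 1 then g e else \<gamma> e)"

text \<open>
  The octahedron with \<open>c\<close> vertices in part 0 and \<open>a j\<close> vertices in each other part \<open>j\<close>: \<open>N h c a\<close> is its
  density in \<open>h\<close>, and \<open>P c a\<close> is the density that \<open>\<gamma>\<close> is expected to have.
\<close>

definition P :: "nat \<Rightarrow> (nat \<Rightarrow> nat) \<Rightarrow> real" where
  "P c a = \<gamma> {} / p {} * count (\<lambda>j. {j}) p (octv {0..k} (a(0 := c)))"

definition N :: "('a set \<Rightarrow> real) \<Rightarrow> nat \<Rightarrow> (nat \<Rightarrow> nat) \<Rightarrow> real" where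
  "N h c a = count V h (octv {0..k} (a(0 := c)))"

lemma top_bounds: "e \<subseteq> (\<Union>j\<in>{0..k}. V j) \<Longrightarrow> 0 \<le> top_graph e \<and> top_graph e \<le> \<gamma> e"
  using g[of e] by (auto simp: top_graph_def)

lemma N_zero: "N h 0 a = count V h (octv {1..k} a)"
  by (simp add: N_def octv_zero)

lemma N_nonneg:
  assumes "\<And>e. e \<subseteq> (\<Union>j\<in>{0..k}. V j) \<Longrightarrow> 0 \<le> h e"
  shows "0 \<le> N h c a"
  unfolding N_def by (rule count_nonneg[OF assms fst_octv])

lemma N_mono:
  assumes "\<And>e. e \<subseteq> (\<Union>j\<in>{0..k}. V j) \<Longrightarrow> 0 \<le> h e \<and> h e \<le> h' e"
  shows "N h c a \<le> N h' c a"
  unfolding N_def by (rule count_mono[OF assms fst_octv])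

lemma N_\<gamma>:
  assumes "\<forall>j\<in>{1..k}. a j \<le> 2" "c \<le> 2"
  shows "(1 - \<eta>) * P c a \<le> N \<gamma> c a" "N \<gamma> c a \<le> (1 + \<eta>) * P c a"
  using counts[of "a(0 := c)"] assms by (auto simp: N_def P_def)

lemma P_slice0:
  obtains A R where "0 < A" "0 < R" "\<And>c. P c a = A * R ^ c"
proof -
  obtain A R where "0 < A" "0 < R"
    "\<And>c. count (\<lambda>j. {j}) p (octv {0..k} (a(0 := c))) = A * R ^ c"
    using density_slice[of "{0..k}" 0 p a] p_pos by (auto simp: atLeast0AtMost)
  then show ?thesis
    using that[of "\<gamma> {} / p {} * A" R] \<gamma>_empty p_pos[of "{}"] by (simp add: P_def)
qed

lemma P_pos: "0 < P c a"
  using P_slice0[of a] by (metis mult_pos_pos zero_less_power)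

lemma P_square:
  assumes "j \<in> {1..k}"
  shows "(P c (a(j := 1)))\<^sup>2 = P c (a(j := 0)) * P c (a(j := 2))"
proof -
  obtain A R where "\<And>i. count (\<lambda>j. {j}) p (octv {0..k} ((a(0 := c))(j := i))) = A * R ^ i"
    by (rule density_slice[of "{0..k}" j p "a(0 := c)"]) (use p_pos assms in auto)
  moreover have "(a(0 := c))(j := i) = (a(j := i))(0 := c)" for i
    using assms by (intro fun_upd_twist) auto
  ultimately have "P c (a(j := i)) = \<gamma> {} / p {} * (A * R ^ i)" for i by (simp add: P_def)
  then show ?thesis by (simp add: power2_eq_square)
qed

text \<open>
  The edges inside \<open>V 1, \<dots>, V k\<close> are too small to carry weights of \<open>g\<close>. On edges through \<open>V 0\<close> the
  hypergraphs \<open>top_graph\<close> and \<open>g\<close> agree: those with fewer than \<open>k + 1\<close> vertices have the weight of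
  \<open>\<gamma>\<close> in both.
\<close>

lemma N_top_slice:
  "N top_graph c a = avg (maps V (octv {1..k} a)) (\<lambda>\<alpha>. wt \<gamma> (octv {1..k} a) \<alpha> *
      avg (V 0) (\<lambda>x. wt_at g (octv {1..k} a) x \<alpha>) ^ c)"
proof -
  let ?X = "octv {1..k} a"
  have J: "{0..k} - {0} = {1..k}" by auto
  have wt: "wt top_graph ?X \<alpha> = wt \<gamma> ?X \<alpha>" if "\<alpha> \<in> maps V ?X" for \<alpha>
    unfolding wt_def
  proof (rule prod.cong[OF refl])
    fix e assume "e \<in> cross ?X"
    then have "finite e" "card e \<le> k" using card_cross[of e ?X "{1..k}"] fst_octv by auto
    then have "card (\<alpha> ` e) \<noteq> k + 1" using card_image_le[of e \<alpha>] by linarith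
    then show "top_graph (\<alpha> ` e) = \<gamma> (\<alpha> ` e)" by (simp add: top_graph_def)
  qed
  have wt_at: "wt_at top_graph ?X x \<alpha> = wt_at g ?X x \<alpha>" if \<alpha>: "\<alpha> \<in> maps V ?X" and x: "x \<in> V 0" for \<alpha> x
    unfolding wt_at_def
  proof (rule prod.cong[OF refl])
    fix e assume e: "e \<in> cross ?X"
    let ?\<phi> = "\<alpha>((0, 0) := x)" and ?e = "insert (0, 0) e"
    have sub: "e \<subseteq> ?X" and inj: "inj_on fst e" using e by (auto simp: cross_def)
    have f: "fst ` e \<subseteq> {1..k}" using sub fst_octv by blast
    have n: "(0, 0) \<notin> e" using f by force
    have im: "insert x (\<alpha> ` e) = ?\<phi> ` ?e" using n by auto
    have "crossing {0..k} V (insert x (\<alpha> ` e))"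
      unfolding im
    proof (rule crossing_image[OF parts(3)])
      show "inj_on fst ?e" using inj f by (force simp: inj_on_def)
      show "fst ` ?e \<subseteq> {0..k}" using f by auto
      show "?\<phi> z \<in> V (fst z)" if "z \<in> ?e" for z
        using that PiE_mem[OF \<alpha>[unfolded maps_def], of z] sub x by auto
    qed
    moreover have "x \<notin> (\<Union>j\<in>{1..k}. V j)"
    proof
      assume "x \<in> (\<Union>j\<in>{1..k}. V j)"
      then obtain j where "j \<in> {1..k}" "x \<in> V j" by blast
      then show False using disjoint_family_onD[OF parts(3), of 0 j] x by auto
    qed
    then have "insert x (\<alpha> ` e) \<notin> transversals V {1..k}" by (auto simp: transversals_def)
    ultimately show "top_graph (insert x (\<alpha> ` e)) = g (insert x (\<alpha> ` e))"
      using same[of "insert x (\<alpha> ` e)"] by (auto simp: top_graph_def)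
  qed
  have inner: "avg (V 0) (\<lambda>x. wt_at top_graph ?X x \<alpha>) = avg (V 0) (\<lambda>x. wt_at g ?X x \<alpha>)"
    if "\<alpha> \<in> maps V ?X" for \<alpha>
    by (rule avg_cong) (rule wt_at[OF that])
  have "N top_graph c a = avg (maps V ?X) (\<lambda>\<alpha>. wt top_graph ?X \<alpha> * avg (V 0) (\<lambda>x. wt_at top_graph ?X x \<alpha>) ^ c)"
    unfolding N_def using octv_slice[of "{0..k}" 0 V top_graph a c] parts(1)[of 0] unfolding J by simp
  also have "\<dots> = avg (maps V ?X) (\<lambda>\<alpha>. wt \<gamma> ?X \<alpha> * avg (V 0) (\<lambda>x. wt_at g ?X x \<alpha>) ^ c)"
    by (rule avg_cong) (simp only: wt inner)
  finally show ?thesis .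
qed

lemma N_g_slice:
  "N g c a = avg (maps V (octv {1..k} a)) (\<lambda>\<alpha>. wt g (octv {1..k} a) \<alpha> *
      avg (V 0) (\<lambda>x. wt_at g (octv {1..k} a) x \<alpha>) ^ c)"
proof -
  have J: "{0..k} - {0} = {1..k}" by auto
  show ?thesis
    unfolding N_def using octv_slice[of "{0..k}" 0 V g a c] parts(1)[of 0] unfolding J by simp
qed

lemma ladder_le: "\<forall>j\<in>{1..k}. ladder i j \<le> 2" "\<forall>j\<in>{1..k}. ((ladder i)(l := 0)) j \<le> 2"
  by (auto simp: ladder_def)

text \<open>
  The octahedra with a removed part play the role of \<open>F0\<close> in \<open>ladder_chain\<close>. They are bounded by their
  densities in \<open>\<gamma>\<close>, which the counting hypothesis controls.
\<close>

lemma top_chain: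
  assumes c: "c \<le> 2"
  shows "(N top_graph c (ladder 0) / P c (ladder 0)) ^ 2 ^ k
    \<le> (1 + \<eta>) ^ 2 ^ k * (N top_graph c (ladder k) / P c (ladder k))"
proof (rule ladder_chain[where F = "\<lambda>i. N top_graph c (ladder i)" and Q = "\<lambda>i. P c (ladder i)"
      and ?F0.0 = "\<lambda>i. N top_graph c ((ladder i)(Suc i := 0))"
      and ?Q0.0 = "\<lambda>i. P c ((ladder i)(Suc i := 0))"])
  fix i assume i: "i < k"
  have upd: "((ladder i)(0 := c))(Suc i := n) = ((ladder i)(Suc i := n))(0 := c)" for n
    by (rule fun_upd_twist) simp
  show "(N top_graph c (ladder i))\<^sup>2 \<le> N top_graph c ((ladder i)(Suc i := 0)) * N top_graph c (ladder (Suc i))"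
    using octahedron_Cauchy_Schwarz[of "{0..k}" "Suc i" V top_graph "(ladder i)(0 := c)"]
      i parts(1) top_bounds unfolding upd ladder_step N_def by simp
  show "(P c (ladder i))\<^sup>2 = P c ((ladder i)(Suc i := 0)) * P c (ladder (Suc i))"
    using P_square[of "Suc i" c "ladder i"] i unfolding ladder_step by simp
  have "N top_graph c ((ladder i)(Suc i := 0)) \<le> N \<gamma> c ((ladder i)(Suc i := 0))"
    by (rule N_mono[OF top_bounds])
  then show "N top_graph c ((ladder i)(Suc i := 0)) \<le> (1 + \<eta>) * P c ((ladder i)(Suc i := 0))"
    using N_\<gamma>(2)[OF ladder_le(2) c] by (rule order_trans)
qed (use P_pos N_nonneg top_bounds small in \<open>auto intro: less_imp_le\<close>)

lemma le_times_power: "c \<le> C \<Longrightarrow> 0 \<le> C \<Longrightarrow> c \<le> C * 2 ^ k" for c C :: real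
  using mult_left_mono[of 1 "2 ^ k" C] by simp

lemma \<gamma>_nonneg: "e \<subseteq> (\<Union>j\<in>{0..k}. V j) \<Longrightarrow> 0 \<le> \<gamma> e"
  using g[of e] by linarith

lemma z_bounds:
  "2 ^ 10 * 2 ^ k * z \<le> r" "z \<le> 1" "0 < z\<^sup>2" "z\<^sup>2 \<le> 1" "z\<^sup>2 \<le> z" "\<eta> \<le> z\<^sup>2" "4 * 2 ^ k * z\<^sup>2 \<le> 1"
proof -
  have "d\<^sub>0 ^ 2 ^ k \<le> 1" using d0 by (simp add: power_le_one)
  then have "r * d\<^sub>0 ^ 2 ^ k \<le> r * 1" using small by (intro mult_left_mono) auto
  then show 1: "2 ^ 10 * 2 ^ k * z \<le> r" using small by linarith
  have "1 * z \<le> 2 ^ 10 * 2 ^ k * z"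
    using small by (intro mult_right_mono le_times_power) auto
  then show z: "z \<le> 1" using 1 small by linarith
  show "0 < z\<^sup>2" using small by simp
  show "z\<^sup>2 \<le> 1" using z small by (simp add: power_le_one)
  show zz: "z\<^sup>2 \<le> z" using z small by (simp add: power2_eq_square mult_left_le)
  have "z ^ 4 \<le> z\<^sup>2" using z small by (intro power_decreasing) auto
  then show "\<eta> \<le> z\<^sup>2" using small by linarith
  have "4 * 2 ^ k * z\<^sup>2 \<le> 2 ^ 10 * 2 ^ k * z" using zz small by (intro mult_mono) auto
  then show "4 * 2 ^ k * z\<^sup>2 \<le> 1" using 1 small by linarith
qed

text \<open>
  The additive error \<open>\<epsilon>\<close> is a small relative error for every power of \<open>d\<close> or \<open>d'\<close> that occurs.
\<close>

lemma \<epsilon>_le: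
  assumes "d\<^sub>0 \<le> x" "n \<le> 2 * 2 ^ k"
  shows "\<epsilon> \<le> z\<^sup>2 * x ^ n"
proof -
  have "d\<^sub>0 ^ (2 * 2 ^ k) \<le> d\<^sub>0 ^ n" using assms d0 by (intro power_decreasing) auto
  also have "\<dots> \<le> x ^ n" using assms d0 by (intro power_mono) auto
  finally have "z\<^sup>2 * d\<^sub>0 ^ (2 * 2 ^ k) \<le> z\<^sup>2 * x ^ n" by (intro mult_left_mono) auto
  then show ?thesis using small by linarith
qed

lemma octv_ladder:
  "octv {0..k} (\<lambda>_. 1) = octv {0..k} ((ladder 0)(0 := 1))"
  "octv {0..k} (\<lambda>_. 2) = octv {0..k} ((ladder k)(0 := 2))"
  "octv {1..k} (\<lambda>_. 1) = octv {1..k} (ladder 0)"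
  "octv {1..k} (\<lambda>_. 2) = octv {1..k} (ladder k)"
  by (auto intro!: octv_cong simp: ladder_def)

lemma regularity_top:
  "(d' - \<epsilon>) * N \<gamma> 1 (ladder 0) \<le> N top_graph 1 (ladder 0)"
  "N top_graph 2 (ladder k) \<le> (d' ^ (2 * 2 ^ k) + \<epsilon>) * N \<gamma> 2 (ladder k)"
  using reg_top
  unfolding regular_wrt_def hom_density_octahedron octv_ladder N_def[symmetric] top_graph_def[symmetric]
  by simp_all

lemma regularity_low:
  "(d - \<epsilon>) * N \<gamma> 0 (ladder 0) \<le> N g 0 (ladder 0)"
  "N g 0 (ladder k) \<le> (d ^ 2 ^ k + \<epsilon>) * N \<gamma> 0 (ladder k)"
  using reg_low
  unfolding regular_wrt_def hom_density_octahedron octv_ladder N_zero[symmetric]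
  by simp_all

lemma top_low_moment: "(1 - z\<^sup>2)\<^sup>2 * d' * P 1 (ladder 0) \<le> N top_graph 1 (ladder 0)"
proof -
  have "(1 - z\<^sup>2) * d' * ((1 - z\<^sup>2) * P 1 (ladder 0)) \<le> (d' - \<epsilon>) * ((1 - \<eta>) * P 1 (ladder 0))"
  proof (rule mult_mono)
    show "(1 - z\<^sup>2) * d' \<le> d' - \<epsilon>" using \<epsilon>_le[of d' 1] d by (simp add: algebra_simps)
    then show "0 \<le> d' - \<epsilon>" using z_bounds d d0 mult_nonneg_nonneg[of "1 - z\<^sup>2" d'] by linarith
    show "(1 - z\<^sup>2) * P 1 (ladder 0) \<le> (1 - \<eta>) * P 1 (ladder 0)"
      using z_bounds P_pos[of 1 "ladder 0"] by (intro mult_right_mono) auto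
    show "0 \<le> (1 - z\<^sup>2) * P 1 (ladder 0)" using z_bounds P_pos[of 1 "ladder 0"] by simp
  qed
  also have "\<dots> \<le> (d' - \<epsilon>) * N \<gamma> 1 (ladder 0)"
  proof (rule mult_left_mono)
    have "z\<^sup>2 * d' \<le> d'" using z_bounds d d0 by (simp add: mult_left_le_one_le)
    then show "0 \<le> d' - \<epsilon>" using \<epsilon>_le[of d' 1] d by simp
  qed (use N_\<gamma>(1)[OF ladder_le(1)] in auto)
  also have "\<dots> \<le> N top_graph 1 (ladder 0)" by (rule regularity_top)
  finally show ?thesis by (simp add: power2_eq_square ac_simps)
qed

lemma top_high_moment:
  "N top_graph 2 (ladder k) \<le> (1 + z\<^sup>2)\<^sup>2 * d' ^ (2 * 2 ^ k) * P 2 (ladder k)"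
proof -
  have "N top_graph 2 (ladder k) \<le> (d' ^ (2 * 2 ^ k) + \<epsilon>) * N \<gamma> 2 (ladder k)" by (rule regularity_top)
  also have "\<dots> \<le> ((1 + z\<^sup>2) * d' ^ (2 * 2 ^ k)) * ((1 + z\<^sup>2) * P 2 (ladder k))"
  proof (rule mult_mono)
    show "d' ^ (2 * 2 ^ k) + \<epsilon> \<le> (1 + z\<^sup>2) * d' ^ (2 * 2 ^ k)"
      using \<epsilon>_le[of d' "2 * 2 ^ k"] d by (simp add: algebra_simps)
    have "(1 + \<eta>) * P 2 (ladder k) \<le> (1 + z\<^sup>2) * P 2 (ladder k)"
      using z_bounds P_pos[of 2 "ladder k"] by (intro mult_right_mono) auto
    then show "N \<gamma> 2 (ladder k) \<le> (1 + z\<^sup>2) * P 2 (ladder k)"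
      using N_\<gamma>(2)[OF ladder_le(1)[of k], of 2] by linarith
    show "0 \<le> N \<gamma> 2 (ladder k)" by (rule N_nonneg) (rule \<gamma>_nonneg)
    show "0 \<le> (1 + z\<^sup>2) * d' ^ (2 * 2 ^ k)" using d d0 by simp
  qed
  finally show ?thesis by (simp add: power2_eq_square ac_simps)
qed

text \<open>
  The chain bounds the \<open>2 ^ k\<close>-th power of the density of the octahedron in which only part 0 is
  doubled by the density of the fully doubled one, which regularity bounds by a power of \<open>d'\<close>.
\<close>

lemma top_low_second_moment:
  "N top_graph 2 (ladder 0) \<le> (1 + 4 * 2 ^ k * z\<^sup>2) * d'\<^sup>2 * P 2 (ladder 0)"
proof -
  let ?y = "z\<^sup>2" and ?u = "N top_graph 2 (ladder 0) / P 2 (ladder 0)"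
  have y: "0 < ?y" "?y \<le> 1" "\<eta> \<le> ?y" using z_bounds by auto
  have d': "0 < d'" using d d0 by linarith
  have "?u ^ 2 ^ k \<le> (1 + \<eta>) ^ 2 ^ k * (N top_graph 2 (ladder k) / P 2 (ladder k))"
    by (rule top_chain) simp
  also have "\<dots> \<le> (1 + ?y) ^ 2 ^ k * ((1 + ?y)\<^sup>2 * d' ^ (2 * 2 ^ k))"
  proof (rule mult_mono)
    show "(1 + \<eta>) ^ 2 ^ k \<le> (1 + ?y) ^ 2 ^ k" using y small by (intro power_mono) auto
    show "N top_graph 2 (ladder k) / P 2 (ladder k) \<le> (1 + ?y)\<^sup>2 * d' ^ (2 * 2 ^ k)"
      using top_high_moment P_pos[of 2 "ladder k"] by (simp add: pos_divide_le_eq)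
    show "0 \<le> N top_graph 2 (ladder k) / P 2 (ladder k)"
      using P_pos[of 2 "ladder k"] N_nonneg[of top_graph 2 "ladder k"] top_bounds by simp
  qed (use y in simp)
  also have "\<dots> \<le> (1 + ?y) ^ 2 ^ k * (((1 + ?y)\<^sup>2) ^ 2 ^ k * (d'\<^sup>2) ^ 2 ^ k)"
  proof (intro mult_left_mono)
    have "((1 + ?y)\<^sup>2) ^ 1 \<le> ((1 + ?y)\<^sup>2) ^ 2 ^ k"
      using y by (intro power_increasing) auto
    then show "(1 + ?y)\<^sup>2 * d' ^ (2 * 2 ^ k) \<le> ((1 + ?y)\<^sup>2) ^ 2 ^ k * (d'\<^sup>2) ^ 2 ^ k"
      unfolding power_mult[symmetric] using d' by (intro mult_right_mono) auto
  qed (use y in auto)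
  also have "\<dots> = ((1 + ?y) ^ 3 * d'\<^sup>2) ^ 2 ^ k"
    by (simp add: power_mult_distrib power2_eq_square power3_eq_cube)
  finally have "?u ^ 2 ^ k \<le> ((1 + ?y) ^ 3 * d'\<^sup>2) ^ 2 ^ k" .
  moreover have "0 \<le> ?u"
    using P_pos[of 2 "ladder 0"] N_nonneg[of top_graph 2 "ladder 0"] top_bounds by simp
  moreover have "0 \<le> (1 + ?y) ^ 3 * d'\<^sup>2" using y by simp
  ultimately have "?u \<le> (1 + ?y) ^ 3 * d'\<^sup>2"
    using power_mono_iff[of ?u "(1 + ?y) ^ 3 * d'\<^sup>2" "2 ^ k"] by simp
  also have "\<dots> \<le> (1 + 4 * 2 ^ k * ?y) * d'\<^sup>2"
  proof (rule mult_right_mono)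
    have "?y * ?y \<le> ?y * 1" by (rule mult_left_mono) (use y in auto)
    moreover have "?y * (?y * ?y) \<le> ?y * (1 * 1)"
      by (intro mult_left_mono mult_mono) (use y in auto)
    moreover have "(1 + ?y) ^ 3 = 1 + 3 * ?y + 3 * (?y * ?y) + ?y * (?y * ?y)"
      by (simp add: power3_eq_cube algebra_simps)
    ultimately have "(1 + ?y) ^ 3 \<le> 1 + 8 * ?y"
      using y(1) by linarith
    also have "8 * ?y \<le> 4 * 2 ^ k * ?y"
    proof (rule mult_right_mono)
      have "(2 :: real) \<le> 2 ^ k" using power_increasing[of 1 k "2 :: real"] k by simp
      then show "(8 :: real) \<le> 4 * 2 ^ k" by linarith
    qed (use y in simp)
    finally show "(1 + ?y) ^ 3 \<le> 1 + 4 * 2 ^ k * ?y" by simp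
  qed simp
  finally show ?thesis using P_pos[of 2 "ladder 0"] by (simp add: pos_divide_le_eq)
qed

text \<open>
  The same chain with one vertex in part 0 is read in the other direction: from the lower bound for
  the simple octahedron to one for the octahedron that is doubled in the parts \<open>1, \<dots>, k\<close>.
\<close>

lemma top_high_first_moment:
  "(1 - 4 * 2 ^ k * z\<^sup>2) * d' ^ 2 ^ k * P 1 (ladder k) \<le> N top_graph 1 (ladder k)"
proof -
  let ?y = "z\<^sup>2" and ?u = "N top_graph 1 (ladder k) / P 1 (ladder k)"
  have y: "0 < ?y" "?y \<le> 1" "\<eta> \<le> ?y" using z_bounds by auto
  have y4: "4 * ?y \<le> 1"
  proof -
    have "4 * ?y \<le> 4 * 2 ^ k * ?y" by (intro mult_right_mono le_times_power) auto
    then show ?thesis using z_bounds(7) by linarith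
  qed
  have d': "0 < d'" using d d0 by linarith
  have "(1 - 3 * ?y) * (1 + ?y) \<le> (1 - ?y)\<^sup>2"
    using small by (simp add: power2_eq_square algebra_simps)
  then have "((1 - 3 * ?y) * (1 + ?y) * d') ^ 2 ^ k \<le> ((1 - ?y)\<^sup>2 * d') ^ 2 ^ k"
    using y4 y d' by (intro power_mono mult_right_mono mult_nonneg_nonneg) auto
  also have "\<dots> \<le> (N top_graph 1 (ladder 0) / P 1 (ladder 0)) ^ 2 ^ k"
    using top_low_moment P_pos[of 1 "ladder 0"] d'
    by (intro power_mono) (auto simp: pos_le_divide_eq)
  also have "\<dots> \<le> (1 + \<eta>) ^ 2 ^ k * ?u" by (rule top_chain) simp
  also have "\<dots> \<le> (1 + ?y) ^ 2 ^ k * ?u"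
  proof (rule mult_right_mono)
    show "(1 + \<eta>) ^ 2 ^ k \<le> (1 + ?y) ^ 2 ^ k" using y small by (intro power_mono) auto
    show "0 \<le> ?u" using P_pos[of 1 "ladder k"] N_nonneg[of top_graph 1 "ladder k"] top_bounds by simp
  qed
  finally have "(1 + ?y) ^ 2 ^ k * ((1 - 3 * ?y) ^ 2 ^ k * d' ^ 2 ^ k) \<le> (1 + ?y) ^ 2 ^ k * ?u"
    by (simp add: power_mult_distrib ac_simps)
  moreover have "0 < (1 + ?y) ^ 2 ^ k" by (rule zero_less_power) (use y(1) in linarith)
  ultimately have *: "(1 - 3 * ?y) ^ 2 ^ k * d' ^ 2 ^ k \<le> ?u"
    by (rule mult_left_le_imp_le)
  have "1 + real (2 ^ k) * (- 3 * ?y) \<le> (1 + (- 3 * ?y)) ^ 2 ^ k"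
    using y4 y by (intro Bernoulli_inequality) auto
  then have "1 - 3 * (2 ^ k * ?y) \<le> (1 - 3 * ?y) ^ 2 ^ k" by (simp add: ac_simps)
  moreover have "0 \<le> 2 ^ k * ?y" by simp
  ultimately have "1 - 4 * 2 ^ k * ?y \<le> (1 - 3 * ?y) ^ 2 ^ k" by linarith
  then have "(1 - 4 * 2 ^ k * ?y) * d' ^ 2 ^ k \<le> (1 - 3 * ?y) ^ 2 ^ k * d' ^ 2 ^ k"
    using d' by (intro mult_right_mono) auto
  then have "(1 - 4 * 2 ^ k * ?y) * d' ^ 2 ^ k \<le> ?u" using * by linarith
  then show ?thesis using P_pos[of 1 "ladder k"] by (simp add: pos_le_divide_eq)
qed

text \<open>
  Let \<open>D \<alpha>\<close> be the weighted number of completions by a vertex of \<open>V 0\<close>. The two hypotheses are bounds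
  on its first and second moment with respect to the weights of \<open>\<gamma>\<close> on \<open>V 1, \<dots>, V k\<close>, so \<open>avg_perturb\<close>
  allows the weights of \<open>g\<close> there.
\<close>

lemma count_completion:
  assumes a: "\<forall>j\<in>{1..k}. a j \<le> 2" and s: "0 < s"
    and first: "(1 - 4 * 2 ^ k * z\<^sup>2) * s * P 1 a \<le> N top_graph 1 a"
    and second: "N top_graph 2 a \<le> (1 + 4 * 2 ^ k * z\<^sup>2) * s\<^sup>2 * P 2 a"
  obtains m t where "0 < m" "0 < t" "P 0 a = m" "P 1 a * s = m * t"
    "\<bar>N g 1 a - t * N g 0 a\<bar> \<le> m * t * (9 * 2 ^ k * z)"
proof -
  obtain A R where AR: "0 < A" "0 < R" "\<And>c. P c a = A * R ^ c" using P_slice0[of a] by metis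
  let ?X = "octv {1..k} a"
  let ?D = "\<lambda>\<alpha>. avg (V 0) (\<lambda>x. wt_at g ?X x \<alpha>)"
  have sub: "fst ` ?X \<subseteq> {0..k}" using fst_octv by fastforce
  have "\<bar>avg (maps V ?X) (\<lambda>\<alpha>. wt g ?X \<alpha> * ?D \<alpha>) - (s * R) * avg (maps V ?X) (wt g ?X)\<bar>
      \<le> A * (s * R) * (z + 2 * (4 * 2 ^ k * z\<^sup>2) / z)"
  proof (rule avg_perturb[where A = "wt \<gamma> ?X"])
    fix \<alpha> assume \<alpha>: "\<alpha> \<in> maps V ?X"
    show "0 \<le> wt g ?X \<alpha> \<and> wt g ?X \<alpha> \<le> wt \<gamma> ?X \<alpha>"
      using wt_nonneg[of V "{0..k}" g, OF _ \<alpha> sub] wt_mono[of V "{0..k}" g \<gamma>, OF _ \<alpha> sub] g by blast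
  next
    have "N \<gamma> 0 a \<le> (1 + \<eta>) * A" using N_\<gamma>(2)[OF a, of 0] AR(3)[of 0] by simp
    also have "\<dots> \<le> (1 + 4 * 2 ^ k * z\<^sup>2) * A"
    proof -
      have "1 * z\<^sup>2 \<le> 4 * 2 ^ k * z\<^sup>2"
        by (intro mult_right_mono le_times_power) auto
      then have "\<eta> \<le> 4 * 2 ^ k * z\<^sup>2" using z_bounds(6) by linarith
      then show ?thesis using AR by (intro mult_right_mono) auto
    qed
    finally show "avg (maps V ?X) (wt \<gamma> ?X) \<le> (1 + 4 * 2 ^ k * z\<^sup>2) * A"
      by (simp add: N_zero count_def)
    show "(1 - 4 * 2 ^ k * z\<^sup>2) * A * (s * R) \<le> avg (maps V ?X) (\<lambda>\<alpha>. wt \<gamma> ?X \<alpha> * ?D \<alpha>)"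
      using first by (simp add: N_top_slice AR(3) ac_simps)
    show "avg (maps V ?X) (\<lambda>\<alpha>. wt \<gamma> ?X \<alpha> * (?D \<alpha>)\<^sup>2) \<le> (1 + 4 * 2 ^ k * z\<^sup>2) * A * (s * R)\<^sup>2"
      using second by (simp add: N_top_slice AR(3) power_mult_distrib ac_simps)
  qed (use AR s z_bounds small in auto)
  also have "z + 2 * (4 * 2 ^ k * z\<^sup>2) / z = (1 + 8 * 2 ^ k) * z"
    using small by (simp add: power2_eq_square algebra_simps)
  also have "A * (s * R) * ((1 + 8 * 2 ^ k) * z) \<le> A * (s * R) * (9 * 2 ^ k * z)"
    using AR s small le_times_power[of 1 1] by (intro mult_left_mono mult_right_mono) auto
  finally have "\<bar>N g 1 a - (s * R) * N g 0 a\<bar> \<le> A * (s * R) * (9 * 2 ^ k * z)"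
    by (simp add: N_g_slice)
  then show ?thesis
    using that[of A "s * R"] AR s by (simp add: ac_simps)
qed

lemma g_first_moment:
  "P 1 (ladder 0) * (d * d') * (1 - r / 2) \<le> N g 1 (ladder 0)"
proof -
  have d': "0 < d" "0 < d'" using d d0 by linarith+
  have "(1 - 4 * 2 ^ k * z\<^sup>2) * d' * P 1 (ladder 0) \<le> (1 - z\<^sup>2)\<^sup>2 * d' * P 1 (ladder 0)"
  proof -
    have "2 * z\<^sup>2 \<le> 4 * 2 ^ k * z\<^sup>2"
      by (intro mult_right_mono le_times_power) auto
    moreover have "1 - 2 * z\<^sup>2 \<le> (1 - z\<^sup>2)\<^sup>2" by (simp add: power2_diff)
    ultimately have "1 - 4 * 2 ^ k * z\<^sup>2 \<le> (1 - z\<^sup>2)\<^sup>2" by linarith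
    then show ?thesis
      using d' P_pos[of 1 "ladder 0"] by (intro mult_right_mono) auto
  qed
  then have first: "(1 - 4 * 2 ^ k * z\<^sup>2) * d' * P 1 (ladder 0) \<le> N top_graph 1 (ladder 0)"
    using top_low_moment by linarith
  obtain m t where mt: "0 < m" "0 < t" "P 0 (ladder 0) = m" "P 1 (ladder 0) * d' = m * t"
    "\<bar>N g 1 (ladder 0) - t * N g 0 (ladder 0)\<bar> \<le> m * t * (9 * 2 ^ k * z)"
    using count_completion[OF ladder_le(1) d'(2) first top_low_second_moment] by blast
  have "(1 - z\<^sup>2) * d * ((1 - z\<^sup>2) * m) \<le> (d - \<epsilon>) * ((1 - \<eta>) * m)"
  proof (rule mult_mono)
    show "(1 - z\<^sup>2) * d \<le> d - \<epsilon>" using \<epsilon>_le[of d 1] d by (simp add: algebra_simps)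
    then show "0 \<le> d - \<epsilon>" using z_bounds d' mult_nonneg_nonneg[of "1 - z\<^sup>2" d] by linarith
    show "(1 - z\<^sup>2) * m \<le> (1 - \<eta>) * m" using z_bounds mt by (intro mult_right_mono) auto
    show "0 \<le> (1 - z\<^sup>2) * m" using z_bounds mt by simp
  qed
  also have "\<dots> \<le> (d - \<epsilon>) * N \<gamma> 0 (ladder 0)"
  proof (rule mult_left_mono)
    have "z\<^sup>2 * d \<le> d" using z_bounds d' by (simp add: mult_left_le_one_le)
    then show "0 \<le> d - \<epsilon>" using \<epsilon>_le[of d 1] d by simp
  qed (use N_\<gamma>(1)[OF ladder_le(1), of 0 0] mt in auto)
  also have "\<dots> \<le> N g 0 (ladder 0)" by (rule regularity_low)
  finally have low: "(1 - z\<^sup>2)\<^sup>2 * d * m \<le> N g 0 (ladder 0)" by (simp add: power2_eq_square ac_simps)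
  have err: "9 * 2 ^ k * z \<le> d * (r / 4)"
  proof -
    have "d\<^sub>0 ^ 2 ^ k \<le> d\<^sub>0 ^ 1" using d0 by (intro power_decreasing) auto
    then have "r * d\<^sub>0 ^ 2 ^ k \<le> r * d" using d small by (intro mult_left_mono) auto
    moreover have "36 * 2 ^ k * z \<le> 2 ^ 10 * 2 ^ k * z" using small by (intro mult_right_mono) auto
    moreover have "r * d / 4 = d * (r / 4)" by simp
    ultimately show ?thesis using small(4) by linarith
  qed
  have y: "1 - r / 4 \<le> (1 - z\<^sup>2)\<^sup>2"
  proof -
    have "8 * z \<le> 2 ^ 10 * 2 ^ k * z"
      using small by (intro mult_right_mono le_times_power) auto
    moreover have "1 - 2 * z\<^sup>2 \<le> (1 - z\<^sup>2)\<^sup>2" by (simp add: power2_diff)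
    ultimately show ?thesis using z_bounds by linarith
  qed
  have "P 1 (ladder 0) * (d * d') * (1 - r / 2) =
      (P 1 (ladder 0) * d') * (d * (1 - r / 4) - d * (r / 4))"
    by (simp add: algebra_simps)
  also have "\<dots> = m * t * (d * (1 - r / 4) - d * (r / 4))"
    by (simp only: mt(4))
  also have "\<dots> \<le> m * t * (d * (1 - z\<^sup>2)\<^sup>2 - 9 * 2 ^ k * z)"
    using mt y err d' by (intro mult_left_mono diff_mono) auto
  also have "\<dots> = t * ((1 - z\<^sup>2)\<^sup>2 * d * m) - m * t * (9 * 2 ^ k * z)" by (simp add: algebra_simps)
  also have "\<dots> \<le> t * N g 0 (ladder 0) - m * t * (9 * 2 ^ k * z)"
    using low mt by (intro diff_mono mult_left_mono) auto
  also have "\<dots> \<le> N g 1 (ladder 0)" using mt(5) by linarith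
  finally show ?thesis .
qed

lemma g_high_moment:
  "N g 1 (ladder k) \<le> P 1 (ladder k) * (d * d') ^ 2 ^ k * (1 + r)"
proof -
  have d': "0 < d" "0 < d'" using d d0 by linarith+
  have "(1 + z\<^sup>2)\<^sup>2 * d' ^ (2 * 2 ^ k) * P 2 (ladder k)
      \<le> (1 + 4 * 2 ^ k * z\<^sup>2) * (d' ^ 2 ^ k)\<^sup>2 * P 2 (ladder k)"
  proof -
    have "3 * z\<^sup>2 \<le> 4 * 2 ^ k * z\<^sup>2"
      by (intro mult_right_mono le_times_power) auto
    moreover have "z\<^sup>2 * z\<^sup>2 \<le> z\<^sup>2 * 1" using z_bounds by (intro mult_left_mono) auto
    ultimately have "(1 + z\<^sup>2)\<^sup>2 \<le> 1 + 4 * 2 ^ k * z\<^sup>2" by (simp add: power2_eq_square algebra_simps)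
    then show ?thesis
      unfolding power_mult[symmetric] mult.commute[of _ 2]
      using d' P_pos[of 2 "ladder k"] by (intro mult_right_mono) auto
  qed
  then have second: "N top_graph 2 (ladder k) \<le> (1 + 4 * 2 ^ k * z\<^sup>2) * (d' ^ 2 ^ k)\<^sup>2 * P 2 (ladder k)"
    using top_high_moment by linarith
  obtain m t where mt: "0 < m" "0 < t" "P 0 (ladder k) = m" "P 1 (ladder k) * d' ^ 2 ^ k = m * t"
    "\<bar>N g 1 (ladder k) - t * N g 0 (ladder k)\<bar> \<le> m * t * (9 * 2 ^ k * z)"
    using count_completion[OF ladder_le(1) _ top_high_first_moment second] d' by (metis zero_less_power)
  have "N g 0 (ladder k) \<le> (d ^ 2 ^ k + \<epsilon>) * N \<gamma> 0 (ladder k)" by (rule regularity_low)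
  also have "\<dots> \<le> ((1 + z\<^sup>2) * d ^ 2 ^ k) * ((1 + z\<^sup>2) * m)"
  proof (rule mult_mono)
    show "d ^ 2 ^ k + \<epsilon> \<le> (1 + z\<^sup>2) * d ^ 2 ^ k"
      using \<epsilon>_le[of d "2 ^ k"] d by (simp add: algebra_simps)
    have "(1 + \<eta>) * m \<le> (1 + z\<^sup>2) * m" using z_bounds mt by (intro mult_right_mono) auto
    then show "N \<gamma> 0 (ladder k) \<le> (1 + z\<^sup>2) * m"
      using N_\<gamma>(2)[OF ladder_le(1)[of k], of 0] mt(3) by simp
    show "0 \<le> N \<gamma> 0 (ladder k)" by (rule N_nonneg) (rule \<gamma>_nonneg)
  qed (use d' in auto)
  finally have high: "N g 0 (ladder k) \<le> (1 + z\<^sup>2)\<^sup>2 * d ^ 2 ^ k * m"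
    by (simp add: power2_eq_square ac_simps)
  have err: "9 * 2 ^ k * z \<le> d ^ 2 ^ k * (r / 4)"
  proof -
    have "d\<^sub>0 ^ 2 ^ k \<le> d ^ 2 ^ k" using d0 d by (intro power_mono) auto
    then have "r * d\<^sub>0 ^ 2 ^ k \<le> r * d ^ 2 ^ k" using small by (intro mult_left_mono) auto
    moreover have "36 * 2 ^ k * z \<le> 2 ^ 10 * 2 ^ k * z" using small by (intro mult_right_mono) auto
    moreover have "r * d ^ 2 ^ k / 4 = d ^ 2 ^ k * (r / 4)" by simp
    ultimately show ?thesis using small(4) by linarith
  qed
  have y: "(1 + z\<^sup>2)\<^sup>2 \<le> 1 + r / 4"
  proof -
    have "12 * z \<le> 2 ^ 10 * 2 ^ k * z"
      using small by (intro mult_right_mono le_times_power) auto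
    moreover have "z\<^sup>2 * z\<^sup>2 \<le> z\<^sup>2 * 1" using z_bounds by (intro mult_left_mono) auto
    then have "(1 + z\<^sup>2)\<^sup>2 \<le> 1 + 3 * z\<^sup>2" by (simp add: power2_eq_square algebra_simps)
    ultimately show ?thesis using z_bounds by linarith
  qed
  have "N g 1 (ladder k) \<le> t * N g 0 (ladder k) + m * t * (9 * 2 ^ k * z)" using mt(5) by linarith
  also have "\<dots> \<le> t * ((1 + z\<^sup>2)\<^sup>2 * d ^ 2 ^ k * m) + m * t * (9 * 2 ^ k * z)"
    using high mt by (intro add_mono mult_left_mono) auto
  also have "\<dots> = m * t * (d ^ 2 ^ k * (1 + z\<^sup>2)\<^sup>2 + 9 * 2 ^ k * z)" by (simp add: algebra_simps)
  also have "\<dots> \<le> m * t * (d ^ 2 ^ k * (1 + r / 4) + d ^ 2 ^ k * (r / 4))"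
    using mt y err d' by (intro mult_left_mono add_mono) auto
  also have "\<dots> \<le> m * t * (d ^ 2 ^ k * (1 + r))"
    using mt d' small by (intro mult_left_mono) (auto simp: algebra_simps)
  also have "\<dots> = P 1 (ladder k) * (d * d') ^ 2 ^ k * (1 + r)"
    unfolding mt(4)[symmetric] by (simp add: power_mult_distrib ac_simps)
  finally show ?thesis .
qed

section \<open>Concentration of the link densities\<close>

definition link_density :: "('a set \<Rightarrow> real) \<Rightarrow> 'a \<Rightarrow> (nat \<Rightarrow> nat) \<Rightarrow> real" where
  "link_density h v a = count V (link h v) (octv {1..k} a)"

definition w :: "'a \<Rightarrow> real" where
  "w v = \<gamma> {v} / real (card (V 0))"

text \<open>
  The value that \<open>link_density \<gamma> v a\<close> should have: the expected density of the octahedron is shared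
  among the vertices \<open>v\<close> in proportion to \<open>\<gamma> {v}\<close>.
\<close>

definition unit_weight :: "'a \<Rightarrow> (nat \<Rightarrow> nat) \<Rightarrow> real" where
  "unit_weight v a = \<gamma> {} * \<gamma> {v} * (P 1 a / (\<gamma> {} * p {0}))"

lemma V0: "finite (V 0)" "0 < real (card (V 0))"
  using parts(1,2)[of 0] by (auto simp: card_gt_0_iff)

lemma p0: "0 < p {0}" "0 < p {}"
  using p_pos by auto

lemma avg_link_density: "avg (V 0) (\<lambda>v. link_density h v a) = N h 1 a"
  unfolding link_density_def N_def using avg_link[of V h k a] V0(1) by blast

lemma vertex_nonneg: "v \<in> V 0 \<Longrightarrow> 0 \<le> \<gamma> {v}"
  by (rule \<gamma>_nonneg) force

lemma w_nonneg: "v \<in> V 0 \<Longrightarrow> 0 \<le> w v"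
  unfolding w_def using vertex_nonneg by simp

lemma link_bounds:
  assumes "v \<in> V 0" "e \<subseteq> (\<Union>j\<in>{0..k}. V j)"
  shows "0 \<le> link g v e \<and> link g v e \<le> link \<gamma> v e"
proof -
  have "insert v e \<subseteq> (\<Union>j\<in>{0..k}. V j)" using assms by force
  then show ?thesis
    unfolding link_def using g[of e] g[of "insert v e"] assms(2) by (simp add: mult_mono)
qed

lemma link_bounds':
  assumes "v \<in> V 0" "e \<subseteq> (\<Union>j\<in>{1..k}. V j)"
  shows "0 \<le> link g v e \<and> link g v e \<le> link \<gamma> v e"
proof (rule link_bounds[OF assms(1)])
  have "(\<Union>j\<in>{1..k}. V j) \<subseteq> (\<Union>j\<in>{0..k}. V j)" by (rule UN_mono) auto
  then show "e \<subseteq> (\<Union>j\<in>{0..k}. V j)" using assms(2) by (rule subset_trans[rotated])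
qed

lemma link_density_bounds:
  assumes "v \<in> V 0"
  shows "0 \<le> link_density g v a" "link_density g v a \<le> link_density \<gamma> v a"
  unfolding link_density_def
proof -
  show "0 \<le> count V (link g v) (octv {1..k} a)"
    using link_bounds'[OF assms] by (intro count_nonneg[OF _ fst_octv]) blast
  show "count V (link g v) (octv {1..k} a) \<le> count V (link \<gamma> v) (octv {1..k} a)"
    using link_bounds'[OF assms] by (intro count_mono[OF _ fst_octv]) blast
qed

lemma second_moment_source:
  obtains S where "\<And>v. v \<in> V 0 \<Longrightarrow> 0 \<le> S v"
    "hom_density {0..k} V \<gamma> (plus2_octahedron k a) = avg (V 0) S"
    "\<And>v. v \<in> V 0 \<Longrightarrow> \<gamma> {} * \<gamma> {v} * S v = (link_density \<gamma> v a)\<^sup>2"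
  unfolding link_density_def by (rule plus2_second_moment[of k V \<gamma> a]) (use parts(1) \<gamma>_nonneg in auto)

text \<open>
  The edge \<open>{v}\<close> of the octahedron becomes \<open>{}\<close> in the link, so that \<open>\<gamma> {v}\<close> divides all densities.
\<close>

lemma link_density_zero:
  assumes v: "v \<in> V 0" "\<gamma> {v} = 0"
  shows "link_density \<gamma> v a = 0" "link_density g v a = 0"
proof -
  obtain S where "\<gamma> {} * \<gamma> {v} * S v = (link_density \<gamma> v a)\<^sup>2"
    using second_moment_source[of a] v by metis
  then show "link_density \<gamma> v a = 0" using v by simp
  then show "link_density g v a = 0" using link_density_bounds[OF v(1), of a] by linarith
qed

text \<open>
  The octahedron with one vertex in part 0 and no other vertices has the two edges \<open>{}\<close> and a vertex.
\<close>

lemma total_weight: "(1 - \<eta>) * p {0} \<le> sum w (V 0)" "sum w (V 0) \<le> (1 + \<eta>) * p {0}"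
proof -
  let ?O = "\<lambda>_ :: nat. 0 :: nat"
  have emp: "octv {1..k} ?O = {}" by (simp add: octv_def)
  have "N \<gamma> 1 ?O = avg (V 0) (\<lambda>v. \<gamma> {} * \<gamma> {v})"
    unfolding avg_link_density[symmetric] link_density_def emp count_empty link_def by simp
  then have N: "N \<gamma> 1 ?O = \<gamma> {} * sum w (V 0)"
    by (simp add: avg_cmult w_def avg_def sum_divide_distrib)
  have "count (\<lambda>j. {j}) p (octv {0..k} (?O(0 := 1))) = p {} * p {0}"
    using avg_link[of "\<lambda>j. {j}" p k ?O] unfolding emp count_empty
    by (simp add: avg_singleton link_def)
  then have P: "P 1 ?O = \<gamma> {} * p {0}" using p0 by (simp add: P_def)
  have "\<gamma> {} * ((1 - \<eta>) * p {0}) \<le> \<gamma> {} * sum w (V 0)"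
    "\<gamma> {} * sum w (V 0) \<le> \<gamma> {} * ((1 + \<eta>) * p {0})"
    using N_\<gamma>[of ?O 1] unfolding N P by (simp_all add: ac_simps)
  then show "(1 - \<eta>) * p {0} \<le> sum w (V 0)" "sum w (V 0) \<le> (1 + \<eta>) * p {0}"
    using \<gamma>_empty by simp_all
qed

lemma unit_pos: "0 < \<gamma> {v} \<Longrightarrow> 0 < unit_weight v a"
  unfolding unit_weight_def using P_pos[of 1 a] \<gamma>_empty p0 by simp

lemma sum_normalised:
  assumes "\<And>v. v \<in> V 0 \<Longrightarrow> \<gamma> {v} = 0 \<Longrightarrow> link_density h v a = 0"
  shows "(\<Sum>v\<in>V 0. w v * (link_density h v a / unit_weight v a)) = N h 1 a * p {0} / P 1 a"
proof -
  have "(\<Sum>v\<in>V 0. w v * (link_density h v a / unit_weight v a)) = (\<Sum>v\<in>V 0. link_density h v a / card (V 0) * (p {0} / P 1 a))"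
  proof (rule sum.cong[OF refl])
    fix v assume v: "v \<in> V 0"
    show "w v * (link_density h v a / unit_weight v a) = link_density h v a / card (V 0) * (p {0} / P 1 a)"
      using assms[OF v] \<gamma>_empty by (cases "\<gamma> {v} = 0") (simp_all add: w_def unit_weight_def)
  qed
  also have "\<dots> = N h 1 a * p {0} / P 1 a"
    unfolding sum_distrib_right[symmetric] sum_divide_distrib[symmetric] avg_def[symmetric] avg_link_density
    by simp
  finally show ?thesis .
qed

text \<open>
  By \<open>plus2_second_moment\<close> and \<open>plus2_density\<close>, the counting hypothesis for two octahedra sharing a vertex
  says that the second moment of the link density is almost the square of its mean.
\<close>

lemma link_variance:
  assumes a: "\<forall>j\<in>{1..k}. a j \<le> 2"
  shows "(\<Sum>v\<in>V 0. w v * (link_density \<gamma> v a / unit_weight v a - 1)\<^sup>2) \<le> 4 * \<eta> * p {0}"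
proof (rule weighted_variance[OF total_weight(2)])
  have "(1 - \<eta>) * p {0} = (1 - \<eta>) * P 1 a * p {0} / P 1 a"
    using P_pos[of 1 a] by simp
  also have "\<dots> \<le> N \<gamma> 1 a * p {0} / P 1 a"
    using N_\<gamma>(1)[OF a, of 1] P_pos[of 1 a] p0 by (intro divide_right_mono mult_right_mono) auto
  finally show "(1 - \<eta>) * p {0} \<le> (\<Sum>v\<in>V 0. w v * (link_density \<gamma> v a / unit_weight v a))"
    using sum_normalised[of \<gamma> a] link_density_zero(1) by simp
next
  obtain S where S: "\<And>v. v \<in> V 0 \<Longrightarrow> 0 \<le> S v"
    "hom_density {0..k} V \<gamma> (plus2_octahedron k a) = avg (V 0) S"
    "\<And>v. v \<in> V 0 \<Longrightarrow> \<gamma> {} * \<gamma> {v} * S v = (link_density \<gamma> v a)\<^sup>2"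
    using second_moment_source[of a] by metis
  let ?c = "\<gamma> {} * (p {0} / P 1 a)\<^sup>2"
  have "(\<Sum>v\<in>V 0. w v * (link_density \<gamma> v a / unit_weight v a)\<^sup>2) \<le> (\<Sum>v\<in>V 0. S v / card (V 0) * ?c)"
  proof (rule sum_mono)
    fix v assume v: "v \<in> V 0"
    show "w v * (link_density \<gamma> v a / unit_weight v a)\<^sup>2 \<le> S v / card (V 0) * ?c"
    proof (cases "\<gamma> {v} = 0")
      case True
      then show ?thesis using S(1)[OF v] \<gamma>_empty V0 by (simp add: w_def)
    next
      case False
      have "w v * (link_density \<gamma> v a / unit_weight v a)\<^sup>2 = w v * (\<gamma> {} * \<gamma> {v} * S v) / (unit_weight v a)\<^sup>2"
        using S(3)[OF v] by (simp add: power_divide)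
      also have "\<dots> = S v / card (V 0) * ?c"
        using False \<gamma>_empty p0 P_pos[of 1 a] V0
        by (simp add: w_def unit_weight_def power2_eq_square field_simps)
      finally show ?thesis by simp
    qed
  qed
  also have "\<dots> = hom_density {0..k} V \<gamma> (plus2_octahedron k a) * ?c"
    unfolding S(2) avg_def sum_distrib_right sum_divide_distrib by simp
  also have "\<dots> \<le> (1 + \<eta>) * (\<gamma> {} / p {} * density_graph_density {0..k} p (plus2_octahedron k a)) * ?c"
    using counts_plus[OF a] \<gamma>_empty by (intro mult_right_mono) auto
  also have "\<dots> = (1 + \<eta>) * p {0}"
  proof -
    let ?h = "density_graph_density {0..k} p (plus2_octahedron k a)"
    have "(P 1 a)\<^sup>2 = (\<gamma> {} / p {})\<^sup>2 * (p {} * p {0} * ?h)"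
      using plus2_density[of k p a] p_pos by (simp add: P_def power_mult_distrib power_divide less_imp_le)
    then have h: "?h * (\<gamma> {})\<^sup>2 * p {0} = p {} * (P 1 a)\<^sup>2"
      using p0 by (simp add: power2_eq_square field_simps)
    have "\<gamma> {} / p {} * ?h * ?c = (?h * (\<gamma> {})\<^sup>2 * p {0}) * p {0} / (p {} * (P 1 a)\<^sup>2)"
      by (simp add: power2_eq_square)
    also have "\<dots> = p {0}" unfolding h using p0 P_pos[of 1 a] by simp
    finally have c: "\<gamma> {} / p {} * ?h * ?c = p {0}" .
    show ?thesis unfolding mult.assoc[of "1 + \<eta>"] c ..
  qed
  finally show "(\<Sum>v\<in>V 0. w v * (link_density \<gamma> v a / unit_weight v a)\<^sup>2) \<le> (1 + \<eta>) * p {0}" .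
qed

text \<open>
  The octahedra whose densities in the link of \<open>\<gamma>\<close> enter the argument: the two that decide regularity,
  and those with one part removed that occur in the Cauchy-Schwarz chain.
\<close>

definition profiles :: "(nat \<Rightarrow> nat) set" where
  "profiles = {ladder 0, ladder k} \<union> (\<lambda>i. (ladder i)(Suc i := 0)) ` {..<k}"

lemma profiles: "finite profiles" "card profiles \<le> k + 2"
  "a \<in> profiles \<Longrightarrow> \<forall>j\<in>{1..k}. a j \<le> 2"
proof -
  show "finite profiles" by (simp add: profiles_def)
  have "card profiles \<le> card {ladder 0, ladder k} + card ((\<lambda>i. (ladder i)(Suc i := 0)) ` {..<k})"
    unfolding profiles_def by (rule card_Un_le)
  also have "\<dots> \<le> 2 + k"
    using card_image_le[of "{..<k}" "\<lambda>i. (ladder i)(Suc i := 0)"] card_insert_le_m1[of 2 "{ladder k}"]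
    by (intro add_mono) auto
  finally show "card profiles \<le> k + 2" by simp
  show "\<forall>j\<in>{1..k}. a j \<le> 2" if "a \<in> profiles"
    using that ladder_le unfolding profiles_def by auto
qed

definition typical :: "'a set" where
  "typical = {v \<in> V 0. \<forall>a\<in>profiles. \<bar>link_density \<gamma> v a / unit_weight v a - 1\<bar> \<le> z}"

lemma k_bound: "real k + 2 \<le> 2 * 2 ^ k"
proof -
  have "k + 2 \<le> 2 * 2 ^ k" using k
  proof (induction k rule: nat_induct_at_least)
    case (Suc n)
    then show ?case by simp
  qed simp
  then have "real (k + 2) \<le> real (2 * 2 ^ k)" by (rule of_nat_mono)
  then show ?thesis by simp
qed

lemma atypical_mass: "sum w (V 0 - typical) \<le> 8 * 2 ^ k * z\<^sup>2 * p {0}"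
proof -
  have eq: "V 0 - typical = {v \<in> V 0. \<exists>a\<in>profiles. z < \<bar>link_density \<gamma> v a / unit_weight v a - 1\<bar>}"
    by (auto simp: typical_def not_le)
  have "sum w (V 0 - typical) \<le> card profiles * (4 * \<eta> * p {0}) / z\<^sup>2"
    unfolding eq using V0 profiles w_nonneg small link_variance
    by (intro Chebyshev_family) auto
  also have "\<dots> \<le> (2 * 2 ^ k) * (4 * z ^ 4 * p {0}) / z\<^sup>2"
  proof (intro divide_right_mono mult_mono)
    show "real (card profiles) \<le> 2 * 2 ^ k"
      using k_bound profiles(2) by linarith
  qed (use small p0 in auto)
  also have "\<dots> = 8 * 2 ^ k * z\<^sup>2 * p {0}"
    using small by (simp add: power2_eq_square power4_eq_xxxx)
  finally show ?thesis .
qed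

lemma typical_vertex:
  assumes v: "v \<in> typical"
  shows "v \<in> V 0" "0 < \<gamma> {v}" "a \<in> profiles \<Longrightarrow> (1 - z) * unit_weight v a \<le> link_density \<gamma> v a"
    "a \<in> profiles \<Longrightarrow> link_density \<gamma> v a \<le> (1 + z) * unit_weight v a"
proof -
  show v0: "v \<in> V 0" using v by (simp add: typical_def)
  have z: "z < 1"
  proof -
    have "2 * z \<le> 2 ^ 10 * 2 ^ k * z" using small by (intro mult_right_mono le_times_power) auto
    then show ?thesis using z_bounds(1) small by linarith
  qed
  show pos: "0 < \<gamma> {v}"
  proof (rule ccontr)
    assume "\<not> 0 < \<gamma> {v}"
    then have "\<gamma> {v} = 0" using vertex_nonneg[OF v0] by simp
    moreover have "ladder 0 \<in> profiles" by (simp add: profiles_def)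
    moreover have "unit_weight v (ladder 0) = 0" unfolding unit_weight_def \<open>\<gamma> {v} = 0\<close> by simp
    ultimately have "\<bar>link_density \<gamma> v (ladder 0) / unit_weight v (ladder 0) - 1\<bar> \<le> z" "unit_weight v (ladder 0) = 0"
      using v unfolding typical_def by blast+
    then show False using z by simp
  qed
  assume a: "a \<in> profiles"
  have "\<bar>link_density \<gamma> v a / unit_weight v a - 1\<bar> \<le> z" using v a by (auto simp: typical_def)
  then have "1 - z \<le> link_density \<gamma> v a / unit_weight v a" "link_density \<gamma> v a / unit_weight v a \<le> 1 + z" by linarith+
  then show "(1 - z) * unit_weight v a \<le> link_density \<gamma> v a" "link_density \<gamma> v a \<le> (1 + z) * unit_weight v a"
    using unit_pos[OF pos, of a] by (simp_all add: pos_le_divide_eq pos_divide_le_eq)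
qed

text \<open>
  Bernoulli's inequality bounds \<open>(1 - z) ^ 2 ^ k\<close> from below, and \<open>(1 + z) * (1 - z) \<le> 1\<close>.
\<close>

lemma z_power: "(1 + z) ^ 2 ^ k \<le> 1 + r"
proof -
  let ?K = "2 ^ k :: nat"
  have Kz: "real ?K * z \<le> r / 4" using z_bounds(1) small by simp
  have "1 * z \<le> real ?K * z" using small by (intro mult_right_mono) auto
  then have z: "z \<le> 1" using Kz small by linarith
  have B: "1 - real ?K * z \<le> (1 - z) ^ ?K"
    using Bernoulli_inequality[of "- z" ?K] z by simp
  have "(1 + z) ^ ?K * (1 - real ?K * z) \<le> (1 + z) ^ ?K * (1 - z) ^ ?K"
    using B small by (intro mult_left_mono) auto
  also have "\<dots> = (1 - z\<^sup>2) ^ ?K"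
    by (simp add: power_mult_distrib[symmetric] power2_eq_square algebra_simps)
  also have "\<dots> \<le> 1" using z_bounds by (intro power_le_one) auto
  also have "1 \<le> (1 + r) * (1 - real ?K * z)"
  proof -
    have "r * (real ?K * z) \<le> 1 * (r / 4)" using Kz small by (intro mult_mono) auto
    then have "real ?K * z + r * (real ?K * z) \<le> r" using Kz small by linarith
    then show ?thesis by (simp add: algebra_simps)
  qed
  finally show ?thesis using Kz small by (auto dest: mult_right_le_imp_le)
qed

text \<open>
  The two densities that decide the regularity of the link of \<open>v\<close>, scaled so that 1 is the value
  they are expected to have.
\<close>

definition X :: "'a \<Rightarrow> real" where
  "X v = link_density g v (ladder 0) / unit_weight v (ladder 0) / (d * d')"

definition Y :: "'a \<Rightarrow> real" where
  "Y v = link_density g v (ladder k) / unit_weight v (ladder k) / (d * d') ^ 2 ^ k"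

lemma dd': "0 < d * d'" "d\<^sub>0\<^sup>2 \<le> d * d'"
  using d d0 by (auto simp: power2_eq_square intro: mult_mono)

text \<open>
  The Cauchy-Schwarz chain inside the link of \<open>v\<close>. The octahedra with a removed part are counted in the
  link of \<open>\<gamma>\<close>, where a typical vertex has the expected densities up to the factor \<open>1 + z\<close>.
\<close>

lemma X_power_le_Y:
  assumes v: "v \<in> typical"
  shows "X v ^ 2 ^ k \<le> (1 + r) * Y v"
proof -
  have v0: "v \<in> V 0" and pos: "0 < \<gamma> {v}" using typical_vertex[OF v] by auto
  have "(link_density g v (ladder 0) / unit_weight v (ladder 0)) ^ 2 ^ k
      \<le> (1 + z) ^ 2 ^ k * (link_density g v (ladder k) / unit_weight v (ladder k))"
  proof (rule ladder_chain[where F = "\<lambda>i. link_density g v (ladder i)" and Q = "\<lambda>i. unit_weight v (ladder i)"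
        and ?F0.0 = "\<lambda>i. link_density g v ((ladder i)(Suc i := 0))"
        and ?Q0.0 = "\<lambda>i. unit_weight v ((ladder i)(Suc i := 0))"])
    fix i assume i: "i < k"
    have fin: "finite (V (Suc i))" using parts(1)[of "Suc i"] i by simp
    show "(link_density g v (ladder i))\<^sup>2 \<le> link_density g v ((ladder i)(Suc i := 0)) * link_density g v (ladder (Suc i))"
      using octahedron_Cauchy_Schwarz[of "{1..k}" "Suc i" V "link g v" "ladder i"]
        i fin link_bounds'[OF v0] unfolding ladder_step link_density_def by simp
    show "(unit_weight v (ladder i))\<^sup>2 = unit_weight v ((ladder i)(Suc i := 0)) * unit_weight v (ladder (Suc i))"
      using P_square[of "Suc i" 1 "ladder i"] i unfolding ladder_step unit_weight_def
      by (simp add: power_mult_distrib power_divide power2_eq_square)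
    have "(ladder i)(Suc i := 0) \<in> profiles" using i by (auto simp: profiles_def)
    then show "link_density g v ((ladder i)(Suc i := 0)) \<le> (1 + z) * unit_weight v ((ladder i)(Suc i := 0))"
      using typical_vertex(4)[OF v] link_density_bounds(2)[OF v0] by (meson order_trans)
  qed (use unit_pos[OF pos] link_density_bounds(1)[OF v0] small in auto)
  also have "\<dots> \<le> (1 + r) * (link_density g v (ladder k) / unit_weight v (ladder k))"
    using z_power unit_pos[OF pos, of "ladder k"] link_density_bounds(1)[OF v0] by (intro mult_right_mono) auto
  finally have "(link_density g v (ladder 0) / unit_weight v (ladder 0)) ^ 2 ^ k / (d * d') ^ 2 ^ k
      \<le> (1 + r) * (link_density g v (ladder k) / unit_weight v (ladder k)) / (d * d') ^ 2 ^ k"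
    using dd' by (intro divide_right_mono) auto
  then show ?thesis by (simp add: X_def Y_def power_divide power_mult_distrib)
qed

lemma XY_nonneg:
  assumes "v \<in> V 0"
  shows "0 \<le> X v" "0 \<le> Y v"
proof -
  have "0 \<le> unit_weight v a" for a
    using unit_pos[of v a] vertex_nonneg[OF assms] by (cases "\<gamma> {v} = 0") (auto simp: unit_weight_def)
  then show "0 \<le> X v" "0 \<le> Y v"
    unfolding X_def Y_def using link_density_bounds(1)[OF assms] dd' by auto
qed

lemma Y_moment: "(\<Sum>v\<in>typical. w v * Y v) \<le> (1 + r) * p {0}"
proof -
  let ?D = "(d * d') ^ 2 ^ k"
  have D: "0 < ?D" using dd' by simp
  have "(\<Sum>v\<in>typical. w v * Y v) \<le> (\<Sum>v\<in>V 0. w v * Y v)"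
    using V0 XY_nonneg w_nonneg by (intro sum_mono2) (auto simp: typical_def)
  also have "\<dots> = (\<Sum>v\<in>V 0. w v * (link_density g v (ladder k) / unit_weight v (ladder k))) / ?D"
    by (simp add: Y_def sum_divide_distrib)
  also have "\<dots> = N g 1 (ladder k) * p {0} / P 1 (ladder k) / ?D"
    using sum_normalised[of g "ladder k"] link_density_zero(2) by simp
  also have "\<dots> \<le> P 1 (ladder k) * ?D * (1 + r) * p {0} / P 1 (ladder k) / ?D"
    using g_high_moment p0 P_pos[of 1 "ladder k"] D
    by (intro divide_right_mono mult_right_mono) auto
  also have "\<dots> = (1 + r) * p {0}" using D P_pos[of 1 "ladder k"] d d0 by simp
  finally show ?thesis .
qed

text \<open>
  The lower bound holds for the sum over all of \<open>V 0\<close>; what atypical vertices contribute is controlled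
  by the variance of the link density of \<open>\<gamma>\<close>, which bounds that of \<open>g\<close>.
\<close>

lemma X_moment: "(1 - r) * p {0} \<le> (\<Sum>v\<in>typical. w v * X v)"
proof -
  let ?D = "d * d'" and ?u = "\<lambda>v. link_density \<gamma> v (ladder 0) / unit_weight v (ladder 0)"
  have D: "0 < ?D" using dd' by simp
  have sub: "typical \<subseteq> V 0" by (auto simp: typical_def)
  have "(1 - r / 2) * p {0} = P 1 (ladder 0) * ?D * (1 - r / 2) * p {0} / P 1 (ladder 0) / ?D"
    using D P_pos[of 1 "ladder 0"] d d0 by simp
  also have "\<dots> \<le> N g 1 (ladder 0) * p {0} / P 1 (ladder 0) / ?D"
    using g_first_moment p0 P_pos[of 1 "ladder 0"] D
    by (intro divide_right_mono mult_right_mono) auto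
  also have "\<dots> = (\<Sum>v\<in>V 0. w v * (link_density g v (ladder 0) / unit_weight v (ladder 0))) / ?D"
    using sum_normalised[of g "ladder 0"] link_density_zero(2) by simp
  also have "\<dots> = (\<Sum>v\<in>V 0. w v * X v)"
    by (simp add: X_def sum_divide_distrib)
  finally have all: "(1 - r / 2) * p {0} \<le> (\<Sum>v\<in>V 0. w v * X v)" .
  have "(\<Sum>v\<in>V 0 - typical. w v * X v) \<le> (\<Sum>v\<in>V 0 - typical. (2 * w v + w v * (?u v - 1)\<^sup>2) / ?D)"
  proof (rule sum_mono)
    fix v assume v: "v \<in> V 0 - typical"
    have u0: "0 \<le> unit_weight v (ladder 0)"
      using unit_pos[of v "ladder 0"] vertex_nonneg[of v] v
      by (cases "\<gamma> {v} = 0") (auto simp: unit_weight_def)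
    \<comment> \<open>This splits the contribution of atypical vertices into their weight and the variance.\<close>
    have "x \<le> 2 + (x - 1)\<^sup>2" for x :: real
    proof -
      have "0 \<le> (x - 3 / 2)\<^sup>2" by simp
      then show ?thesis by (simp add: power2_eq_square algebra_simps)
    qed
    moreover have "link_density g v (ladder 0) / unit_weight v (ladder 0) \<le> ?u v"
      using link_density_bounds(2)[of v "ladder 0"] v u0 by (intro divide_right_mono) auto
    ultimately have "link_density g v (ladder 0) / unit_weight v (ladder 0) \<le> 2 + (?u v - 1)\<^sup>2"
      by (meson order_trans)
    then have "w v * (link_density g v (ladder 0) / unit_weight v (ladder 0)) \<le> w v * (2 + (?u v - 1)\<^sup>2)"
      using w_nonneg v by (intro mult_left_mono) auto
    then have "w v * (link_density g v (ladder 0) / unit_weight v (ladder 0)) / ?D \<le> w v * (2 + (?u v - 1)\<^sup>2) / ?D"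
      using D by (intro divide_right_mono) auto
    then show "w v * X v \<le> (2 * w v + w v * (?u v - 1)\<^sup>2) / ?D"
      by (simp add: X_def algebra_simps)
  qed
  also have "\<dots> = (2 * sum w (V 0 - typical) + (\<Sum>v\<in>V 0 - typical. w v * (?u v - 1)\<^sup>2)) / ?D"
    by (simp add: sum_divide_distrib[symmetric] sum.distrib sum_distrib_left)
  also have "\<dots> \<le> (2 * (8 * 2 ^ k * z\<^sup>2 * p {0}) + 4 * z\<^sup>2 * p {0}) / ?D"
  proof (intro divide_right_mono add_mono mult_left_mono atypical_mass)
    have "(\<Sum>v\<in>V 0 - typical. w v * (?u v - 1)\<^sup>2) \<le> (\<Sum>v\<in>V 0. w v * (?u v - 1)\<^sup>2)"
      using V0 w_nonneg by (intro sum_mono2) auto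
    also have "\<dots> \<le> 4 * \<eta> * p {0}" by (rule link_variance[OF ladder_le(1)])
    also have "\<dots> \<le> 4 * z\<^sup>2 * p {0}" using z_bounds(6) p0 by (intro mult_right_mono) auto
    finally show "(\<Sum>v\<in>V 0 - typical. w v * (?u v - 1)\<^sup>2) \<le> 4 * z\<^sup>2 * p {0}" .
  qed (use D in auto)
  also have "\<dots> \<le> r / 2 * p {0}"
  proof -
    have K2: "(2 :: nat) \<le> 2 ^ k" using power_increasing[of 1 k "2 :: nat"] k by simp
    have "4 * z\<^sup>2 \<le> 4 * 2 ^ k * z\<^sup>2" by (intro mult_right_mono le_times_power) auto
    moreover have "20 * (2 ^ k * z) * z = 2 * (8 * 2 ^ k * z\<^sup>2) + 4 * 2 ^ k * z\<^sup>2"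
      by (simp add: power2_eq_square)
    ultimately have "2 * (8 * 2 ^ k * z\<^sup>2) + 4 * z\<^sup>2 \<le> 20 * (2 ^ k * z) * z" by linarith
    also have "\<dots> \<le> 20 * (2 ^ k * z) * 1" using z_bounds small by (intro mult_left_mono) auto
    also have "\<dots> \<le> r / 2 * d\<^sub>0 ^ 2 ^ k"
    proof -
      have "40 * 2 ^ k * z \<le> 2 ^ 10 * 2 ^ k * z" using small by (intro mult_right_mono) auto
      then show ?thesis using small(4) by linarith
    qed
    also have "\<dots> \<le> r / 2 * d\<^sub>0\<^sup>2"
      using small d0 K2 by (intro mult_left_mono power_decreasing) auto
    also have "\<dots> \<le> r / 2 * ?D" using small dd' by (intro mult_left_mono) auto
    finally have "(2 * (8 * 2 ^ k * z\<^sup>2) + 4 * z\<^sup>2) * p {0} \<le> r / 2 * ?D * p {0}"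
      using p0 by (intro mult_right_mono) auto
    then show ?thesis using D by (simp add: pos_divide_le_eq algebra_simps)
  qed
  finally have "(\<Sum>v\<in>V 0 - typical. w v * X v) \<le> r / 2 * p {0}" .
  moreover have "(\<Sum>v\<in>V 0 - typical. w v * X v) = (\<Sum>v\<in>V 0. w v * X v) - (\<Sum>v\<in>typical. w v * X v)"
    using V0(1) sub by (rule sum_diff)
  ultimately show ?thesis using all by (simp add: algebra_simps)
qed

lemma typical_mass: "(1 - r) * p {0} \<le> sum w typical" "sum w typical \<le> (1 + r) * p {0}"
proof -
  have sub: "typical \<subseteq> V 0" by (auto simp: typical_def)
  have "8 * 2 ^ k * z\<^sup>2 \<le> 8 * 2 ^ k * z" using z_bounds by (intro mult_left_mono) auto
  moreover have "z\<^sup>2 \<le> 1 * 2 ^ k * z"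
  proof -
    have "1 * z \<le> 1 * 2 ^ k * z" using small by (intro mult_right_mono le_times_power) auto
    then show ?thesis using z_bounds(5) by linarith
  qed
  moreover have "0 \<le> 2 ^ k * z" "9 * 2 ^ k * z \<le> 2 ^ 10 * 2 ^ k * z"
    using small by (auto intro: mult_right_mono)
  moreover have "0 \<le> 2 ^ k * z\<^sup>2" by simp
  ultimately have e: "8 * 2 ^ k * z\<^sup>2 + \<eta> \<le> r" "\<eta> \<le> r"
    using z_bounds(1,6) by linarith+
  have "sum w (V 0 - typical) = sum w (V 0) - sum w typical"
    using V0(1) sub by (rule sum_diff)
  then have "(1 - \<eta> - 8 * 2 ^ k * z\<^sup>2) * p {0} \<le> sum w typical"
    using atypical_mass total_weight(1) by (simp add: algebra_simps)
  moreover have "(1 - r) * p {0} \<le> (1 - \<eta> - 8 * 2 ^ k * z\<^sup>2) * p {0}"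
    using e p0 by (intro mult_right_mono) auto
  ultimately show "(1 - r) * p {0} \<le> sum w typical" by linarith
  have "sum w typical \<le> sum w (V 0)" using V0 sub w_nonneg by (intro sum_mono2) auto
  also have "\<dots> \<le> (1 + \<eta>) * p {0}" by (rule total_weight)
  also have "\<dots> \<le> (1 + r) * p {0}" using e p0 by (intro mult_right_mono) auto
  finally show "sum w typical \<le> (1 + r) * p {0}" .
qed

lemma N_\<gamma>_pos: 
  assumes "\<forall>j\<in>{1..k}. a j \<le> 2" "c \<le> 2"
  shows "0 < N \<gamma> c a"
proof -
  have "2 * z \<le> 2 ^ 10 * 2 ^ k * z" using small by (intro mult_right_mono le_times_power) auto
  then have "\<eta> < 1" using z_bounds small by linarith
  then have "0 < (1 - \<eta>) * P c a" using P_pos[of c a] by simp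
  then show ?thesis using N_\<gamma>(1)[OF assms] by linarith
qed

text \<open>
  No subgraph can have a relative density above 1, so the parameters \<open>d\<close> and \<open>d'\<close> exceed 1 by at most
  the error in the regularity.
\<close>

lemma density_upper: "d \<le> 1 + z" "d' \<le> 1 + z"
proof -
  have \<epsilon>: "\<epsilon> \<le> z" using \<epsilon>_le[of 1 0] d0 z_bounds(5) by simp
  have "(d - \<epsilon>) * N \<gamma> 0 (ladder 0) \<le> N g 0 (ladder 0)" by (rule regularity_low)
  also have "\<dots> \<le> 1 * N \<gamma> 0 (ladder 0)" using N_mono[OF g] by simp
  finally have "d - \<epsilon> \<le> 1"
    using N_\<gamma>_pos[OF ladder_le(1)[of 0], of 0] mult_le_cancel_right_pos by blast
  then show "d \<le> 1 + z" using \<epsilon> by linarith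
  have "(d' - \<epsilon>) * N \<gamma> 1 (ladder 0) \<le> N top_graph 1 (ladder 0)" by (rule regularity_top)
  also have "\<dots> \<le> 1 * N \<gamma> 1 (ladder 0)" using N_mono[OF top_bounds] by simp
  finally have "d' - \<epsilon> \<le> 1"
    using N_\<gamma>_pos[OF ladder_le(1)[of 0], of 1] mult_le_cancel_right_pos by fastforce
  then show "d' \<le> 1 + z" using \<epsilon> by linarith
qed

text \<open>
  In \<open>moment_concentration\<close> the deviation of \<open>X\<close> is taken as \<open>\<sigma> = e\<^sup>2 / (64 * K)\<close> and that of \<open>Y\<close> as
  \<open>e / 8\<close>: then \<open>K * \<sigma>\<close>, the resulting uncertainty of the lower bound for \<open>Y\<close>, is small even after
  the division by \<open>e / 8\<close> in Markov's inequality. The additive error \<open>e\<close> is recovered at the end from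
  the relative one because \<open>d * d'\<close> and \<open>(d * d') ^ 2 ^ k\<close> are at most 2.
\<close>

lemma regular_links:
  assumes e: "0 < e" "e \<le> 1 / 2" and r: "2 ^ 22 * (2 ^ k)\<^sup>2 * r \<le> e ^ 6"
  shows "\<exists>U\<subseteq>V 0. (1 - e) * sum w (V 0) \<le> sum w U \<and> (\<forall>v\<in>U.
    (d * d' - e) * link_density \<gamma> v (ladder 0) \<le> link_density g v (ladder 0) \<and>
    link_density g v (ladder 0) \<le> (d * d' + e) * link_density \<gamma> v (ladder 0) \<and>
    link_density g v (ladder k) \<le> ((d * d') ^ 2 ^ k + e) * link_density \<gamma> v (ladder k))"
proof -
  define K where "K = (2 :: nat) ^ k"
  define \<sigma> where "\<sigma> = e\<^sup>2 / (64 * real K)"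
  define U where "U = {v \<in> typical. \<bar>X v - 1\<bar> \<le> \<sigma> \<and> Y v \<le> 1 + e / 8}"
  have K: "even K" "0 < K" "2 \<le> real K"
  proof -
    show "even K" "0 < K" using k by (simp_all add: K_def)
    show "2 \<le> real K" using power_increasing[of 1 k "2 :: real"] k by (simp add: K_def)
  qed
  have e2: "e\<^sup>2 \<le> 1 / 4" "e\<^sup>2 \<le> e / 2" 
    using e power_mono[of e "1 / 2" 2] mult_left_mono[of e "1 / 2" e] by (auto simp: power2_eq_square)
  have \<sigma>: "0 < \<sigma>" "real K * \<sigma> = e\<^sup>2 / 64" "\<sigma> \<le> e\<^sup>2 / 64"
  proof -
    show "0 < \<sigma>" "real K * \<sigma> = e\<^sup>2 / 64" using e K by (simp_all add: \<sigma>_def)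
    then show "\<sigma> \<le> e\<^sup>2 / 64" using K mult_right_mono[of 1 "real K" \<sigma>] by linarith
  qed
  have r': "2 ^ 22 * (real K)\<^sup>2 * r \<le> e ^ 4 * e\<^sup>2" using r by (simp add: K_def flip: power_add)
  have rr: "6 * r / \<sigma>\<^sup>2 \<le> e\<^sup>2 / 100"
  proof -
    have "6 * r / \<sigma>\<^sup>2 = 6 * 64\<^sup>2 * (real K)\<^sup>2 * r / e ^ 4"
      using e K by (simp add: \<sigma>_def power_divide power_mult_distrib field_simps)
    also have "\<dots> \<le> (2 ^ 22 * (real K)\<^sup>2 * r / 100) / e ^ 4"
      using e small by (intro divide_right_mono) auto
    also have "\<dots> \<le> (e ^ 4 * e\<^sup>2 / 100) / e ^ 4"
      using e r' by (intro divide_right_mono) auto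
    also have "\<dots> = e\<^sup>2 / 100"
    proof -
      have "e ^ 4 \<noteq> 0" using e by simp
      then have "e ^ 4 * (e\<^sup>2 / 100) / e ^ 4 = e\<^sup>2 / 100" by (rule nonzero_mult_div_cancel_left)
      then show ?thesis by (simp only: times_divide_eq_right)
    qed
    finally show ?thesis .
  qed
  have r100: "r \<le> e\<^sup>2 / 100"
  proof -
    have "\<sigma>\<^sup>2 \<le> 1" using \<sigma> e2 by (intro power_le_one) auto
    then have "6 * r / 1 \<le> 6 * r / \<sigma>\<^sup>2" using \<sigma> small by (intro divide_left_mono) auto
    then show ?thesis using rr small by linarith
  qed
  have z: "z \<le> r / 2 ^ 10"
  proof -
    have "2 ^ 10 * z \<le> 2 ^ 10 * 2 ^ k * z" using small by (intro mult_right_mono le_times_power) auto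
    then show ?thesis using z_bounds(1) by simp
  qed
  have "(1 - r - 6 * r / \<sigma>\<^sup>2 - (3 * r + real K * \<sigma> + 6 * r / \<sigma>\<^sup>2) / (e / 8)) * p {0} \<le> sum w U"
    unfolding U_def
  proof (rule moment_concentration[OF V0(1), where r = r])
    show "typical \<subseteq> V 0" by (auto simp: typical_def)
    show "real K * \<sigma> + r \<le> 1" "\<sigma> \<le> 1" using \<sigma> r100 e2 by auto
    show "X v ^ K \<le> (1 + r) * Y v" if "v \<in> typical" for v
      using X_power_le_Y[OF that] by (simp add: K_def)
    show "0 \<le> X v" "0 \<le> Y v" if "v \<in> typical" for v
      using XY_nonneg that by (auto simp: typical_def)
  qed (use w_nonneg p0 K small \<sigma> e typical_mass X_moment Y_moment in auto)
  moreover have "(1 - e) * sum w (V 0)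
      \<le> (1 - r - 6 * r / \<sigma>\<^sup>2 - (3 * r + real K * \<sigma> + 6 * r / \<sigma>\<^sup>2) / (e / 8)) * p {0}"
  proof -
    have "(3 * r + real K * \<sigma> + 6 * r / \<sigma>\<^sup>2) / (e / 8) \<le> (e\<^sup>2 * (1 / 16)) / (e / 8)"
    proof (rule divide_right_mono)
      have "0 \<le> e\<^sup>2" by simp
      then show "3 * r + real K * \<sigma> + 6 * r / \<sigma>\<^sup>2 \<le> e\<^sup>2 * (1 / 16)"
        using r100 rr \<sigma>(2) by linarith
    qed (use e in simp)
    also have "\<dots> = e / 2" using e by (simp add: power2_eq_square)
    finally have *: "(3 * r + real K * \<sigma> + 6 * r / \<sigma>\<^sup>2) / (e / 8) \<le> e / 2" .
    have "\<eta> \<le> r" using z_bounds(5,6) z small by auto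
    then have "sum w (V 0) \<le> (1 + r) * p {0}"
      using total_weight(2) p0 mult_right_mono[of "1 + \<eta>" "1 + r" "p {0}"] by linarith
    then have "(1 - e) * sum w (V 0) \<le> (1 - e) * ((1 + r) * p {0})"
      using e by (intro mult_left_mono) auto
    also have "\<dots> = (1 - e + r - e * r) * p {0}" by (simp add: algebra_simps)
    also have "\<dots> \<le> (1 - r - 6 * r / \<sigma>\<^sup>2
        - (3 * r + real K * \<sigma> + 6 * r / \<sigma>\<^sup>2) / (e / 8)) * p {0}"
    proof (rule mult_right_mono)
      have "0 \<le> e * r" using e small by simp
      then show "1 - e + r - e * r \<le> 1 - r - 6 * r / \<sigma>\<^sup>2
          - (3 * r + real K * \<sigma> + 6 * r / \<sigma>\<^sup>2) / (e / 8)"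
        using * rr r100 e2 e by linarith
    qed (use p0 in auto)
    finally show ?thesis .
  qed
  ultimately have mass: "(1 - e) * sum w (V 0) \<le> sum w U" by linarith
  have dd2: "d * d' \<le> 2" "(d * d') ^ K \<le> 2"
  proof -
    have 1: "d * d' \<le> (1 + z) * (1 + z)"
      using density_upper d d0 small by (intro mult_mono) auto
    have "(1 + z) * (1 + z) \<le> (5 / 4) * (5 / 4)"
      using z r100 e2 small by (intro mult_mono) auto
    then show "d * d' \<le> 2" using 1 by linarith
    have "(d * d') ^ K \<le> ((1 + z) * (1 + z)) ^ K" using 1 dd' by (intro power_mono) auto
    also have "\<dots> = (1 + z) ^ K * (1 + z) ^ K" by (simp add: power_mult_distrib)
    also have "\<dots> \<le> (1 + r) * (1 + r)"
      using z_power small by (intro mult_mono) (auto simp: K_def)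
    also have "\<dots> \<le> (5 / 4) * (5 / 4)" using r100 e2 small by (intro mult_mono) auto
    finally show "(d * d') ^ K \<le> 2" by simp
  qed
  have compare: "(t - e) * u \<le> t * x" "t * x \<le> (t + e) * u"
    if t: "0 \<le> t" "t \<le> 2" and u: "1 - z \<le> u" "u \<le> 1 + z" and x: "\<bar>x - 1\<bar> \<le> e / 8" for t u x
  proof -
    have zu: "z \<le> e / 16" "1 / 2 \<le> u" using z r100 e2 u small by auto
    have "\<bar>x - u\<bar> \<le> e / 8 + e / 16" using u x zu by linarith
    then have "t * \<bar>x - u\<bar> \<le> 2 * (e / 8 + e / 16)"
      using t by (intro mult_mono) auto
    also have "\<dots> \<le> e * (1 / 2)" by (use e in simp)
    also have "\<dots> \<le> e * u" using e zu by (intro mult_left_mono) auto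
    finally have "\<bar>t * x - t * u\<bar> \<le> e * u"
      using t by (simp add: abs_mult flip: right_diff_distrib)
    then show "(t - e) * u \<le> t * x" "t * x \<le> (t + e) * u" by (auto simp: algebra_simps)
  qed
  have "(d * d' - e) * link_density \<gamma> v (ladder 0) \<le> link_density g v (ladder 0) \<and>
    link_density g v (ladder 0) \<le> (d * d' + e) * link_density \<gamma> v (ladder 0) \<and>
    link_density g v (ladder k) \<le> ((d * d') ^ 2 ^ k + e) * link_density \<gamma> v (ladder k)" if v: "v \<in> U" for v
  proof -
    have ty: "v \<in> typical" and Xv: "\<bar>X v - 1\<bar> \<le> e / 8" and Yv: "Y v \<le> 1 + e / 8"
      using v \<sigma>(3) e2 e(1) by (auto simp: U_def)
    note tv = typical_vertex[OF ty]
    have un: "0 < unit_weight v a" for a by (rule unit_pos[OF tv(2)])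
    have prof: "ladder 0 \<in> profiles" "ladder k \<in> profiles" by (simp_all add: profiles_def)
    let ?u = "\<lambda>a. link_density \<gamma> v a / unit_weight v a"
    have u: "1 - z \<le> ?u a" "?u a \<le> 1 + z" if "a \<in> profiles" for a
      using tv(3,4)[OF that] un[of a] by (simp_all add: pos_le_divide_eq pos_divide_le_eq)
    have gX: "link_density g v (ladder 0) = d * d' * X v * unit_weight v (ladder 0)"
      using un[of "ladder 0"] d d0 by (simp add: X_def)
    have gY: "link_density g v (ladder k) = (d * d') ^ K * Y v * unit_weight v (ladder k)"
      using un[of "ladder k"] d d0 by (simp add: Y_def K_def)
    have \<gamma>u: "link_density \<gamma> v a = ?u a * unit_weight v a" for a using un[of a] by simp
    have c0: "(d * d' - e) * ?u (ladder 0) \<le> d * d' * X v" "d * d' * X v \<le> (d * d' + e) * ?u (ladder 0)"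
      using compare[OF _ dd2(1) u[OF prof(1)] Xv] dd' by auto
    have "(d * d') ^ K * Y v \<le> (d * d') ^ K * (1 + e / 8)"
      using Yv dd' by (intro mult_left_mono) auto
    also have "\<dots> \<le> ((d * d') ^ K + e) * ?u (ladder k)"
      using compare(2)[OF _ dd2(2) u[OF prof(2)], of "1 + e / 8"] dd' e by simp
    finally have ck: "(d * d') ^ K * Y v \<le> ((d * d') ^ K + e) * ?u (ladder k)" .
    have "(d * d' - e) * (?u (ladder 0) * unit_weight v (ladder 0)) \<le> link_density g v (ladder 0)"
      "link_density g v (ladder 0) \<le> (d * d' + e) * (?u (ladder 0) * unit_weight v (ladder 0))"
      "link_density g v (ladder k) \<le> ((d * d') ^ K + e) * (?u (ladder k) * unit_weight v (ladder k))"
      unfolding gX gY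
      using mult_right_mono[OF c0(1) less_imp_le[OF un[of "ladder 0"]]]
        mult_right_mono[OF c0(2) less_imp_le[OF un[of "ladder 0"]]]
        mult_right_mono[OF ck less_imp_le[OF un[of "ladder k"]]]
      by (simp_all only: mult.assoc)
    then show ?thesis unfolding \<gamma>u[symmetric] K_def by blast
  qed
  moreover have "U \<subseteq> V 0" by (auto simp: U_def typical_def)
  ultimately show ?thesis using mass by blast
qed

end

section \<open>Regularity inheritance\<close>

text \<open>
  The hypothesis says that \<open>\<epsilon> powr (1/16)\<close> and \<open>\<eta> powr (1/32)\<close> are at most \<open>s\<close>. Since \<open>s ^ 8 \<le> z * d\<^sub>0 ^ K\<close>, the
  16th and the 32nd power of \<open>s\<close> are as small as the squares and fourth powers in the setting above
  require.
\<close>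

lemma small_parameters:
  fixes k :: nat
  assumes k: "1 \<le> k" and d0: "0 < d\<^sub>0" "d\<^sub>0 \<le> 1" and pos: "0 < \<epsilon>" "0 < \<eta>"
    and e: "0 < e" "e \<le> 1"
    and small: "2 ^ (2 ^ (k + 6)) * real k ^ 3 * (\<epsilon> powr (1/16) + \<eta> powr (1/32)) / d\<^sub>0 ^ (2 ^ (k + 1)) \<le> e"
  obtains r z where "0 < r" "r \<le> 1" "0 < z" "2 ^ 10 * 2 ^ k * z \<le> r * d\<^sub>0 ^ 2 ^ k"
    "\<epsilon> \<le> z\<^sup>2 * d\<^sub>0 ^ (2 * 2 ^ k)" "\<eta> \<le> z ^ 4" "2 ^ 22 * (2 ^ k)\<^sup>2 * r \<le> e ^ 6"
proof -
  define K where "K = (2 :: nat) ^ k"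
  define r where "r = e ^ 6 / (2 ^ 22 * (real K)\<^sup>2)"
  define z where "z = r * d\<^sub>0 ^ K / (2 ^ 10 * real K)"
  define s where "s = e * d\<^sub>0 ^ (2 * K) / 2 ^ (64 * K)"
  have K: "1 \<le> real K" by (simp add: K_def)
  have r: "0 < r" "r \<le> 1"
  proof -
    show "0 < r" using e K by (simp add: r_def)
    have "e ^ 6 \<le> 1" using e by (intro power_le_one) auto
    moreover have "1 * 1 \<le> 2 ^ 22 * (real K)\<^sup>2" using K by (intro mult_mono) auto
    ultimately show "r \<le> 1" using K by (simp add: r_def)
  qed
  have z: "0 < z" using r d0 K by (simp add: z_def)
  have D: "0 < d\<^sub>0 ^ (2 * K)" using d0 by simp
  have "2 ^ (64 * K) * (\<epsilon> powr (1/16) + \<eta> powr (1/32)) \<le>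
      2 ^ (64 * K) * real k ^ 3 * (\<epsilon> powr (1/16) + \<eta> powr (1/32))"
  proof -
    have "1 \<le> real k ^ 3" using k by simp
    then have "2 ^ (64 * K) * 1 \<le> 2 ^ (64 * K) * real k ^ 3" by (intro mult_left_mono) auto
    then show ?thesis by (intro mult_right_mono) auto
  qed
  also have "\<dots> \<le> e * d\<^sub>0 ^ (2 * K)"
  proof -
    have "(2 :: nat) ^ (k + 6) = 64 * K" "(2 :: nat) ^ (k + 1) = 2 * K" by (simp_all add: K_def power_add)
    then show ?thesis using small D by (simp add: pos_divide_le_eq)
  qed
  finally have sum: "\<epsilon> powr (1/16) + \<eta> powr (1/32) \<le> s"
    by (simp add: s_def pos_le_divide_eq mult.commute)
  have s: "0 < s" using e D by (simp add: s_def)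
  have s8: "s ^ 8 \<le> z * d\<^sub>0 ^ K"
  proof -
    have "real K \<le> 2 ^ K" using of_nat_less_two_power[of K, where 'a = real] by linarith
    then have "(real K) ^ 3 \<le> (2 ^ K) ^ 3" by (intro power_mono) auto
    then have "2 ^ 32 * (real K) ^ 3 \<le> 2 ^ (32 * K) * 2 ^ (3 * K)"
      using K by (intro mult_mono power_increasing)
        (auto simp: K_def simp flip: power_mult simp: mult.commute)
    also have "\<dots> \<le> 2 ^ (512 * K)" by (simp flip: power_add)
    finally have K3: "2 ^ 32 * (real K) ^ 3 \<le> 2 ^ (512 * K)" .
    have "s ^ 8 = e ^ 8 * d\<^sub>0 ^ (16 * K) / 2 ^ (512 * K)"
      by (simp add: s_def power_divide power_mult_distrib flip: power_mult)
    also have "\<dots> \<le> (e ^ 6 * d\<^sub>0 ^ (2 * K)) / (2 ^ 32 * (real K) ^ 3)"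
    proof (rule frac_le)
      show "e ^ 8 * d\<^sub>0 ^ (16 * K) \<le> e ^ 6 * d\<^sub>0 ^ (2 * K)"
        using e d0 by (intro mult_mono power_decreasing) auto
    qed (use e d0 K K3 in auto)
    also have "\<dots> = z * d\<^sub>0 ^ K"
      by (simp add: z_def r_def mult_2 power_add power2_eq_square power3_eq_cube)
    finally show ?thesis .
  qed
  have "\<epsilon> = (\<epsilon> powr (1/16)) ^ 16" using pos by (simp add: powr_power)
  also have "\<dots> \<le> s ^ 16" using sum by (intro power_mono) (auto simp: add_increasing2 intro: order_trans[rotated])
  also have "\<dots> = (s ^ 8)\<^sup>2" by (simp flip: power_mult)
  also have "\<dots> \<le> (z * d\<^sub>0 ^ K)\<^sup>2" using s8 s by (intro power_mono) auto
  also have "\<dots> = z\<^sup>2 * d\<^sub>0 ^ (2 * K)" by (simp add: power_mult_distrib mult.commute flip: power_mult)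
  finally have \<epsilon>: "\<epsilon> \<le> z\<^sup>2 * d\<^sub>0 ^ (2 * K)" .
  have "\<eta> = (\<eta> powr (1/32)) ^ 32" using pos by (simp add: powr_power)
  also have "\<dots> \<le> s ^ 32" using sum by (intro power_mono) (auto simp: add_increasing2 intro: order_trans[rotated])
  also have "\<dots> = (s ^ 8) ^ 4" by (simp flip: power_mult)
  also have "\<dots> \<le> (z * d\<^sub>0 ^ K) ^ 4" using s8 s by (intro power_mono) auto
  also have "\<dots> \<le> z ^ 4"
    using z d0 by (intro power_mono mult_left_le) (auto intro: power_le_one)
  finally have \<eta>: "\<eta> \<le> z ^ 4" .
  show ?thesis
  proof (rule that[of r z])
    show "2 ^ 10 * 2 ^ k * z \<le> r * d\<^sub>0 ^ 2 ^ k" by (simp add: z_def K_def)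
    show "2 ^ 22 * (2 ^ k)\<^sup>2 * r \<le> e ^ 6" by (simp add: r_def K_def)
  qed (use r z \<epsilon> \<eta> in \<open>simp_all add: K_def\<close>)
qed

theorem lemma8:
  fixes k :: nat
    and \<epsilon>' d\<^sub>0 \<epsilon> \<eta> d d' :: real
    and V :: "nat \<Rightarrow> 'a set"
    and p :: "nat set \<Rightarrow> real"
    and g \<gamma> :: "'a set \<Rightarrow> real"
  assumes k: "1 \<le> k"
    and eps': "0 < \<epsilon>'"
    and d0: "0 < d\<^sub>0" "d\<^sub>0 \<le> 1"
    and small: "0 < \<epsilon>" "0 < \<eta>"
      "min \<epsilon>' (1 / 2 ^ k) \<ge>
         2 ^ (2 ^ (k + 6)) * real k ^ 3 * (\<epsilon> powr (1/16) + \<eta> powr (1/32)) / d\<^sub>0 ^ (2 ^ (k + 1))"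
    and d: "d\<^sub>0 \<le> d" "d\<^sub>0 \<le> d'"
    and parts: "\<forall>j\<in>{0..k}. finite (V j) \<and> V j \<noteq> {}" "disjoint_family_on V {0..k}"
    and P: "density_graph {0..k} p"
    and G: "m_graph (k + 1) (\<Union>j\<in>{0..k}. V j) g"
    and Gamma: "m_graph (k + 1) (\<Union>j\<in>{0..k}. V j) \<gamma>"
    and le: "\<forall>e \<subseteq> (\<Union>j\<in>{0..k}. V j). g e \<le> \<gamma> e"
    and counts: "\<forall>R \<in> {plus2_octahedron k a | a. \<forall>j\<in>{1..k}. a j \<in> {0, 1, 2}}
                    \<union> {octahedron {0..k} b | b. \<forall>j\<in>{0..k}. b j \<in> {0, 1, 2}}.
      hom_density {0..k} V \<gamma> R
        \<in> {(1 - \<eta>) * (\<gamma> {} / p {} * density_graph_density {0..k} p R)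
           .. (1 + \<eta>) * (\<gamma> {} / p {} * density_graph_density {0..k} p R)}"
    and same: "\<forall>e. crossing {0..k} V e \<and> card e \<noteq> k + 1 \<and> e \<notin> transversals V {1..k}
                 \<longrightarrow> g e = \<gamma> e"
    and reg_top: "regular_wrt {0..k} V \<epsilon> d' (\<lambda>e. if card e = k + 1 then g e else \<gamma> e) \<gamma>"
    and reg_low: "regular_wrt {1..k} V \<epsilon> d g \<gamma>"
  shows "\<exists>V\<^sub>0' \<subseteq> V 0. vertex_weight (V 0) \<gamma> V\<^sub>0' \<ge> (1 - \<epsilon>') * vertex_weight (V 0) \<gamma> (V 0) \<and>
           (\<forall>v\<in>V\<^sub>0'. regular_wrt {1..k} V \<epsilon>' (d * d') (link g v) (link \<gamma> v))"
proof -
  have g: "0 \<le> g e \<and> g e \<le> \<gamma> e" if "e \<subseteq> (\<Union>j\<in>{0..k}. V j)" for e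
    using that G le by (simp add: m_graph_def weighted_hypergraph_def)
  have same': "g e = \<gamma> e"
    if "crossing {0..k} V e" "card e \<noteq> k + 1" "e \<notin> transversals V {1..k}" for e
    using same that by blast
  have V0: "finite (V 0)" "0 < card (V 0)" using parts(1) by (auto simp: card_gt_0_iff)
  have small_J: "e \<subseteq> (\<Union>j\<in>{0..k}. V j)" "insert v e \<subseteq> (\<Union>j\<in>{0..k}. V j)"
    if "e \<subseteq> (\<Union>j\<in>{1..k}. V j)" "v \<in> V 0" for e v
    using that by fastforce+
  have link_order: "0 \<le> link g v e \<and> link g v e \<le> link \<gamma> v e"
    if "e \<subseteq> (\<Union>j\<in>{1..k}. V j)" "v \<in> V 0" for e v
    using g[OF small_J(1)[OF that]] g[OF small_J(2)[OF that]] by (simp add: link_def mult_mono)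
  have below: "(card e < k \<longrightarrow> link g v e = link \<gamma> v e) \<and> link g v e \<le> link \<gamma> v e"
    if "v \<in> V 0" "crossing {1..k} V e" for v e
  proof (intro conjI impI)
    note link_below = link_below[of V k g \<gamma> v e, OF parts(2) g same' that]
    show "link g v e = link \<gamma> v e" if "card e < k" using that by (rule link_below(1)[rotated -1])
    show "link g v e \<le> link \<gamma> v e" by (rule link_below(2))
  qed
  have mass: "vertex_weight (V 0) \<gamma> U = (\<Sum>v\<in>U. \<gamma> {v} / real (card (V 0)))" if "U \<subseteq> V 0" for U
    by (rule vertex_weight_eq[OF V0(1) that])
  have oct: "(1 - \<eta>) * (\<gamma> {} / p {} * count (\<lambda>j. {j}) p (octv {0..k} a)) \<le> count V \<gamma> (octv {0..k} a) \<and>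
      count V \<gamma> (octv {0..k} a) \<le> (1 + \<eta>) * (\<gamma> {} / p {} * count (\<lambda>j. {j}) p (octv {0..k} a))"
    if "\<forall>j\<in>{0..k}. a j \<le> 2" for a
  proof -
    have "\<forall>j\<in>{0..k}. a j \<in> {0, 1, 2}"
    proof
      fix j assume "j \<in> {0..k}"
      then have "a j \<le> 2" using that by blast
      then show "a j \<in> {0, 1, 2}" by auto
    qed
    then have "octahedron {0..k} a \<in> {octahedron {0..k} b | b. \<forall>j\<in>{0..k}. b j \<in> {0, 1, 2}}" by blast
    then have "hom_density {0..k} V \<gamma> (octahedron {0..k} a) \<in>
        {(1 - \<eta>) * (\<gamma> {} / p {} * density_graph_density {0..k} p (octahedron {0..k} a))
         .. (1 + \<eta>) * (\<gamma> {} / p {} * density_graph_density {0..k} p (octahedron {0..k} a))}"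
      by (intro bspec[OF counts] UnI2)
    then show ?thesis by (simp only: atLeastAtMost_iff hom_density_octahedron)
  qed
  show ?thesis
  proof (cases "\<gamma> {} = 0 \<or> (\<exists>f\<subseteq>{0..k}. p f = 0)")
    case True
    \<comment> \<open>The counting hypothesis makes the average over \<open>v\<close> of these nonnegative numbers vanish.\<close>
    have zero: "count V (link \<gamma> v) (octv {1..k} a) = 0"
      if a: "\<forall>j\<in>{1..k}. 0 < a j \<and> a j \<le> 2" and v: "v \<in> V 0" for a v
    proof -
      have "0 < (a(0 := 1)) j" if "j \<in> {0..k}" for j
        using a that by (cases "j = 0") auto
      then have "\<gamma> {} = 0 \<or> count (\<lambda>j. {j}) p (octv {0..k} (a(0 := 1))) = 0"
        using True density_zero[of "{0..k}" _ p "a(0 := 1)"] by blast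
      moreover have "\<forall>j\<in>{0..k}. (a(0 := 1)) j \<le> 2" using a by auto
      ultimately have "count V \<gamma> (octv {0..k} (a(0 := 1))) = 0"
        using oct[of "a(0 := 1)"] by auto
      then have "avg (V 0) (\<lambda>v. count V (link \<gamma> v) (octv {1..k} a)) = 0"
        using avg_link[of V \<gamma> k a] V0(1) by simp
      then show ?thesis
      proof (rule avg_eq_0_D[where f = "\<lambda>v. count V (link \<gamma> v) (octv {1..k} a)", OF _ V0(1) _ v])
        fix v assume v: "v \<in> V 0"
        show "0 \<le> count V (link \<gamma> v) (octv {1..k} a)"
        proof (rule count_nonneg[OF _ fst_octv])
          show "0 \<le> link \<gamma> v e" if "e \<subseteq> (\<Union>j\<in>{1..k}. V j)" for e
            using link_order[OF that v] by linarith
        qed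
      qed
    qed
    have "regular_wrt {1..k} V \<epsilon>' (d * d') (link g v) (link \<gamma> v)" if v: "v \<in> V 0" for v
    proof -
      have "count V (link g v) (octv {1..k} a) = 0" if a: "\<forall>j\<in>{1..k}. 0 < a j \<and> a j \<le> 2" for a
      proof (rule antisym)
        show "0 \<le> count V (link g v) (octv {1..k} a)"
          by (rule count_nonneg[OF conjunct1[OF link_order[OF _ v]] fst_octv])
        have "count V (link g v) (octv {1..k} a) \<le> count V (link \<gamma> v) (octv {1..k} a)"
          by (rule count_mono[OF link_order[OF _ v] fst_octv])
        then show "count V (link g v) (octv {1..k} a) \<le> 0" using zero[OF a v] by simp
      qed
      then show ?thesis
        unfolding regular_wrt_def hom_density_octahedron using zero[OF _ v] below[OF v] by simp
    qed
    moreover have "(1 - \<epsilon>') * vertex_weight (V 0) \<gamma> (V 0) \<le> vertex_weight (V 0) \<gamma> (V 0)"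
    proof -
      have "0 \<le> \<gamma> {v}" if "v \<in> V 0" for v
        using g[of "{v}"] that by fastforce
      then have "0 \<le> vertex_weight (V 0) \<gamma> (V 0)"
        unfolding mass[OF subset_refl] by (intro sum_nonneg) auto
      then have "(1 - \<epsilon>') * vertex_weight (V 0) \<gamma> (V 0) \<le> 1 * vertex_weight (V 0) \<gamma> (V 0)"
        using eps' by (intro mult_right_mono) auto
      then show ?thesis by simp
    qed
    ultimately show ?thesis by blast
  next
    case False
    have p: "0 < p f" if "f \<subseteq> {0..k}" for f
    proof -
      have "p f \<noteq> 0" using False that by blast
      moreover have "0 \<le> p f" using P that unfolding density_graph_def weighted_hypergraph_def by blast
      ultimately show ?thesis by linarith
    qed
    have \<gamma>0: "0 < \<gamma> {}"
    proof -
      have "\<gamma> {} \<noteq> 0" using False by blast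
      moreover have "0 \<le> \<gamma> {}" using g[OF empty_subsetI] by linarith
      ultimately show ?thesis by linarith
    qed
    define e where "e = min \<epsilon>' (1 / 2 ^ k)"
    have e: "0 < e" "e \<le> 1 / 2" "e \<le> \<epsilon>'"
    proof -
      have "(2 :: real) \<le> 2 ^ k" using power_increasing[of 1 k "2 :: real"] k by simp
      then have "1 / 2 ^ k \<le> (1 / 2 :: real)" by (intro divide_left_mono) auto
      then show "e \<le> 1 / 2" unfolding e_def by linarith
      show "0 < e" "e \<le> \<epsilon>'" using eps' by (simp_all add: e_def)
    qed
    obtain r z where rz: "0 < r" "r \<le> 1" "0 < z" "2 ^ 10 * 2 ^ k * z \<le> r * d\<^sub>0 ^ 2 ^ k"
      "\<epsilon> \<le> z\<^sup>2 * d\<^sub>0 ^ (2 * 2 ^ k)" "\<eta> \<le> z ^ 4" "2 ^ 22 * (2 ^ k)\<^sup>2 * r \<le> e ^ 6"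
      by (rule small_parameters[OF k d0 small(1,2), of e]) (use small(3) e in \<open>auto simp: e_def\<close>)
    interpret inheritance k \<epsilon> \<eta> d\<^sub>0 d d' r z V p g \<gamma>
    proof
      show "hom_density {0..k} V \<gamma> (plus2_octahedron k a)
          \<le> (1 + \<eta>) * (\<gamma> {} / p {} * density_graph_density {0..k} p (plus2_octahedron k a))"
        if "\<forall>j\<in>{1..k}. a j \<le> 2" for a
      proof -
        have "\<forall>j\<in>{1..k}. a j \<in> {0, 1, 2}"
        proof
          fix j assume "j \<in> {1..k}"
          then have "a j \<le> 2" using that by blast
          then show "a j \<in> {0, 1, 2}" by auto
        qed
        then have "plus2_octahedron k a \<in> {plus2_octahedron k a | a. \<forall>j\<in>{1..k}. a j \<in> {0, 1, 2}}"
          by blast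
        then have "hom_density {0..k} V \<gamma> (plus2_octahedron k a) \<in>
            {(1 - \<eta>) * (\<gamma> {} / p {} * density_graph_density {0..k} p (plus2_octahedron k a))
             .. (1 + \<eta>) * (\<gamma> {} / p {} * density_graph_density {0..k} p (plus2_octahedron k a))}"
          by (intro bspec[OF counts] UnI1)
        then show ?thesis by (simp only: atLeastAtMost_iff)
      qed
    qed (use k d0 d rz small parts p \<gamma>0 g oct same' reg_top reg_low in auto)
    obtain U where U: "U \<subseteq> V 0" "(1 - e) * sum w (V 0) \<le> sum w U"
      "\<And>v. v \<in> U \<Longrightarrow> (d * d' - e) * link_density \<gamma> v (ladder 0) \<le> link_density g v (ladder 0) \<and>
        link_density g v (ladder 0) \<le> (d * d' + e) * link_density \<gamma> v (ladder 0) \<and>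
        link_density g v (ladder k) \<le> ((d * d') ^ 2 ^ k + e) * link_density \<gamma> v (ladder k)"
      using regular_links[OF e(1,2) rz(7)] by blast
    have "regular_wrt {1..k} V \<epsilon>' (d * d') (link g v) (link \<gamma> v)" if v: "v \<in> U" for v
    proof (rule regular_wrt_mono[OF _ e(3)])
      have v0: "v \<in> V 0" using v U(1) by blast
      show "regular_wrt {1..k} V e (d * d') (link g v) (link \<gamma> v)"
        unfolding regular_wrt_def hom_density_octahedron octv_ladder link_density_def[symmetric]
        using U(3)[OF v] below[OF v0] by simp
      show "0 \<le> link \<gamma> v e" if "e \<subseteq> (\<Union>j\<in>{1..k}. V j)" for e
        using link_order[OF that v0] by linarith
    qed
    moreover have "(1 - \<epsilon>') * vertex_weight (V 0) \<gamma> (V 0) \<le> vertex_weight (V 0) \<gamma> U"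
    proof -
      have "0 \<le> sum w (V 0)" using w_nonneg by (rule sum_nonneg)
      then have "(1 - \<epsilon>') * sum w (V 0) \<le> (1 - e) * sum w (V 0)"
        using e(3) by (intro mult_right_mono) auto
      then have "(1 - \<epsilon>') * sum w (V 0) \<le> sum w U" using U(2) by linarith
      then show ?thesis using mass[OF subset_refl] mass[OF U(1)] by (simp add: w_def[abs_def])
    qed
    ultimately show ?thesis using U(1) by blast
  qed
qed

end
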